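(* Assume that $\kappa_\star\ge2$. Let $\{\ell_N\}_{N\ge1}$ and $\{b_N(z)\}_{N\ge1}$, $z\in S\setminus S_\star$, be sequences with $\ell_N\to\infty$, $\ell_N/N\to0$ and $b_N(z)\to\infty$ for all $z\in S\setminus S_\star$ as $N\to\infty$. Fix a nonempty subset $S_\star^1\subsetneq S_\star$ and denote $S_\star^2=S_\star\setminus S_\star^1$. Then $$\lim_{N\to\infty}N^{1+\alpha}\,\mathrm{cap}_N\big(\mathscr E_N(S_\star^1),\mathscr E_N(S_\star^2)\big)=\frac1{M_\star\,\kappa_\star\,\Gamma(\alpha)\,I_\alpha}\sum_{x\in S_\star^1,\,y\in S_\star^2}\mathrm{cap}_S(x,y).$$
   Context: $S$ is a finite set of cardinality $\kappa\ge2$, $\alpha>1$ is a real number, and $r(x,y)\ge 0$ ($x\neq y\in S$) are the jump rates of an irreducible continuous-time random walk on $S$ that is reversible with respect to a probability measure $m$ on $S$: $m(x)r(x,y)=m(y)r(y,x)$. Put $M_\star=\max_{x\in S} m(x)$, $S_\star=\{x\in S:m(x)=M_\star\}$, $\kappa_\star=|S_\star|$, $m_\star(x)=m(x)/M_\star$. For $f:S\to\mathbb R$ let $D_S(f)=\frac12\sum_{x,y\in S}m(x)r(x,y)\{f(y)-f(x)\}^2$, and for $x\ne y$ in $S$ let $\mathrm{cap}_S(x,y)=\inf\{D_S(f): f:S\to\mathbb R,\ f(x)=1,\ f(y)=0\}$. $\mathbb N=\{0,1,2,\dots\}$, $E_N=\{\eta\in\mathbb N^S:\sum_{x\in S}\eta_x=N\}$,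 $a(0)=1$, $a(n)=n^\alpha$ for $n\ge1$, $g(0)=0$, $g(1)=1$, $g(n)=a(n)/a(n-1)$ for $n\ge2$. For $x\ne y$ and $\eta_x>0$, $\sigma^{xy}\eta$ is the configuration obtained from $\eta$ by moving one particle from $x$ to $y$. Let $\mu_N$ be the probability measure on $E_N$ $$\mu_N(\eta)=\frac{N^\alpha}{Z_{N,S}}\prod_{x\in S}\frac{m_\star(x)^{\eta_x}}{a(\eta_x)},\qquad Z_{N,S}=N^\alpha\sum_{\eta\in E_N}\prod_{x\in S}\frac{m_\star(x)^{\eta_x}}{a(\eta_x)} .$$ (It is the reversible invariant measure of the zero range process on $E_N$ in which a particle jumps from $x$ to $y$ at rate $g(\eta_x)r(x,y)$.) For $F:E_N\to\mathbb R$, $$D_N(F)=\frac12\sum_{x,y\in S,\,x\ne y}\ \sum_{\eta\in E_N}\mu_N(\eta)\,g(\eta_x)\,r(x,y)\{F(\sigma^{xy}\eta)-F(\eta)\}^2$$ (terms with $\eta_x=0$ vanish). For disjoint $A,B\subseteq E_N$, $\mathrm{cap}_N(A,B)=\inf\{D_N(F): F:E_N\to\mathbb R,\ F=1\text{ on }A,\ F=0\text{ on }B\}$. For $x\in S_\star$, $\mathscr E^x_N=\{\eta\in E_N:\eta_x\ge N-\ell_N,\ \eta_z\le b_N(z)\ \text{for all } z\in S\setminus S_\star\}$; for nonempty $S'\subseteq S_\star$, $\mathscr E_N(S')=\bigcup_{x\in S'}\mathscr E^x_N$. $N$ is taken large enough that the sets $\mathscr E^x_N$, $x\in S_\star$,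 are nonempty and pairwise disjoint. $I_\alpha=\int_0^1u^\alpha(1-u)^\alpha\,du$ and $\Gamma(\alpha)=\sum_{j\ge0}\frac1{a(j)}$ (not the Euler Gamma function). *)

theory Defs
  imports "HOL-Probability.Probability"
begin

text \<open>
  The finite set \<open>S\<close> is the universe of a type \<open>'s::finite\<close>. Jump rates are functions \<open>r\<close> of two
  sites; the values \<open>r x x\<close> are never constrained and contribute nothing below.
\<close>

definition jump_rates :: "('s \<Rightarrow> 's \<Rightarrow> real) \<Rightarrow> bool" where
  "jump_rates r \<longleftrightarrow> (\<forall>x y. x \<noteq> y \<longrightarrow> 0 \<le> r x y)"

definition irreducible_rates :: "('s \<Rightarrow> 's \<Rightarrow> real) \<Rightarrow> bool" where
  "irreducible_rates r \<longleftrightarrow> (\<forall>x y. (\<lambda>u v. u \<noteq> v \<and> 0 < r u v)\<^sup>*\<^sup>* x y)"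

definition reversible_rates :: "('s \<Rightarrow> 's \<Rightarrow> real) \<Rightarrow> 's pmf \<Rightarrow> bool" where
  "reversible_rates r m \<longleftrightarrow> (\<forall>x y. x \<noteq> y \<longrightarrow> pmf m x * r x y = pmf m y * r y x)"

definition M_star :: "('s::finite) pmf \<Rightarrow> real" where
  "M_star m = (MAX x. pmf m x)"

definition S_star :: "('s::finite) pmf \<Rightarrow> 's set" where
  "S_star m = {x. pmf m x = M_star m}"

definition kappa_star :: "('s::finite) pmf \<Rightarrow> nat" where
  "kappa_star m = card (S_star m)"

definition m_star :: "('s::finite) pmf \<Rightarrow> 's \<Rightarrow> real" where
  "m_star m x = pmf m x / M_star m"

definition dirichlet_S :: "('s \<Rightarrow> 's \<Rightarrow> real) \<Rightarrow> ('s::finite) pmf \<Rightarrow> ('s \<Rightarrow> real) \<Rightarrow> real" where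
  "dirichlet_S r m f = (1 / 2) * (\<Sum>x\<in>UNIV. \<Sum>y\<in>UNIV. pmf m x * r x y * (f y - f x)\<^sup>2)"

definition cap_S :: "('s \<Rightarrow> 's \<Rightarrow> real) \<Rightarrow> ('s::finite) pmf \<Rightarrow> 's \<Rightarrow> 's \<Rightarrow> real" where
  "cap_S r m x y = Inf {dirichlet_S r m f | f. f x = 1 \<and> f y = 0}"

definition zr_a :: "real \<Rightarrow> nat \<Rightarrow> real" where
  "zr_a \<alpha> n = (if n = 0 then 1 else real n powr \<alpha>)"

definition zr_g :: "real \<Rightarrow> nat \<Rightarrow> real" where
  "zr_g \<alpha> n = (if n = 0 then 0 else if n = 1 then 1 else zr_a \<alpha> n / zr_a \<alpha> (n - 1))"

definition configs :: "nat \<Rightarrow> (('s::finite) \<Rightarrow> nat) set" where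
  "configs N = {\<eta>. (\<Sum>x\<in>UNIV. \<eta> x) = N}"

text \<open>
  The particle move \<open>\<sigma>\<close> is meaningful only for \<open>x \<noteq> y\<close> and \<open>\<eta> x > 0\<close>. In the Dirichlet form
  below, the terms with \<open>\<eta> x = 0\<close> vanish because \<open>zr_g \<alpha> 0 = 0\<close>, so a function \<open>F\<close> is evaluated
  effectively only on \<open>configs N\<close>.
\<close>

definition move :: "'s \<Rightarrow> 's \<Rightarrow> ('s \<Rightarrow> nat) \<Rightarrow> ('s \<Rightarrow> nat)" where
  "move x y \<eta> = \<eta>(x := \<eta> x - 1, y := \<eta> y + 1)"

definition Z_N :: "real \<Rightarrow> ('s::finite) pmf \<Rightarrow> nat \<Rightarrow> real" where
  "Z_N \<alpha> m N =
     real N powr \<alpha> * (\<Sum>\<eta>\<in>configs N. \<Prod>x\<in>UNIV. m_star m x ^ \<eta> x / zr_a \<alpha> (\<eta> x))"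

definition mu_N :: "real \<Rightarrow> ('s::finite) pmf \<Rightarrow> nat \<Rightarrow> ('s \<Rightarrow> nat) \<Rightarrow> real" where
  "mu_N \<alpha> m N \<eta> =
     real N powr \<alpha> / Z_N \<alpha> m N * (\<Prod>x\<in>UNIV. m_star m x ^ \<eta> x / zr_a \<alpha> (\<eta> x))"

definition dirichlet_N ::
  "real \<Rightarrow> ('s \<Rightarrow> 's \<Rightarrow> real) \<Rightarrow> ('s::finite) pmf \<Rightarrow> nat \<Rightarrow> (('s \<Rightarrow> nat) \<Rightarrow> real) \<Rightarrow> real" where
  "dirichlet_N \<alpha> r m N F =
     (1 / 2) * (\<Sum>x\<in>UNIV. \<Sum>y\<in>UNIV - {x}. \<Sum>\<eta>\<in>configs N.
        mu_N \<alpha> m N \<eta> * zr_g \<alpha> (\<eta> x) * r x y * (F (move x y \<eta>) - F \<eta>)\<^sup>2)"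

text \<open>
  If \<open>A\<close> and \<open>B\<close> intersect, the infimum is over the empty set and has no meaning.
\<close>

definition cap_N ::
  "real \<Rightarrow> ('s \<Rightarrow> 's \<Rightarrow> real) \<Rightarrow> ('s::finite) pmf \<Rightarrow> nat \<Rightarrow> ('s \<Rightarrow> nat) set \<Rightarrow> ('s \<Rightarrow> nat) set \<Rightarrow> real"
where
  "cap_N \<alpha> r m N A B =
     Inf {dirichlet_N \<alpha> r m N F | F. (\<forall>\<eta>\<in>A. F \<eta> = 1) \<and> (\<forall>\<eta>\<in>B. F \<eta> = 0)}"

definition well ::
  "('s::finite) pmf \<Rightarrow> (nat \<Rightarrow> real) \<Rightarrow> (nat \<Rightarrow> 's \<Rightarrow> real) \<Rightarrow> nat \<Rightarrow> 's \<Rightarrow> ('s \<Rightarrow> nat) set" where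
  "well m l b N x =
     {\<eta> \<in> configs N. real (\<eta> x) \<ge> real N - l N \<and> (\<forall>z\<in>UNIV - S_star m. real (\<eta> z) \<le> b N z)}"

definition wells ::
  "('s::finite) pmf \<Rightarrow> (nat \<Rightarrow> real) \<Rightarrow> (nat \<Rightarrow> 's \<Rightarrow> real) \<Rightarrow> nat \<Rightarrow> 's set \<Rightarrow> ('s \<Rightarrow> nat) set" where
  "wells m l b N S' = (\<Union>x\<in>S'. well m l b N x)"

definition I_alpha :: "real \<Rightarrow> real" where
  "I_alpha \<alpha> = integral {0..1} (\<lambda>u. u powr \<alpha> * (1 - u) powr \<alpha>)"

definition Gamma_alpha :: "real \<Rightarrow> real" where
  "Gamma_alpha \<alpha> = (\<Sum>j. 1 / zr_a \<alpha> j)"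

end

theory Submission
  imports Defs "HOL-Real_Asymp.Real_Asymp"
begin

text \<open>
  The proof rests on one identity. Write \<open>w \<eta>\<close> for the product of the site weights
  \<open>m_star m x ^ \<eta> x / zr_a \<alpha> (\<eta> x)\<close>. A jump out of \<open>x\<close> is a particle on top of a configuration \<open>\<xi>\<close> of \<open>N - 1\<close>
  particles that moves from \<open>x\<close> to another site, and the rate \<open>g\<close> is chosen such that
  \<open>w (\<xi> + x) * g (\<xi> x + 1) = m_star m x * w \<xi>\<close>. Hence (\<open>dirichlet_N_eq_energy\<close>) the Dirichlet form of \<open>F\<close> is, up to
  the factor \<open>N powr \<alpha> / (M_star m * Z_N \<alpha> m N)\<close>, the sum over these \<open>\<xi>\<close> of \<open>w \<xi>\<close> times the Dirichlet form of the walk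
  on \<open>S\<close> at the function \<open>z \<mapsto> F (\<xi> + z)\<close>. Three limits are needed.

  \<^item> \<open>Z_N_LIMSEQ\<close>: almost all the mass has one condensate, on a site of \<open>S_star m\<close>, and boundedly many particles on
    each other site. So \<open>Z_N\<close> tends to the sum over \<open>x \<in> S_star m\<close> of the product of the series
    \<open>site_sum z\<close> over \<open>z \<noteq> x\<close>.

  \<^item> Lower bound (\<open>energy_ge\<close>): for \<open>x \<in> S1\<close> and \<open>y \<in> S2\<close> fix boundedly many particles off \<open>x\<close> and \<open>y\<close> and let the
    others go from \<open>y\<close> to \<open>x\<close> one at a time. The walk's Dirichlet form is at least
    \<open>cap_S r m x y * (F (\<xi> + x) - F (\<xi> + y))\<^sup>2\<close>, and \<open>\<xi> + x\<close>, \<open>\<xi> + y\<close> are consecutive on this path, along which \<open>F\<close> goes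
    from 0 to 1. Resistances in series give the sum of \<open>n powr \<alpha> * (N - n) powr \<alpha>\<close>, which is
    \<open>N powr (1 + 2 * \<alpha>) * I_alpha \<alpha>\<close> asymptotically. Paths for different pairs have no \<open>\<xi>\<close> in common, so
    their contributions add up.

  \<^item> Upper bound (\<open>energy_trial_le\<close>): the trial function is \<open>H (height \<eta> / N)\<close>, where \<open>H' u\<close> is proportional to
    \<open>u powr \<alpha> * (1 - u) powr \<alpha>\<close> except that \<open>H\<close> is constant near 0 and 1. When all but a few particles are on
    \<open>x \<in> S1\<close> and \<open>y \<in> S2\<close>, the height is linear in \<open>\<eta>\<close> with slope a function \<open>f x y\<close> of nearly minimal Dirichlet form
    for \<open>cap_S r m x y\<close>, so that \<open>\<xi>\<close> contributes about \<open>cap_S r m x y * (H' / N)\<^sup>2\<close>, as in the lower bound. The height is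
    Lipschitz everywhere; this makes the remaining configurations harmless, since they either carry
    little weight (three non-negligible sites, or many particles off \<open>S_star m\<close>) or see a constant trial function.

  Both bounds involve a truncation level \<open>L\<close> for the number of particles on a site without condensate. The limit
  \<open>N \<rightarrow> \<infinity>\<close> is taken first, then \<open>L \<rightarrow> \<infinity>\<close>, and in the upper bound the plateau width \<open>A\<close> of \<open>H\<close> goes to 0 last.
\<close>

section \<open>Iterated limits and sums over coverings\<close>

text \<open>The bounds below depend on a truncation level \<open>L\<close> and hold only for \<open>N\<close> large depending on \<open>L\<close>. Letting
  \<open>N\<close> and then \<open>L\<close> tend to their limits is still enough to bound a quantity that does not depend on \<open>L\<close>.\<close>

lemma eventually_greater_iterated_limit:
  fixes X :: "'b \<Rightarrow> real"
  assumes "F \<noteq> bot"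
    and "\<And>L. \<forall>\<^sub>F N in G. lo L N \<le> X N"
    and "\<And>L. (lo L \<longlongrightarrow> lo' L) G"
    and "(lo' \<longlongrightarrow> l) F" and "a < l"
  shows "\<forall>\<^sub>F N in G. a < X N"
proof -
  have "\<forall>\<^sub>F L in F. a < lo' L" using order_tendstoD(1)[OF assms(4,5)] .
  then obtain L where "a < lo' L" using assms(1) eventually_happens' by blast
  then have "\<forall>\<^sub>F N in G. a < lo L N" using order_tendstoD(1)[OF assms(3)] by blast
  with assms(2)[of L] show ?thesis by eventually_elim linarith
qed

lemma eventually_less_iterated_limit:
  fixes X :: "'b \<Rightarrow> real"
  assumes "F \<noteq> bot"
    and "\<And>L. \<forall>\<^sub>F N in G. X N \<le> hi L N"
    and "\<And>L. (hi L \<longlongrightarrow> hi' L) G"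
    and "(hi' \<longlongrightarrow> l) F" and "l < a"
  shows "\<forall>\<^sub>F N in G. X N < a"
proof -
  have "\<forall>\<^sub>F N in G. - a < - X N"
    using assms
    by (intro eventually_greater_iterated_limit[where F = F and lo = "\<lambda>L N. - hi L N"
          and lo' = "\<lambda>L. - hi' L" and l = "- l"]) (auto intro!: tendsto_intros)
  then show ?thesis by simp
qed

lemma sum_le_sum_cover:
  fixes f :: "'a \<Rightarrow> real"
  assumes "finite I" "\<And>i. i \<in> I \<Longrightarrow> finite (A i)" "S \<subseteq> (\<Union>i\<in>I. A i)"
    and "\<And>i x. i \<in> I \<Longrightarrow> x \<in> A i \<Longrightarrow> 0 \<le> f x"
  shows "sum f S \<le> (\<Sum>i\<in>I. sum f (A i))"
proof -
  have "sum f (\<Union>i\<in>I. A i) \<le> (\<Sum>i\<in>I. sum f (A i))"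
    using assms(1,2,4)
  proof (induction I rule: finite_induct)
    case (insert i I)
    have "sum f (A i \<union> (\<Union>j\<in>I. A j))
        = sum f (A i) + sum f (\<Union>j\<in>I. A j) - sum f (A i \<inter> (\<Union>j\<in>I. A j))"
      using insert by (subst sum_Un) auto
    moreover have "0 \<le> sum f (A i \<inter> (\<Union>j\<in>I. A j))"
      using insert.prems by (intro sum_nonneg) auto
    moreover have "sum f (\<Union>j\<in>I. A j) \<le> (\<Sum>j\<in>I. sum f (A j))"
      using insert.prems by (intro insert.IH) auto
    ultimately show ?case using insert.hyps by simp
  qed simp
  moreover have "sum f S \<le> sum f (\<Union>i\<in>I. A i)"
    using assms by (intro sum_mono2) auto
  ultimately show ?thesis by linarith
qed

lemma sum_le_sum_Un:
  fixes f :: "'a \<Rightarrow> real"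
  assumes "finite A" "finite B" "S \<subseteq> A \<union> B" "\<And>x. 0 \<le> f x"
  shows "sum f S \<le> sum f A + sum f B"
proof -
  have "sum f S \<le> sum f (A \<union> B)" using assms by (intro sum_mono2) auto
  also have "\<dots> = sum f A + sum f B - sum f (A \<inter> B)" using assms by (intro sum_Un)
  also have "\<dots> \<le> sum f A + sum f B" using assms(4) by (simp add: sum_nonneg)
  finally show ?thesis .
qed

lemma powr_mult_exponential_LIMSEQ:
  fixes \<rho> :: real
  assumes "0 < \<rho>" "\<rho> < 1" "0 < s"
  shows "(\<lambda>N. real N powr p * \<rho> powr (s * real N)) \<longlonglongrightarrow> 0"
proof -
  define c where "c = - s * ln \<rho>"
  have c: "0 < c" using assms by (simp add: c_def mult_pos_neg)
  have "(\<lambda>N. real N powr p * exp (- (c * real N))) \<longlonglongrightarrow> 0"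
    using c by real_asymp
  then show ?thesis using assms by (simp add: powr_def c_def mult_ac)
qed

lemma shifted_powr_ratio_LIMSEQ: "(\<lambda>N. real N powr p * (real N - c) powr - p) \<longlonglongrightarrow> (1 :: real)"
  by real_asymp

section \<open>Sums over configurations\<close>

lemma finite_configs [simp]: "finite (configs N :: ('s::finite \<Rightarrow> nat) set)"
proof (rule finite_subset)
  show "configs N \<subseteq> (PiE UNIV (\<lambda>_. {..N}) :: ('s \<Rightarrow> nat) set)"
    by (auto simp: configs_def PiE_def Pi_def intro: member_le_sum)
qed (simp add: finite_PiE)

lemma configs_le: "\<eta> \<in> configs N \<Longrightarrow> \<eta> (x :: 's::finite) \<le> N"
  by (auto simp: configs_def intro: member_le_sum)

lemma configs_coordinate:
  "\<eta> \<in> configs N \<Longrightarrow> \<eta> (x :: 's::finite) + (\<Sum>z\<in>UNIV - {x}. \<eta> z) = N"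
  by (simp add: configs_def sum.remove[symmetric])

lemma configs_coordinates:
  assumes "\<eta> \<in> configs N" "x \<noteq> (y :: 's::finite)"
  shows "\<eta> x + \<eta> y + (\<Sum>z\<in>UNIV - {x, y}. \<eta> z) = N"
proof -
  have "(\<Sum>z\<in>UNIV - {x}. \<eta> z) = \<eta> y + (\<Sum>z\<in>UNIV - {x} - {y}. \<eta> z)"
    using assms by (intro sum.remove) auto
  moreover have "UNIV - {x} - {y} = UNIV - {x, y}" by auto
  ultimately show ?thesis using configs_coordinate[OF assms(1), of x] by simp
qed

text \<open>The total number of particles determines \<open>\<eta> x\<close> from the other coordinates. So forgetting \<open>\<eta> x\<close> is
  injective, and a sum over configurations is at most a sum over a product set, which factorizes. All upper
  bounds on weights come from this, with \<open>x\<close> a site that carries many particles.\<close>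

lemma sum_configs_le:
  fixes G :: "('s::finite \<Rightarrow> nat) \<Rightarrow> real"
  assumes "A \<subseteq> configs N" and "0 \<le> C"
    and "\<And>z. finite (B z)" and "\<And>z n. 0 \<le> v z n"
    and "\<And>\<eta> z. \<eta> \<in> A \<Longrightarrow> z \<noteq> x \<Longrightarrow> \<eta> z \<in> B z"
    and "\<And>\<eta>. \<eta> \<in> A \<Longrightarrow> G \<eta> \<le> C * (\<Prod>z\<in>UNIV - {x}. v z (\<eta> z))"
  shows "sum G A \<le> C * (\<Prod>z\<in>UNIV - {x}. \<Sum>n\<in>B z. v z n)"
proof -
  let ?res = "\<lambda>\<eta>. restrict \<eta> (UNIV - {x})"
  have inj: "inj_on ?res A"
  proof (rule inj_onI)
    fix \<eta> \<xi> assume *: "\<eta> \<in> A" "\<xi> \<in> A" "?res \<eta> = ?res \<xi>"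
    have eq: "\<eta> z = \<xi> z" if "z \<noteq> x" for z
      using fun_cong[OF *(3), of z] that by simp
    then have "(\<Sum>z\<in>UNIV - {x}. \<eta> z) = (\<Sum>z\<in>UNIV - {x}. \<xi> z)" by (intro sum.cong) auto
    moreover have "\<eta> \<in> configs N" "\<xi> \<in> configs N" using * assms(1) by auto
    ultimately have "\<eta> x = \<xi> x"
      using configs_coordinate[of \<eta> N x] configs_coordinate[of \<xi> N x] by simp
    with eq show "\<eta> = \<xi>" by (metis ext)
  qed
  have "sum G A \<le> (\<Sum>\<eta>\<in>A. C * (\<Prod>z\<in>UNIV - {x}. v z (?res \<eta> z)))"
    using assms(6) by (intro sum_mono) simp
  also have "\<dots> = (\<Sum>\<zeta>\<in>?res ` A. C * (\<Prod>z\<in>UNIV - {x}. v z (\<zeta> z)))"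
    using inj by (simp add: sum.reindex)
  also have "\<dots> \<le> (\<Sum>\<zeta>\<in>PiE (UNIV - {x}) B. C * (\<Prod>z\<in>UNIV - {x}. v z (\<zeta> z)))"
  proof (rule sum_mono2)
    show "?res ` A \<subseteq> PiE (UNIV - {x}) B" using assms(5) by (simp add: image_subset_iff restrict_PiE_iff)
  qed (use assms(2-4) in \<open>auto intro!: finite_PiE mult_nonneg_nonneg prod_nonneg\<close>)
  also have "\<dots> = C * (\<Prod>z\<in>UNIV - {x}. \<Sum>n\<in>B z. v z n)"
    using assms(3) by (simp add: prod_sum_PiE sum_distrib_left)
  finally show ?thesis .
qed

section \<open>Site weights\<close>

lemma zr_a_pos [simp]: "0 < zr_a \<alpha> n"
  by (simp add: zr_a_def)

lemma zr_a_nonneg [simp]: "0 \<le> zr_a \<alpha> n"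
  using zr_a_pos[of \<alpha> n] by linarith

locale zero_range =
  fixes \<alpha> :: real and r :: "'s::finite \<Rightarrow> 's \<Rightarrow> real" and m :: "'s pmf"
  assumes alpha: "1 < \<alpha>" and rates: "jump_rates r"
begin

definition site_weight :: "'s \<Rightarrow> nat \<Rightarrow> real" where
  "site_weight z n = m_star m z ^ n / zr_a \<alpha> n"

definition weight :: "('s \<Rightarrow> nat) \<Rightarrow> real" where
  "weight \<eta> = (\<Prod>z\<in>UNIV. site_weight z (\<eta> z))"

definition site_sum :: "'s \<Rightarrow> real" where
  "site_sum z = (\<Sum>n. site_weight z n)"

abbreviation \<Gamma> :: real where "\<Gamma> \<equiv> Gamma_alpha \<alpha>"

definition Gamma_tail :: "nat \<Rightarrow> real" where
  "Gamma_tail L = \<Gamma> - (\<Sum>n\<le>L. 1 / zr_a \<alpha> n)"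

lemma M_star_ge: "pmf m x \<le> M_star m"
  by (simp add: M_star_def)

lemma M_star_pos: "0 < M_star m"
proof -
  obtain x where "x \<in> set_pmf m" using set_pmf_not_empty by fast
  then have "0 < pmf m x" by (simp add: pmf_positive)
  with M_star_ge[of x] show ?thesis by linarith
qed

lemma m_star_nonneg [simp]: "0 \<le> m_star m x"
  using M_star_pos by (simp add: m_star_def)

lemma m_star_le_1 [simp]: "m_star m x \<le> 1"
  using M_star_pos M_star_ge[of x] by (simp add: m_star_def divide_le_eq)

lemma m_star_eq_1: "x \<in> S_star m \<Longrightarrow> m_star m x = 1"
  using M_star_pos by (simp add: m_star_def S_star_def)

lemma m_star_off_star:
  obtains \<rho> where "0 < \<rho>" "\<rho> < 1" "\<And>x. x \<notin> S_star m \<Longrightarrow> m_star m x \<le> \<rho>"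
proof
  let ?A = "insert (1/2) (m_star m ` (- S_star m))"
  have lt: "m_star m x < 1" if "x \<notin> S_star m" for x
    using that M_star_pos M_star_ge[of x] by (simp add: m_star_def S_star_def divide_less_eq)
  have fin: "finite ?A" by simp
  show "0 < Max ?A" by (rule less_le_trans[OF _ Max_ge[OF fin, of "1/2"]]) auto
  show "Max ?A < 1" using lt by (subst Max_less_iff[OF fin]) auto
  show "m_star m x \<le> Max ?A" if "x \<notin> S_star m" for x
    using that by (intro Max_ge[OF fin]) auto
qed

lemma site_weight_0 [simp]: "site_weight z 0 = 1"
  by (simp add: site_weight_def zr_a_def)

lemma site_weight_nonneg [simp]: "0 \<le> site_weight z n"
  by (simp add: site_weight_def)

lemma site_weight_le: "site_weight z n \<le> 1 / zr_a \<alpha> n"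
  by (simp add: site_weight_def divide_right_mono power_le_one)

lemma site_weight_star: "z \<in> S_star m \<Longrightarrow> site_weight z n = 1 / zr_a \<alpha> n"
  by (simp add: site_weight_def m_star_eq_1)

lemma inverse_zr_a_le: "0 < t \<Longrightarrow> t \<le> real n \<Longrightarrow> 1 / zr_a \<alpha> n \<le> t powr - \<alpha>"
  using alpha by (auto simp: zr_a_def powr_minus_divide intro!: divide_left_mono powr_mono2)

lemma site_weight_le_powr: "0 < t \<Longrightarrow> t \<le> real n \<Longrightarrow> site_weight z n \<le> t powr - \<alpha>"
  using site_weight_le inverse_zr_a_le by (rule order_trans)

lemma zr_a_ge_1: "1 \<le> zr_a \<alpha> n"
  using alpha by (simp add: zr_a_def ge_one_powr_ge_zero)

lemma summable_zr_a: "summable (\<lambda>n. 1 / zr_a \<alpha> n)"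
proof -
  have "summable (\<lambda>n. real n powr - \<alpha>)"
    using alpha by (simp add: summable_real_powr_iff)
  then show ?thesis
    by (rule summable_cong[THEN iffD1, rotated])
       (auto simp: zr_a_def powr_minus_divide intro: eventually_mono[OF eventually_gt_at_top[of 0]])
qed

lemma summable_site_weight: "summable (site_weight z)"
  by (rule summable_comparison_test'[OF summable_zr_a, of 0]) (simp add: site_weight_le)

lemma sum_site_weight_le: "finite B \<Longrightarrow> (\<Sum>n\<in>B. site_weight z n) \<le> site_sum z"
  unfolding site_sum_def by (rule sum_le_suminf[OF summable_site_weight]) auto

lemma site_sum_le: "site_sum z \<le> \<Gamma>"
  unfolding site_sum_def Gamma_alpha_def
  by (rule suminf_le[OF site_weight_le summable_site_weight summable_zr_a])

lemma site_sum_star: "z \<in> S_star m \<Longrightarrow> site_sum z = \<Gamma>"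
  by (simp add: site_sum_def Gamma_alpha_def site_weight_star)

lemma site_sum_ge_1: "1 \<le> site_sum z"
  using sum_site_weight_le[of "{0}" z] by simp

lemma Gamma_ge_1: "1 \<le> \<Gamma>"
  using site_sum_ge_1 site_sum_le order_trans by blast

lemma site_sum_LIMSEQ: "(\<lambda>L. \<Sum>n\<le>L. site_weight z n) \<longlonglongrightarrow> site_sum z"
  unfolding site_sum_def by (rule summable_LIMSEQ'[OF summable_site_weight])

lemma Gamma_tail_LIMSEQ: "Gamma_tail \<longlonglongrightarrow> 0"
proof -
  have "Gamma_tail \<longlonglongrightarrow> \<Gamma> - \<Gamma>"
    unfolding Gamma_tail_def[abs_def] Gamma_alpha_def
    by (intro tendsto_intros summable_LIMSEQ'[OF summable_zr_a])
  then show ?thesis by simp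
qed

lemma sum_site_weight_le_tail:
  assumes "finite B" "B \<subseteq> {L<..}"
  shows "(\<Sum>n\<in>B. site_weight z n) \<le> Gamma_tail L"
proof -
  have "(\<Sum>n\<in>B. site_weight z n) + (\<Sum>n\<le>L. 1 / zr_a \<alpha> n)
      \<le> (\<Sum>n\<in>B. 1 / zr_a \<alpha> n) + (\<Sum>n\<le>L. 1 / zr_a \<alpha> n)"
    by (intro add_right_mono sum_mono site_weight_le)
  also have "\<dots> = (\<Sum>n\<in>B \<union> {..L}. 1 / zr_a \<alpha> n)"
    using assms by (intro sum.union_disjoint[symmetric]) auto
  also have "\<dots> \<le> \<Gamma>"
    unfolding Gamma_alpha_def using assms by (intro sum_le_suminf[OF summable_zr_a]) auto
  finally show ?thesis by (simp add: Gamma_tail_def)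
qed

lemma Gamma_tail_nonneg: "0 \<le> Gamma_tail L"
  using sum_site_weight_le_tail[of "{}" L] by simp

lemma weight_nonneg [simp]: "0 \<le> weight \<eta>"
  by (simp add: weight_def prod_nonneg)

lemma weight_remove: "weight \<eta> = site_weight x (\<eta> x) * (\<Prod>z\<in>UNIV - {x}. site_weight z (\<eta> z))"
  unfolding weight_def by (rule prod.remove) auto

lemma prod_le_Gamma_power:
  fixes A :: "'s set"
  assumes "\<And>z. z \<in> A \<Longrightarrow> 0 \<le> s z" "\<And>z. z \<in> A \<Longrightarrow> s z \<le> \<Gamma>"
  shows "(\<Prod>z\<in>A. s z) \<le> \<Gamma> ^ CARD('s)"
proof -
  have "(\<Prod>z\<in>A. s z) \<le> (\<Prod>z\<in>A. \<Gamma>)" using assms by (intro prod_mono) auto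
  also have "\<dots> \<le> \<Gamma> ^ CARD('s)"
    using Gamma_ge_1 card_mono[of UNIV A] by (simp add: power_increasing)
  finally show ?thesis .
qed

lemma sum_weight_off_star_le:
  assumes "A \<subseteq> configs N" "m_star m x \<le> \<rho>" "0 < \<rho>" "\<rho> < 1"
    and "\<And>\<eta>. \<eta> \<in> A \<Longrightarrow> t \<le> real (\<eta> x)"
  shows "sum weight A \<le> \<rho> powr t * \<Gamma> ^ CARD('s)"
proof -
  have le: "\<eta> z \<le> N" if "\<eta> \<in> A" for \<eta> z using that assms(1) configs_le by blast
  have "sum weight A \<le> \<rho> powr t * (\<Prod>z\<in>UNIV - {x}. \<Sum>n\<le>N. site_weight z n)"
  proof (rule sum_configs_le[OF assms(1)])
    fix \<eta> assume \<eta>: "\<eta> \<in> A"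
    have "site_weight x (\<eta> x) \<le> m_star m x ^ \<eta> x"
      unfolding site_weight_def
      using zr_a_ge_1[of "\<eta> x"] mult_left_mono[OF zr_a_ge_1[of "\<eta> x"], of "m_star m x ^ \<eta> x"]
      by (simp add: divide_le_eq)
    also have "\<dots> \<le> \<rho> ^ \<eta> x" using assms by (intro power_mono) auto
    also have "\<dots> = \<rho> powr real (\<eta> x)" using assms by (simp add: powr_realpow)
    also have "\<dots> \<le> \<rho> powr t" using assms \<eta> by (intro powr_mono') auto
    finally show "weight \<eta> \<le> \<rho> powr t * (\<Prod>z\<in>UNIV - {x}. site_weight z (\<eta> z))"
      unfolding weight_remove[of \<eta> x] by (intro mult_right_mono prod_nonneg) auto
  qed (use le in auto)
  also have "\<dots> \<le> \<rho> powr t * \<Gamma> ^ CARD('s)"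
    using sum_site_weight_le site_sum_le
    by (intro mult_left_mono prod_le_Gamma_power) (auto intro!: sum_nonneg intro: order_trans)
  finally show ?thesis .
qed

text \<open>The condensate at \<open>x\<close> costs \<open>t powr - \<alpha>\<close>, and more than \<open>L\<close> particles on \<open>y\<close> cost the tail of the
  convergent series \<open>\<Gamma>\<close>.\<close>

lemma sum_weight_two_sites_le:
  assumes "A \<subseteq> configs N" "x \<noteq> y" "0 < t"
    and "\<And>\<eta>. \<eta> \<in> A \<Longrightarrow> t \<le> real (\<eta> x) \<and> L < \<eta> y"
  shows "sum weight A \<le> t powr - \<alpha> * (Gamma_tail L * \<Gamma> ^ CARD('s))"
proof -
  define B where "B z = (if z = y then {L<..N} else {..N})" for z
  have le: "\<eta> z \<le> N" if "\<eta> \<in> A" for \<eta> z using that assms(1) configs_le by blast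
  have "sum weight A \<le> t powr - \<alpha> * (\<Prod>z\<in>UNIV - {x}. \<Sum>n\<in>B z. site_weight z n)"
  proof (rule sum_configs_le[OF assms(1)])
    fix \<eta> assume \<eta>: "\<eta> \<in> A"
    have "site_weight x (\<eta> x) \<le> t powr - \<alpha>"
      using assms \<eta> by (intro site_weight_le_powr) auto
    then show "weight \<eta> \<le> t powr - \<alpha> * (\<Prod>z\<in>UNIV - {x}. site_weight z (\<eta> z))"
      unfolding weight_remove[of \<eta> x] by (intro mult_right_mono prod_nonneg) auto
  qed (use assms(4) le in \<open>auto simp: B_def\<close>)
  also have "(\<Prod>z\<in>UNIV - {x}. \<Sum>n\<in>B z. site_weight z n)
      = (\<Sum>n\<in>B y. site_weight y n) * (\<Prod>z\<in>UNIV - {x} - {y}. \<Sum>n\<in>B z. site_weight z n)"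
    using assms by (intro prod.remove) auto
  also have "t powr - \<alpha> * \<dots> \<le> t powr - \<alpha> * (Gamma_tail L * \<Gamma> ^ CARD('s))"
    using sum_site_weight_le site_sum_le Gamma_tail_nonneg
    by (intro mult_left_mono mult_mono prod_le_Gamma_power sum_site_weight_le_tail)
       (auto simp: B_def intro!: sum_nonneg prod_nonneg intro: order_trans)
  finally show ?thesis .
qed

text \<open>Two condensates cost \<open>t powr - \<alpha>\<close> each, and the division of the particles between them gives at most \<open>N + 1\<close>
  choices. For \<open>t\<close> of order \<open>N\<close> this is of order \<open>N powr (1 - 2 * \<alpha>)\<close>, like the weight of the
  configurations that carry the main part of the energy; only the tail makes it negligible.\<close>

lemma sum_weight_three_sites_le:
  assumes "A \<subseteq> configs N" "x \<noteq> y" "x \<noteq> w" "y \<noteq> w" "0 < t"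
    and "\<And>\<eta>. \<eta> \<in> A \<Longrightarrow> t \<le> real (\<eta> x) \<and> t \<le> real (\<eta> y) \<and> L < \<eta> w"
  shows "sum weight A \<le> t powr - \<alpha> * ((real N + 1) * t powr - \<alpha> * (Gamma_tail L * \<Gamma> ^ CARD('s)))"
proof -
  define B where "B z = (if z = w then {L<..N} else if z = y then {n. n \<le> N \<and> t \<le> real n} else {..N})" for z
  have fB: "finite (B z)" for z by (auto simp: B_def)
  have le: "\<eta> z \<le> N" if "\<eta> \<in> A" for \<eta> z using that assms(1) configs_le by blast
  have "sum weight A \<le> t powr - \<alpha> * (\<Prod>z\<in>UNIV - {x}. \<Sum>n\<in>B z. site_weight z n)"
  proof (rule sum_configs_le[OF assms(1)])
    fix \<eta> assume \<eta>: "\<eta> \<in> A"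
    have "site_weight x (\<eta> x) \<le> t powr - \<alpha>"
      using assms \<eta> by (intro site_weight_le_powr) auto
    then show "weight \<eta> \<le> t powr - \<alpha> * (\<Prod>z\<in>UNIV - {x}. site_weight z (\<eta> z))"
      unfolding weight_remove[of \<eta> x] by (intro mult_right_mono prod_nonneg) auto
  qed (use assms(6) le fB in \<open>auto simp: B_def\<close>)
  also have "(\<Prod>z\<in>UNIV - {x}. \<Sum>n\<in>B z. site_weight z n)
      = (\<Sum>n\<in>B y. site_weight y n) * (\<Prod>z\<in>UNIV - {x} - {y}. \<Sum>n\<in>B z. site_weight z n)"
    using assms by (intro prod.remove) auto
  also have "(\<Prod>z\<in>UNIV - {x} - {y}. \<Sum>n\<in>B z. site_weight z n)
      = (\<Sum>n\<in>B w. site_weight w n) * (\<Prod>z\<in>UNIV - {x} - {y} - {w}. \<Sum>n\<in>B z. site_weight z n)"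
    using assms by (intro prod.remove) auto
  also have "t powr - \<alpha> * ((\<Sum>n\<in>B y. site_weight y n) * \<dots>)
     \<le> t powr - \<alpha> * ((real N + 1) * t powr - \<alpha> * (Gamma_tail L * \<Gamma> ^ CARD('s)))"
  proof (intro mult_left_mono mult_mono prod_le_Gamma_power sum_site_weight_le_tail)
    have "(\<Sum>n\<in>B y. site_weight y n) \<le> (\<Sum>n\<in>B y. t powr - \<alpha>)"
      using assms(4,5) by (intro sum_mono site_weight_le_powr) (auto simp: B_def)
    also have "\<dots> \<le> (real N + 1) * t powr - \<alpha>"
    proof -
      have "card (B y) \<le> card {..N}" using assms by (intro card_mono) (auto simp: B_def)
      then show ?thesis by (simp add: mult_right_mono flip: of_nat_Suc)
    qed
    finally show "(\<Sum>n\<in>B y. site_weight y n) \<le> (real N + 1) * t powr - \<alpha>" .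
  qed (use sum_site_weight_le site_sum_le Gamma_tail_nonneg Gamma_ge_1 fB in
       \<open>auto simp: B_def intro!: sum_nonneg prod_nonneg mult_nonneg_nonneg intro: order_trans\<close>)
  finally show ?thesis .
qed

end

section \<open>The partition function\<close>

context zero_range
begin

lemma Z_N_eq: "Z_N \<alpha> m N = real N powr \<alpha> * sum weight (configs N)"
  by (simp add: Z_N_def weight_def[abs_def] site_weight_def)

text \<open>For large \<open>L\<close> the configurations condensed at a site of \<open>S_star m\<close> carry almost all the mass.\<close>

definition condensed :: "'s \<Rightarrow> nat \<Rightarrow> nat \<Rightarrow> ('s \<Rightarrow> nat) set" where
  "condensed x N L = {\<eta> \<in> configs N. \<forall>z. z \<noteq> x \<longrightarrow> \<eta> z \<le> L}"

lemma sum_le_card_mult: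
  fixes \<eta> :: "'s \<Rightarrow> nat"
  assumes "\<And>z. z \<in> A \<Longrightarrow> \<eta> z \<le> L"
  shows "(\<Sum>z\<in>A. \<eta> z) \<le> CARD('s) * L"
proof -
  have "(\<Sum>z\<in>A. \<eta> z) \<le> of_nat (card A) * L" by (rule sum_bounded_above[OF assms])
  also have "\<dots> \<le> CARD('s) * L" by (simp add: card_mono)
  finally show ?thesis .
qed

lemma condensed_ge: "\<eta> \<in> condensed x N L \<Longrightarrow> N \<le> \<eta> x + CARD('s) * L"
  using configs_coordinate[of \<eta> N x] sum_le_card_mult[of "UNIV - {x}" \<eta> L]
  by (auto simp: condensed_def)

lemma sum_weight_condensed_ge:
  assumes "CARD('s) * L < N" "x \<in> S_star m"
  shows "(\<Prod>z\<in>UNIV - {x}. \<Sum>n\<le>L. site_weight z n) \<le> real N powr \<alpha> * sum weight (condensed x N L)"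
proof -
  let ?P = "PiE (UNIV - {x}) (\<lambda>_. {..L})"
  let ?f = "\<lambda>\<zeta>. \<zeta>(x := N - (\<Sum>z\<in>UNIV - {x}. \<zeta> z))"
  have small: "(\<Sum>z\<in>UNIV - {x}. \<zeta> z) < N" if "\<zeta> \<in> ?P" for \<zeta>
    using sum_le_card_mult[of "UNIV - {x}" \<zeta> L] that assms(1) by (auto simp: PiE_iff)
  have inj: "inj_on ?f ?P"
  proof (rule inj_onI)
    fix \<zeta> \<zeta>' assume *: "\<zeta> \<in> ?P" "\<zeta>' \<in> ?P" "?f \<zeta> = ?f \<zeta>'"
    have "\<zeta> z = \<zeta>' z" if "z \<in> UNIV - {x}" for z using fun_cong[OF *(3), of z] that by simp
    then show "\<zeta> = \<zeta>'" using * by (intro PiE_ext) auto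
  qed
  have sub: "?f ` ?P \<subseteq> condensed x N L"
  proof safe
    fix \<zeta> assume \<zeta>: "\<zeta> \<in> ?P"
    have "(\<Sum>z\<in>UNIV. ?f \<zeta> z) = ?f \<zeta> x + (\<Sum>z\<in>UNIV - {x}. ?f \<zeta> z)" by (intro sum.remove) auto
    also have "(\<Sum>z\<in>UNIV - {x}. ?f \<zeta> z) = (\<Sum>z\<in>UNIV - {x}. \<zeta> z)" by (intro sum.cong) auto
    finally have "?f \<zeta> \<in> configs N" using small[OF \<zeta>] by (simp add: configs_def)
    then show "?f \<zeta> \<in> condensed x N L" using \<zeta> by (auto simp: condensed_def PiE_iff)
  qed
  have "(\<Prod>z\<in>UNIV - {x}. \<Sum>n\<le>L. site_weight z n) = (\<Sum>\<zeta>\<in>?P. \<Prod>z\<in>UNIV - {x}. site_weight z (\<zeta> z))"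
    by (intro prod_sum_PiE) auto
  also have "\<dots> \<le> (\<Sum>\<zeta>\<in>?P. real N powr \<alpha> * weight (?f \<zeta>))"
  proof (rule sum_mono)
    fix \<zeta> assume \<zeta>: "\<zeta> \<in> ?P"
    define n where "n = N - (\<Sum>z\<in>UNIV - {x}. \<zeta> z)"
    have n: "0 < n" "n \<le> N" using small[OF \<zeta>] by (auto simp: n_def)
    have "zr_a \<alpha> n \<le> real N powr \<alpha>" using n alpha by (auto simp: zr_a_def intro!: powr_mono2)
    then have "1 \<le> real N powr \<alpha> * site_weight x n"
      using assms(2) by (simp add: site_weight_star le_divide_eq)
    moreover have "weight (?f \<zeta>) = site_weight x n * (\<Prod>z\<in>UNIV - {x}. site_weight z (\<zeta> z))"
      unfolding weight_remove[of _ x] n_def by simp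
    ultimately show "(\<Prod>z\<in>UNIV - {x}. site_weight z (\<zeta> z)) \<le> real N powr \<alpha> * weight (?f \<zeta>)"
      using mult_right_mono[of 1 "real N powr \<alpha> * site_weight x n" "\<Prod>z\<in>UNIV - {x}. site_weight z (\<zeta> z)"]
      by (simp add: prod_nonneg mult.assoc)
  qed
  also have "\<dots> = real N powr \<alpha> * sum weight (?f ` ?P)"
    using inj by (simp add: sum.reindex sum_distrib_left)
  also have "\<dots> \<le> real N powr \<alpha> * sum weight (condensed x N L)"
    using sub by (intro mult_left_mono sum_mono2) (auto simp: condensed_def)
  finally show ?thesis .
qed

lemma Z_N_ge:
  assumes "(CARD('s) + 1) * L < N"
  shows "(\<Sum>x\<in>S_star m. \<Prod>z\<in>UNIV - {x}. \<Sum>n\<le>L. site_weight z n) \<le> Z_N \<alpha> m N"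
proof -
  have "(\<Sum>x\<in>S_star m. \<Prod>z\<in>UNIV - {x}. \<Sum>n\<le>L. site_weight z n)
      \<le> (\<Sum>x\<in>S_star m. real N powr \<alpha> * sum weight (condensed x N L))"
    using assms by (intro sum_mono sum_weight_condensed_ge) auto
  also have "\<dots> = real N powr \<alpha> * sum weight (\<Union>x\<in>S_star m. condensed x N L)"
  proof -
    have "condensed x N L \<inter> condensed y N L = {}" if "x \<noteq> y" for x y
    proof safe
      fix \<eta> assume *: "\<eta> \<in> condensed x N L" "\<eta> \<in> condensed y N L"
      then have "\<eta> x \<le> L" using that by (auto simp: condensed_def)
      with condensed_ge[OF *(1)] assms show "\<eta> \<in> {}" by simp
    qed
    then have "(\<Sum>x\<in>S_star m. sum weight (condensed x N L)) = sum weight (\<Union>x\<in>S_star m. condensed x N L)"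
      by (intro sum.UNION_disjoint[symmetric]) (auto simp: condensed_def)
    then show ?thesis unfolding sum_distrib_left[symmetric] by simp
  qed
  also have "\<dots> \<le> Z_N \<alpha> m N"
    unfolding Z_N_eq by (intro mult_left_mono sum_mono2) (auto simp: condensed_def)
  finally show ?thesis .
qed

lemma exists_large_site:
  assumes "\<eta> \<in> configs N"
  obtains x where "real N / real CARD('s) \<le> real (\<eta> (x :: 's))"
proof (rule ccontr)
  assume "\<not> thesis"
  with that have "\<And>x. real (\<eta> x) < real N / real CARD('s)" using not_le by blast
  then have "(\<Sum>x\<in>UNIV. real (\<eta> x)) < (\<Sum>x\<in>(UNIV :: 's set). real N / real CARD('s))"
    by (intro sum_strict_mono) auto
  moreover have "(\<Sum>x\<in>UNIV. real (\<eta> x)) = real N"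
    using assms by (simp add: configs_def flip: of_nat_sum)
  ultimately show False by simp
qed

text \<open>Some site carries at least \<open>N / CARD('s)\<close> particles. Either it lies in \<open>S_star m\<close> and no other site exceeds
  \<open>L\<close>, or a second site exceeds \<open>L\<close>, or it lies off \<open>S_star m\<close>; the three terms bound the three cases.\<close>

lemma Z_N_le:
  assumes "CARD('s) * L < N" "0 < \<rho>" "\<rho> < 1" "\<And>x. x \<notin> S_star m \<Longrightarrow> m_star m x \<le> \<rho>"
  shows "Z_N \<alpha> m N \<le> real N powr \<alpha> *
    ((real N - CARD('s) * L) powr - \<alpha> * (\<Sum>x\<in>S_star m. \<Prod>z\<in>UNIV - {x}. site_sum z)
     + CARD('s)\<^sup>2 * ((real N / CARD('s)) powr - \<alpha> * (Gamma_tail L * \<Gamma> ^ CARD('s)))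
     + CARD('s) * (\<rho> powr (real N / CARD('s)) * \<Gamma> ^ CARD('s)))"
proof -
  let ?t = "real N / real CARD('s)"
  define Q where "Q p = {\<eta> \<in> configs N. ?t \<le> real (\<eta> (fst p)) \<and> L < \<eta> (snd p)}" for p :: "'s \<times> 's"
  define R where "R x = {\<eta> \<in> configs N. ?t \<le> real (\<eta> x)}" for x :: 's
  let ?I = "{p :: 's \<times> 's. fst p \<noteq> snd p}"
  have N: "0 < N" and t: "0 < ?t" using assms(1) by auto
  have P: "sum weight (\<Union>x\<in>S_star m. condensed x N L)
      \<le> (real N - CARD('s) * L) powr - \<alpha> * (\<Sum>x\<in>S_star m. \<Prod>z\<in>UNIV - {x}. site_sum z)"
  proof -
    have "sum weight (\<Union>x\<in>S_star m. condensed x N L) \<le> (\<Sum>x\<in>S_star m. sum weight (condensed x N L))"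
      by (rule sum_le_sum_cover) (auto simp: condensed_def)
    also have "\<dots> \<le> (\<Sum>x\<in>S_star m. (real N - CARD('s) * L) powr - \<alpha> * (\<Prod>z\<in>UNIV - {x}. site_sum z))"
    proof (rule sum_mono)
      fix x
      have "sum weight (condensed x N L)
          \<le> (real N - CARD('s) * L) powr - \<alpha> * (\<Prod>z\<in>UNIV - {x}. \<Sum>n\<le>L. site_weight z n)"
      proof (rule sum_configs_le)
        fix \<eta> assume \<eta>: "\<eta> \<in> condensed x N L"
        have "real N \<le> real (\<eta> x) + real (CARD('s) * L)"
          using condensed_ge[OF \<eta>] by (metis of_nat_add of_nat_le_iff)
        then have "site_weight x (\<eta> x) \<le> (real N - CARD('s) * L) powr - \<alpha>"
          using assms(1) by (intro site_weight_le_powr) (auto simp flip: of_nat_mult)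
        then show "weight \<eta> \<le> (real N - CARD('s) * L) powr - \<alpha> * (\<Prod>z\<in>UNIV - {x}. site_weight z (\<eta> z))"
          unfolding weight_remove[of \<eta> x] by (intro mult_right_mono prod_nonneg) auto
      qed (auto simp: condensed_def)
      also have "\<dots> \<le> (real N - CARD('s) * L) powr - \<alpha> * (\<Prod>z\<in>UNIV - {x}. site_sum z)"
        by (intro mult_left_mono prod_mono) (auto intro!: sum_site_weight_le sum_nonneg)
      finally show "sum weight (condensed x N L)
          \<le> (real N - CARD('s) * L) powr - \<alpha> * (\<Prod>z\<in>UNIV - {x}. site_sum z)" .
    qed
    finally show ?thesis by (simp add: sum_distrib_left)
  qed
  have Q: "sum weight (\<Union>p\<in>?I. Q p) \<le> CARD('s)\<^sup>2 * (?t powr - \<alpha> * (Gamma_tail L * \<Gamma> ^ CARD('s)))"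
  proof -
    have "sum weight (\<Union>p\<in>?I. Q p) \<le> (\<Sum>p\<in>?I. sum weight (Q p))"
      by (rule sum_le_sum_cover) (auto simp: Q_def)
    also have "\<dots> \<le> (\<Sum>p\<in>?I. ?t powr - \<alpha> * (Gamma_tail L * \<Gamma> ^ CARD('s)))"
      using t by (intro sum_mono sum_weight_two_sites_le[where N = N]) (auto simp: Q_def)
    also have "\<dots> \<le> (\<Sum>p\<in>(UNIV :: ('s \<times> 's) set). ?t powr - \<alpha> * (Gamma_tail L * \<Gamma> ^ CARD('s)))"
      using Gamma_tail_nonneg Gamma_ge_1 by (intro sum_mono2) auto
    finally show ?thesis by (simp add: card_prod power2_eq_square)
  qed
  have R: "sum weight (\<Union>x\<in>-S_star m. R x) \<le> CARD('s) * (\<rho> powr ?t * \<Gamma> ^ CARD('s))"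
  proof -
    have "sum weight (\<Union>x\<in>-S_star m. R x) \<le> (\<Sum>x\<in>-S_star m. sum weight (R x))"
      by (rule sum_le_sum_cover) (auto simp: R_def)
    also have "\<dots> \<le> (\<Sum>x\<in>-S_star m. \<rho> powr ?t * \<Gamma> ^ CARD('s))"
      using assms by (intro sum_mono sum_weight_off_star_le[where N = N]) (auto simp: R_def)
    also have "\<dots> \<le> (\<Sum>x\<in>(UNIV :: 's set). \<rho> powr ?t * \<Gamma> ^ CARD('s))"
      using Gamma_ge_1 by (intro sum_mono2) auto
    finally show ?thesis by simp
  qed
  have cover: "configs N \<subseteq> (\<Union>x\<in>S_star m. condensed x N L) \<union> ((\<Union>p\<in>?I. Q p) \<union> (\<Union>x\<in>-S_star m. R x))"
  proof
    fix \<eta> :: "'s \<Rightarrow> nat" assume \<eta>: "\<eta> \<in> configs N"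
    obtain x where x: "?t \<le> real (\<eta> x)" using exists_large_site[OF \<eta>] .
    show "\<eta> \<in> (\<Union>x\<in>S_star m. condensed x N L) \<union> ((\<Union>p\<in>?I. Q p) \<union> (\<Union>x\<in>-S_star m. R x))"
    proof (cases "x \<in> S_star m \<and> \<not> (\<exists>y. y \<noteq> x \<and> L < \<eta> y)")
      case True
      then have "\<eta> \<in> condensed x N L" using \<eta> by (auto simp: condensed_def not_less)
      then show ?thesis using True by blast
    next
      case False
      then consider "\<eta> \<in> R x" "x \<notin> S_star m" | y where "y \<noteq> x" "\<eta> \<in> Q (x, y)"
        using \<eta> x by (auto simp: R_def Q_def)
      then show ?thesis
      proof cases
        case 2
        then have "(x, y) \<in> ?I" by simp
        with 2 show ?thesis by blast
      qed blast
    qed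
  qed
  have "sum weight (configs N) \<le> sum weight (\<Union>x\<in>S_star m. condensed x N L)
      + sum weight ((\<Union>p\<in>?I. Q p) \<union> (\<Union>x\<in>-S_star m. R x))"
    using cover by (intro sum_le_sum_Un) (auto simp: condensed_def Q_def R_def)
  also have "sum weight ((\<Union>p\<in>?I. Q p) \<union> (\<Union>x\<in>-S_star m. R x))
      \<le> sum weight (\<Union>p\<in>?I. Q p) + sum weight (\<Union>x\<in>-S_star m. R x)"
    by (intro sum_le_sum_Un) (auto simp: Q_def R_def)
  finally have "sum weight (configs N)
    \<le> (real N - CARD('s) * L) powr - \<alpha> * (\<Sum>x\<in>S_star m. \<Prod>z\<in>UNIV - {x}. site_sum z)
     + CARD('s)\<^sup>2 * (?t powr - \<alpha> * (Gamma_tail L * \<Gamma> ^ CARD('s)))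
     + CARD('s) * (\<rho> powr ?t * \<Gamma> ^ CARD('s))"
    using P Q R by linarith
  then show ?thesis unfolding Z_N_eq by (intro mult_left_mono) auto
qed

lemma Z_N_LIMSEQ: "Z_N \<alpha> m \<longlonglongrightarrow> (\<Sum>x\<in>S_star m. \<Prod>z\<in>UNIV - {x}. site_sum z)"
proof (rule order_tendstoI)
  fix a assume "a < (\<Sum>x\<in>S_star m. \<Prod>z\<in>UNIV - {x}. site_sum z)"
  then show "\<forall>\<^sub>F N in sequentially. a < Z_N \<alpha> m N"
  proof (rule eventually_greater_iterated_limit[where F = sequentially, rotated 4])
    show "\<forall>\<^sub>F N in sequentially. (\<Sum>x\<in>S_star m. \<Prod>z\<in>UNIV - {x}. \<Sum>n\<le>L. site_weight z n) \<le> Z_N \<alpha> m N" for L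
      using eventually_gt_at_top by eventually_elim (rule Z_N_ge)
  qed (auto intro!: tendsto_intros site_sum_LIMSEQ)
next
  fix a assume a: "(\<Sum>x\<in>S_star m. \<Prod>z\<in>UNIV - {x}. site_sum z) < a"
  obtain \<rho> where \<rho>: "0 < \<rho>" "\<rho> < 1" "\<And>x. x \<notin> S_star m \<Longrightarrow> m_star m x \<le> \<rho>"
    using m_star_off_star by blast
  let ?k = "real CARD('s)"
  let ?s = "\<Sum>x\<in>S_star m. \<Prod>z\<in>UNIV - {x}. site_sum z"
  show "\<forall>\<^sub>F N in sequentially. Z_N \<alpha> m N < a"
    using a
  proof (rule eventually_less_iterated_limit[where F = sequentially
      and hi = "\<lambda>L N. (real N powr \<alpha> * (real N - CARD('s) * L) powr - \<alpha>) * ?s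
        + ?k\<^sup>2 * (?k powr \<alpha> * (Gamma_tail L * \<Gamma> ^ CARD('s)))
        + ?k * \<Gamma> ^ CARD('s) * (real N powr \<alpha> * \<rho> powr (1 / ?k * real N))"
      and hi' = "\<lambda>L. 1 * ?s + ?k\<^sup>2 * (?k powr \<alpha> * (Gamma_tail L * \<Gamma> ^ CARD('s)))
        + ?k * \<Gamma> ^ CARD('s) * 0", rotated 4])
    fix L
    show "\<forall>\<^sub>F N in sequentially. Z_N \<alpha> m N
       \<le> (real N powr \<alpha> * (real N - CARD('s) * L) powr - \<alpha>) * ?s
        + ?k\<^sup>2 * (?k powr \<alpha> * (Gamma_tail L * \<Gamma> ^ CARD('s)))
        + ?k * \<Gamma> ^ CARD('s) * (real N powr \<alpha> * \<rho> powr (1 / ?k * real N))"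
      using eventually_gt_at_top[of "CARD('s) * L"]
    proof eventually_elim
      case (elim N)
      have "real N powr \<alpha> * (real N / ?k) powr - \<alpha> = ?k powr \<alpha>"
        using elim by (simp add: powr_divide powr_minus field_simps)
      moreover have "a * (u * s + k * (t * G) + j * (w * P)) = (a * u) * s + k * ((a * t) * G) + j * P * (a * w)"
        for a u s k t G j w P :: real by (simp add: algebra_simps)
      ultimately show ?case using Z_N_le[OF elim \<rho>] by simp
    qed
  next
    fix L
    show "(\<lambda>N. (real N powr \<alpha> * (real N - CARD('s) * L) powr - \<alpha>) * ?s
        + ?k\<^sup>2 * (?k powr \<alpha> * (Gamma_tail L * \<Gamma> ^ CARD('s)))
        + ?k * \<Gamma> ^ CARD('s) * (real N powr \<alpha> * \<rho> powr (1 / ?k * real N)))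
      \<longlonglongrightarrow> 1 * ?s + ?k\<^sup>2 * (?k powr \<alpha> * (Gamma_tail L * \<Gamma> ^ CARD('s)))
        + ?k * \<Gamma> ^ CARD('s) * 0"
      using \<rho> by (intro tendsto_intros shifted_powr_ratio_LIMSEQ powr_mult_exponential_LIMSEQ) auto
  next
    have "(\<lambda>L. 1 * ?s + ?k\<^sup>2 * (?k powr \<alpha> * (Gamma_tail L * \<Gamma> ^ CARD('s)))
        + ?k * \<Gamma> ^ CARD('s) * 0)
      \<longlonglongrightarrow> 1 * ?s + ?k\<^sup>2 * (?k powr \<alpha> * (0 * \<Gamma> ^ CARD('s))) + ?k * \<Gamma> ^ CARD('s) * 0"
      by (intro tendsto_intros Gamma_tail_LIMSEQ)
    then show "(\<lambda>L. 1 * ?s + ?k\<^sup>2 * (?k powr \<alpha> * (Gamma_tail L * \<Gamma> ^ CARD('s)))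
        + ?k * \<Gamma> ^ CARD('s) * 0) \<longlonglongrightarrow> ?s" by simp
  qed simp
qed

end

section \<open>The Dirichlet form on configurations\<close>

definition add_particle :: "('s \<Rightarrow> nat) \<Rightarrow> 's \<Rightarrow> ('s \<Rightarrow> nat)" where
  "add_particle \<xi> z = \<xi>(z := \<xi> z + 1)"

lemma add_particle_configs: "\<xi> \<in> configs N \<Longrightarrow> add_particle \<xi> (z :: 's::finite) \<in> configs (Suc N)"
proof -
  assume \<xi>: "\<xi> \<in> configs N"
  have "(\<Sum>w\<in>UNIV. add_particle \<xi> z w) = add_particle \<xi> z z + (\<Sum>w\<in>UNIV - {z}. add_particle \<xi> z w)"
    by (rule sum.remove) auto
  also have "(\<Sum>w\<in>UNIV - {z}. add_particle \<xi> z w) = (\<Sum>w\<in>UNIV - {z}. \<xi> w)"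
    by (rule sum.cong) (auto simp: add_particle_def)
  finally show ?thesis
    using configs_coordinate[OF \<xi>, of z] by (simp add: configs_def add_particle_def)
qed

lemma bij_betw_add_particle:
  "bij_betw (\<lambda>\<xi>. add_particle \<xi> x) (configs N) {\<eta> \<in> configs (Suc N). 0 < \<eta> (x :: 's::finite)}"
proof (rule bij_betwI[where g = "\<lambda>\<eta>. \<eta>(x := \<eta> x - 1)"])
  show "(\<lambda>\<eta>. \<eta>(x := \<eta> x - 1)) \<in> {\<eta> \<in> configs (Suc N). 0 < \<eta> x} \<rightarrow> configs N"
  proof safe
    fix \<eta> :: "'s \<Rightarrow> nat" assume \<eta>: "\<eta> \<in> configs (Suc N)" "0 < \<eta> x"
    have "(\<Sum>w\<in>UNIV. (\<eta>(x := \<eta> x - 1)) w) = (\<eta> x - 1) + (\<Sum>w\<in>UNIV - {x}. (\<eta>(x := \<eta> x - 1)) w)"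
      by (subst sum.remove[of _ x]) auto
    also have "(\<Sum>w\<in>UNIV - {x}. (\<eta>(x := \<eta> x - 1)) w) = (\<Sum>w\<in>UNIV - {x}. \<eta> w)"
      by (rule sum.cong) auto
    finally show "\<eta>(x := \<eta> x - 1) \<in> configs N"
      using configs_coordinate[OF \<eta>(1), of x] \<eta>(2) by (simp add: configs_def)
  qed
qed (auto simp: add_particle_configs, auto simp: add_particle_def)

context zero_range
begin

text \<open>The sum runs over the configurations of the particles that stay put during a jump.\<close>

definition energy :: "nat \<Rightarrow> (('s \<Rightarrow> nat) \<Rightarrow> real) \<Rightarrow> real" where
  "energy M F = (\<Sum>\<xi>\<in>configs M. weight \<xi> * dirichlet_S r m (\<lambda>z. F (add_particle \<xi> z)))"

text \<open>The rate \<open>g\<close> is a ratio of consecutive values of \<open>a\<close>, so it cancels the change of weight caused by the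
  additional particle.\<close>

lemma weight_add_particle_rate:
  "weight (add_particle \<xi> x) * zr_g \<alpha> (add_particle \<xi> x x) = m_star m x * weight \<xi>"
proof -
  have "site_weight x (Suc n) * zr_g \<alpha> (Suc n) = m_star m x * site_weight x n" for n
    by (auto simp: site_weight_def zr_g_def zr_a_def)
  moreover have "(\<Prod>z\<in>UNIV - {x}. site_weight z (add_particle \<xi> x z)) = (\<Prod>z\<in>UNIV - {x}. site_weight z (\<xi> z))"
    by (rule prod.cong) (auto simp: add_particle_def)
  ultimately show ?thesis
    unfolding weight_remove[of _ x] by (simp add: add_particle_def mult_ac)
qed

lemma dirichlet_S_eq:
  "dirichlet_S r m f = (1 / 2) * (\<Sum>x\<in>UNIV. \<Sum>y\<in>UNIV - {x}. pmf m x * r x y * (f y - f x)\<^sup>2)"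
proof -
  have "(\<Sum>y\<in>UNIV. pmf m x * r x y * (f y - f x)\<^sup>2) = (\<Sum>y\<in>UNIV - {x}. pmf m x * r x y * (f y - f x)\<^sup>2)" for x
    by (subst sum.remove[of UNIV x]) auto
  then show ?thesis by (simp add: dirichlet_S_def)
qed

lemma rate_nonneg: "y \<noteq> x \<Longrightarrow> 0 \<le> pmf m x * r x y"
  using rates by (auto simp: jump_rates_def)

lemma dirichlet_S_nonneg [simp]: "0 \<le> dirichlet_S r m f"
  unfolding dirichlet_S_eq by (auto intro!: sum_nonneg mult_nonneg_nonneg rate_nonneg)

lemma dirichlet_S_mono:
  assumes "\<And>x y. \<bar>f y - f x\<bar> \<le> c * \<bar>g y - g x\<bar>"
  shows "dirichlet_S r m f \<le> c\<^sup>2 * dirichlet_S r m g"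
proof -
  have "(\<Sum>x\<in>UNIV. \<Sum>y\<in>UNIV - {x}. pmf m x * r x y * (f y - f x)\<^sup>2)
      \<le> (\<Sum>x\<in>UNIV. \<Sum>y\<in>UNIV - {x}. pmf m x * r x y * (c\<^sup>2 * (g y - g x)\<^sup>2))"
  proof (intro sum_mono mult_left_mono)
    fix x y
    have "(f y - f x)\<^sup>2 \<le> (c * \<bar>g y - g x\<bar>)\<^sup>2"
      using power_mono[OF assms[of y x], of 2] by simp
    then show "(f y - f x)\<^sup>2 \<le> c\<^sup>2 * (g y - g x)\<^sup>2" by (simp add: power_mult_distrib)
  qed (auto intro: rate_nonneg)
  also have "\<dots> = c\<^sup>2 * (\<Sum>x\<in>UNIV. \<Sum>y\<in>UNIV - {x}. pmf m x * r x y * (g y - g x)\<^sup>2)"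
    by (simp add: sum_distrib_left mult_ac)
  finally show ?thesis unfolding dirichlet_S_eq by simp
qed

definition rate_sum :: real where
  "rate_sum = (1 / 2) * (\<Sum>x\<in>UNIV. \<Sum>y\<in>UNIV - {x}. pmf m x * r x y)"

lemma rate_sum_nonneg: "0 \<le> rate_sum"
  unfolding rate_sum_def by (intro mult_nonneg_nonneg sum_nonneg rate_nonneg) auto

lemma dirichlet_S_le:
  assumes "\<And>x y. \<bar>f y - f x\<bar> \<le> c"
  shows "dirichlet_S r m f \<le> c\<^sup>2 * rate_sum"
proof -
  have "(\<Sum>x\<in>UNIV. \<Sum>y\<in>UNIV - {x}. pmf m x * r x y * (f y - f x)\<^sup>2)
      \<le> (\<Sum>x\<in>UNIV. \<Sum>y\<in>UNIV - {x}. pmf m x * r x y * c\<^sup>2)"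
  proof (intro sum_mono mult_left_mono)
    show "(f y - f x)\<^sup>2 \<le> c\<^sup>2" for x y using power_mono[OF assms[of y x], of 2] by simp
  qed (auto intro: rate_nonneg)
  also have "\<dots> = c\<^sup>2 * (\<Sum>x\<in>UNIV. \<Sum>y\<in>UNIV - {x}. pmf m x * r x y)"
    by (simp add: sum_distrib_left mult_ac)
  finally show ?thesis unfolding dirichlet_S_eq rate_sum_def by simp
qed

lemma dirichlet_N_eq_energy:
  "dirichlet_N \<alpha> r m (Suc M) F = real (Suc M) powr \<alpha> / (Z_N \<alpha> m (Suc M) * M_star m) * energy M F"
proof -
  let ?c = "real (Suc M) powr \<alpha> / Z_N \<alpha> m (Suc M)"
  have "(\<Sum>\<eta>\<in>configs (Suc M). mu_N \<alpha> m (Suc M) \<eta> * zr_g \<alpha> (\<eta> x) * r x y * (F (move x y \<eta>) - F \<eta>)\<^sup>2)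
    = (\<Sum>\<xi>\<in>configs M. ?c / M_star m * weight \<xi> * (pmf m x * r x y *
          (F (add_particle \<xi> y) - F (add_particle \<xi> x))\<^sup>2))" (is "?l = ?r") if "y \<noteq> x" for x y
  proof -
    let ?h = "\<lambda>\<eta>. mu_N \<alpha> m (Suc M) \<eta> * zr_g \<alpha> (\<eta> x) * r x y * (F (move x y \<eta>) - F \<eta>)\<^sup>2"
    have "?l = sum ?h {\<eta> \<in> configs (Suc M). 0 < \<eta> x}"
      by (rule sum.mono_neutral_right) (auto simp: zr_g_def)
    also have "\<dots> = (\<Sum>\<xi>\<in>configs M. ?h (add_particle \<xi> x))"
      by (rule sum.reindex_bij_betw[OF bij_betw_add_particle, symmetric])
    also have "\<dots> = ?r"
    proof (rule sum.cong)
      fix \<xi> :: "'s \<Rightarrow> nat"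
      have "move x y (add_particle \<xi> x) = add_particle \<xi> y"
        using that by (auto simp: move_def add_particle_def)
      moreover have "mu_N \<alpha> m (Suc M) (add_particle \<xi> x) * zr_g \<alpha> (add_particle \<xi> x x)
          = ?c / M_star m * weight \<xi> * pmf m x"
      proof -
        have "mu_N \<alpha> m (Suc M) (add_particle \<xi> x) = ?c * weight (add_particle \<xi> x)"
          by (simp add: mu_N_def weight_def site_weight_def)
        then have "mu_N \<alpha> m (Suc M) (add_particle \<xi> x) * zr_g \<alpha> (add_particle \<xi> x x)
            = ?c * (m_star m x * weight \<xi>)"
          by (simp only: mult.assoc weight_add_particle_rate)
        then show ?thesis by (simp add: m_star_def mult_ac)
      qed
      ultimately show "?h (add_particle \<xi> x) = ?c / M_star m * weight \<xi> * (pmf m x * r x y *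
          (F (add_particle \<xi> y) - F (add_particle \<xi> x))\<^sup>2)" by simp
    qed simp
    finally show ?thesis .
  qed
  then have "dirichlet_N \<alpha> r m (Suc M) F = (1 / 2) * (\<Sum>x\<in>UNIV. \<Sum>y\<in>UNIV - {x}. \<Sum>\<xi>\<in>configs M.
      ?c / M_star m * weight \<xi> * (pmf m x * r x y * (F (add_particle \<xi> y) - F (add_particle \<xi> x))\<^sup>2))"
    unfolding dirichlet_N_def
    by (rule arg_cong2[of _ _ _ _ "(*)", OF refl sum.cong[OF refl sum.cong[OF refl]]]) auto
  also have "\<dots> = (1 / 2) * (\<Sum>\<xi>\<in>configs M. \<Sum>x\<in>UNIV. \<Sum>y\<in>UNIV - {x}.
      ?c / M_star m * weight \<xi> * (pmf m x * r x y * (F (add_particle \<xi> y) - F (add_particle \<xi> x))\<^sup>2))"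
    by (subst sum.swap[of _ "configs M"], subst sum.swap[of _ "configs M"]) simp
  also have "\<dots> = ?c / M_star m * energy M F"
    unfolding energy_def dirichlet_S_eq by (simp add: sum_distrib_left mult_ac)
  finally show ?thesis by simp
qed

lemma energy_nonneg: "0 \<le> energy M F"
  unfolding energy_def by (intro sum_nonneg mult_nonneg_nonneg) auto

lemma dirichlet_N_nonneg: "0 \<le> dirichlet_N \<alpha> r m (Suc M) F"
proof -
  have "0 \<le> Z_N \<alpha> m (Suc M)" unfolding Z_N_eq by (simp add: sum_nonneg)
  then show ?thesis unfolding dirichlet_N_eq_energy using M_star_pos energy_nonneg by simp
qed

section \<open>Capacities of the underlying walk\<close>

lemma cap_S_le: "f x = 1 \<Longrightarrow> f y = 0 \<Longrightarrow> cap_S r m x y \<le> dirichlet_S r m f"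
  unfolding cap_S_def by (intro cInf_lower) (auto intro!: bdd_belowI[of _ 0])

lemma cap_S_nonneg:
  assumes "x \<noteq> y" shows "0 \<le> cap_S r m x y"
  unfolding cap_S_def
proof (rule cInf_greatest)
  show "{dirichlet_S r m f |f. f x = 1 \<and> f y = 0} \<noteq> {}"
    using assms by (auto intro!: exI[of _ "\<lambda>z. if z = x then 1 else 0"])
qed auto

text \<open>Normalizing \<open>f\<close> to the values 1 at \<open>x\<close> and 0 at \<open>y\<close> makes it admissible for the capacity.\<close>

lemma cap_S_mult_le:
  assumes "x \<noteq> y"
  shows "cap_S r m x y * (f x - f y)\<^sup>2 \<le> dirichlet_S r m f"
proof (cases "f x = f y")
  case False
  let ?g = "\<lambda>z. (f z - f y) / (f x - f y)"
  have "dirichlet_S r m ?g \<le> (1 / (f x - f y))\<^sup>2 * dirichlet_S r m f"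
  proof -
    have "dirichlet_S r m ?g \<le> \<bar>1 / (f x - f y)\<bar>\<^sup>2 * dirichlet_S r m f"
    proof (rule dirichlet_S_mono)
      fix u v
      have "?g v - ?g u = (1 / (f x - f y)) * (f v - f u)"
        by (simp add: diff_divide_distrib)
      then show "\<bar>?g v - ?g u\<bar> \<le> \<bar>1 / (f x - f y)\<bar> * \<bar>f v - f u\<bar>" by (simp only: abs_mult)
    qed
    then show ?thesis by (simp add: power_divide)
  qed
  moreover have "cap_S r m x y \<le> dirichlet_S r m ?g"
    using False by (intro cap_S_le) auto
  ultimately have "cap_S r m x y \<le> (1 / (f x - f y))\<^sup>2 * dirichlet_S r m f" by linarith
  then have "cap_S r m x y \<le> dirichlet_S r m f / (f x - f y)\<^sup>2" by (simp add: power_divide)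
  then show ?thesis using False by (simp add: pos_le_divide_eq)
qed auto

text \<open>Truncating a function to \<open>[0, 1]\<close> does not increase its Dirichlet form.\<close>

lemma cap_S_near_minimizer:
  assumes "x \<noteq> y" "0 < e"
  obtains f where "f x = 1" "f y = 0" "\<And>z. 0 \<le> f z" "\<And>z. f z \<le> 1" "dirichlet_S r m f < cap_S r m x y + e"
proof -
  let ?X = "{dirichlet_S r m f |f. f x = 1 \<and> f y = 0}"
  have "?X \<noteq> {}" using assms by (auto intro!: exI[of _ "\<lambda>z. if z = x then 1 else 0"])
  moreover have "Inf ?X < cap_S r m x y + e" using assms by (simp add: cap_S_def)
  ultimately obtain d where "d \<in> ?X" "d < cap_S r m x y + e" by (rule cInf_lessD[THEN bexE])
  then obtain g where g: "g x = 1" "g y = 0" "dirichlet_S r m g < cap_S r m x y + e" by auto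
  let ?f = "\<lambda>z. max 0 (min 1 (g z))"
  have "dirichlet_S r m ?f \<le> 1\<^sup>2 * dirichlet_S r m g" by (rule dirichlet_S_mono) auto
  then show thesis using g by (intro that[of ?f]) auto
qed

end

section \<open>The profile function\<close>

text \<open>By uniform continuity the integral over each of the \<open>N\<close> intervals differs from the corresponding term
  by a small multiple of \<open>1 / N\<close>.\<close>

lemma riemann_sum_LIMSEQ:
  fixes f :: "real \<Rightarrow> real"
  assumes cont: "continuous_on {0..1} f"
  shows "(\<lambda>N. (\<Sum>n<N. f (real n / real N)) / real N) \<longlonglongrightarrow> integral {0..1} f"
proof (rule LIMSEQ_I)
  fix e :: real assume e: "0 < e"
  have "uniformly_continuous_on {0..1} f"
    using cont by (intro compact_uniformly_continuous) auto
  then obtain d where d: "0 < d"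
    "\<And>u v. u \<in> {0..1} \<Longrightarrow> v \<in> {0..1} \<Longrightarrow> dist v u < d \<Longrightarrow> dist (f v) (f u) < e / 2"
    unfolding uniformly_continuous_on_def using e by (metis half_gt_zero)
  obtain N0 :: nat where N0: "1 / d < real N0" using reals_Archimedean2 by blast
  show "\<exists>N0. \<forall>N\<ge>N0. norm ((\<Sum>n<N. f (real n / real N)) / real N - integral {0..1} f) < e"
  proof (intro exI allI impI)
    fix N assume N: "N \<ge> Suc N0"
    have N0': "0 < N" and Nd: "1 / real N < d"
      using N N0 d(1) by (auto simp: field_simps intro: less_le_trans)
    let ?I = "\<lambda>n. {real n / real N..real (Suc n) / real N}"
    have sub: "?I n \<subseteq> {0..1}" if "n < N" for n
      using that N0' by (auto simp: field_simps intro: order_trans)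
    have piece: "\<bar>f (real n / real N) / real N - integral (?I n) f\<bar> \<le> (e / 2) / real N" if "n < N" for n
    proof -
      have c: "continuous_on (?I n) f" using cont sub[OF that] by (rule continuous_on_subset)
      have len: "real (Suc n) / real N - real n / real N = 1 / real N"
        by (simp add: diff_divide_distrib[symmetric])
      have "integral (?I n) (\<lambda>u. f (real n / real N) - f u)
          = f (real n / real N) / real N - integral (?I n) f"
        using c len by (subst integral_diff) (auto intro: integrable_continuous_real simp: divide_right_mono)
      moreover have "norm (integral (?I n) (\<lambda>u. f (real n / real N) - f u)) \<le> (e / 2) * (real (Suc n) / real N - real n / real N)"
      proof (rule integral_bound)
        show "real n / real N \<le> real (Suc n) / real N" by (simp add: divide_right_mono)
        show "continuous_on (?I n) (\<lambda>u. f (real n / real N) - f u)" using c by (intro continuous_intros)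
        fix u assume u: "u \<in> ?I n"
        have "dist (real n / real N) u < d" using u Nd len by (auto simp: dist_real_def)
        moreover have "u \<in> {0..1}" by (rule subsetD[OF sub[OF that] u])
        moreover have "real n / real N \<in> {0..1}" using that by auto
        ultimately show "norm (f (real n / real N) - f u) \<le> e / 2"
          using d(2)[of u "real n / real N"] by (simp add: dist_real_def)
      qed
      ultimately show ?thesis using len by simp
    qed
    have "integral {0..real k / real N} f = (\<Sum>n<k. integral (?I n) f)" if "k \<le> N" for k
      using that
    proof (induction k)
      case (Suc k)
      have "integral {0..real k / real N} f + integral (?I k) f = integral {0..real (Suc k) / real N} f"
      proof (rule Henstock_Kurzweil_Integration.integral_combine)
        show "f integrable_on {0..real (Suc k) / real N}"
          using Suc.prems N0' by (intro integrable_continuous_real continuous_on_subset[OF cont]) auto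
      qed (auto simp: divide_right_mono)
      with Suc show ?case by simp
    qed simp
    from this[of N] have "integral {0..1} f = (\<Sum>n<N. integral (?I n) f)" using N0' by simp
    then have "\<bar>(\<Sum>n<N. f (real n / real N)) / real N - integral {0..1} f\<bar>
        = \<bar>\<Sum>n<N. f (real n / real N) / real N - integral (?I n) f\<bar>"
      by (simp add: sum_subtractf sum_divide_distrib)
    also have "\<dots> \<le> (\<Sum>n<N. (e / 2) / real N)"
      by (rule order_trans[OF sum_abs sum_mono], rule piece) simp
    also have "\<dots> < e" using N0' e by simp
    finally show "norm ((\<Sum>n<N. f (real n / real N)) / real N - integral {0..1} f) < e" by simp
  qed
qed

definition bump :: "real \<Rightarrow> real \<Rightarrow> real" where
  "bump \<alpha> u = u powr \<alpha> * (1 - u) powr \<alpha>"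

definition bump_mass :: "real \<Rightarrow> real \<Rightarrow> real" where
  "bump_mass \<alpha> A = integral {A..1 - A} (bump \<alpha>)"

text \<open>The profile rises from 0 to 1 on \<open>{A..1 - A}\<close> with derivative proportional to \<open>bump\<close>. For \<open>A = 0\<close> it minimizes
  the integral of \<open>h' u ^ 2 / bump \<alpha> u\<close> over \<open>h\<close> with \<open>h 0 = 0\<close> and \<open>h 1 = 1\<close>, the continuum limit of the energy along a path
  between two condensates. The plateaus make the trial function constant on the wells and their surroundings.\<close>

definition profile :: "real \<Rightarrow> real \<Rightarrow> real \<Rightarrow> real" where
  "profile \<alpha> A t = integral {A..max A (min (1 - A) t)} (bump \<alpha>) / bump_mass \<alpha> A"

lemma I_alpha_eq: "I_alpha \<alpha> = integral {0..1} (bump \<alpha>)"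
  by (simp add: I_alpha_def bump_def[abs_def])

lemma bump_nonneg: "0 \<le> bump \<alpha> u"
  by (simp add: bump_def)

lemma bump_le_1: "0 < \<alpha> \<Longrightarrow> u \<in> {0..1} \<Longrightarrow> bump \<alpha> u \<le> 1"
  unfolding bump_def by (intro mult_le_one powr_le1) auto

lemma continuous_on_bump: "0 < \<alpha> \<Longrightarrow> continuous_on {0..1} (bump \<alpha>)"
  unfolding bump_def[abs_def] by (intro continuous_intros continuous_on_powr') auto

lemma integrable_bump: "0 < \<alpha> \<Longrightarrow> 0 \<le> a \<Longrightarrow> b \<le> 1 \<Longrightarrow> bump \<alpha> integrable_on {a..b}"
  by (intro integrable_continuous_real continuous_on_subset[OF continuous_on_bump]) auto

lemma bump_mass_pos:
  assumes "0 < \<alpha>" "0 \<le> A" "A < 1 / 2"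
  shows "0 < bump_mass \<alpha> A"
proof -
  have "integral {A..1 - A} (\<lambda>_. 0 :: real) < integral {A..1 - A} (bump \<alpha>)"
    using assms by (intro integral_less_real continuous_on_subset[OF continuous_on_bump])
      (auto simp: bump_def)
  then show ?thesis by (simp add: bump_mass_def)
qed

lemma I_alpha_pos: "0 < \<alpha> \<Longrightarrow> 0 < I_alpha \<alpha>"
  using bump_mass_pos[of \<alpha> 0] by (simp add: I_alpha_eq bump_mass_def)

lemma bump_mass_tendsto:
  assumes "0 < \<alpha>"
  shows "(bump_mass \<alpha> \<longlongrightarrow> I_alpha \<alpha>) (at_right 0)"
proof -
  let ?J = "\<lambda>t. integral {0..t} (bump \<alpha>)"
  have J: "continuous_on {0..1} ?J"
    using assms by (intro indefinite_integral_continuous_1 integrable_bump) auto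
  have "continuous_on {0..1} (\<lambda>A. ?J (1 - A) - ?J A)"
    by (intro continuous_intros J continuous_on_compose2[OF J]) auto
  then have "((\<lambda>A. ?J (1 - A) - ?J A) \<longlongrightarrow> ?J (1 - 0) - ?J 0) (at 0 within {0..1})"
    unfolding continuous_on_def by (rule bspec) simp
  moreover have "at (0 :: real) within {0..1} = at_right 0"
    by (rule at_within_Icc_at_right) simp
  ultimately have "((\<lambda>A. ?J (1 - A) - ?J A) \<longlongrightarrow> I_alpha \<alpha>) (at_right 0)"
    by (simp add: I_alpha_eq)
  moreover have "\<forall>\<^sub>F A in at_right (0 :: real). ?J (1 - A) - ?J A = bump_mass \<alpha> A"
  proof -
    have "?J (1 - A) - ?J A = bump_mass \<alpha> A" if "0 < A" "A < 1 / 2" for A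
      using Henstock_Kurzweil_Integration.integral_combine[of 0 A "1 - A" "bump \<alpha>"] integrable_bump[OF assms] that
      by (simp add: bump_mass_def)
    moreover have "\<forall>\<^sub>F A in at_right (0 :: real). A \<in> {0<..<1 / 2}"
      by (rule eventually_at_right_real) simp
    ultimately show ?thesis by (auto elim: eventually_mono)
  qed
  ultimately show ?thesis by (rule Lim_transform_eventually)
qed

lemma profile_eq_0: "t \<le> A \<Longrightarrow> profile \<alpha> A t = 0"
  by (simp add: profile_def)

lemma profile_eq_1:
  "0 < \<alpha> \<Longrightarrow> 0 \<le> A \<Longrightarrow> A < 1 / 2 \<Longrightarrow> 1 - A \<le> t \<Longrightarrow> profile \<alpha> A t = 1"
  using bump_mass_pos[of \<alpha> A] by (simp add: profile_def bump_mass_def max_def)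

lemma profile_diff_le:
  assumes "0 < \<alpha>" "0 \<le> A" "A < 1 / 2" "0 \<le> B"
    and "s \<in> {lo..hi}" "t \<in> {lo..hi}"
    and "\<And>u. u \<in> {lo..hi} \<Longrightarrow> u \<in> {A..1 - A} \<Longrightarrow> bump \<alpha> u \<le> B"
  shows "\<bar>profile \<alpha> A t - profile \<alpha> A s\<bar> \<le> B / bump_mass \<alpha> A * \<bar>t - s\<bar>"
proof -
  have *: "\<bar>profile \<alpha> A t - profile \<alpha> A s\<bar> \<le> B / bump_mass \<alpha> A * (t - s)"
    if st: "s \<le> t" "s \<in> {lo..hi}" "t \<in> {lo..hi}" for s t
  proof -
    define s' t' where "s' = max A (min (1 - A) s)" and "t' = max A (min (1 - A) t)"
    have st': "A \<le> s'" "s' \<le> t'" "t' \<le> 1 - A" "t' - s' \<le> t - s" using assms(2,3) st by (auto simp: s'_def t'_def)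
    have mass: "0 < bump_mass \<alpha> A" using assms by (intro bump_mass_pos)
    have "integral {A..s'} (bump \<alpha>) + integral {s'..t'} (bump \<alpha>) = integral {A..t'} (bump \<alpha>)"
      using st' assms by (intro Henstock_Kurzweil_Integration.integral_combine integrable_bump) auto
    moreover have "0 \<le> integral {s'..t'} (bump \<alpha>)"
      using st' assms by (intro integral_nonneg integrable_bump) (auto simp: bump_nonneg)
    ultimately have "\<bar>profile \<alpha> A t - profile \<alpha> A s\<bar> = integral {s'..t'} (bump \<alpha>) / bump_mass \<alpha> A"
      using mass by (simp add: profile_def s'_def[symmetric] t'_def[symmetric] diff_divide_distrib[symmetric])
    also have "integral {s'..t'} (bump \<alpha>) \<le> B * (t - s)"
    proof (cases "s' = t'")
      case False
      then have in_range: "s \<le> s'" "t' \<le> t" using st' assms(3) by (auto simp: s'_def t'_def)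
      have "integral {s'..t'} (bump \<alpha>) \<le> integral {s'..t'} (\<lambda>_. B)"
        using st' st in_range assms by (intro integral_le integrable_bump) auto
      also have "\<dots> = B * (t' - s')" using st' by simp
      also have "\<dots> \<le> B * (t - s)" using st' assms by (intro mult_left_mono) auto
      finally show ?thesis .
    qed (use st assms in auto)
    finally show ?thesis using mass by (simp add: divide_right_mono)
  qed
  show ?thesis
  proof (cases "s \<le> t")
    case True
    then show ?thesis using *[of s t] assms(5,6) by simp
  next
    case False
    then show ?thesis using *[of t s] assms(5,6) by (simp add: abs_minus_commute)
  qed
qed

section \<open>Lower bound\<close>

text \<open>The series law: a unit potential drop over conductances \<open>w n\<close> in series dissipates at least the inverse of
  the total resistance. It is the Cauchy-Schwarz inequality.\<close>

lemma sum_squares_ge_resistance: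
  fixes d w :: "'a \<Rightarrow> real"
  assumes "\<And>n. n \<in> J \<Longrightarrow> 0 < w n" "sum d J = 1" "(\<Sum>n\<in>J. 1 / w n) \<le> R"
  shows "1 / R \<le> (\<Sum>n\<in>J. w n * (d n)\<^sup>2)"
proof -
  have "1 = (\<Sum>n\<in>J. (sqrt (w n) * d n) * (1 / sqrt (w n)))\<^sup>2"
  proof -
    have "(\<Sum>n\<in>J. (sqrt (w n) * d n) * (1 / sqrt (w n))) = sum d J"
      using assms(1) by (intro sum.cong) (auto dest: less_imp_neq[THEN not_sym])
    then show ?thesis using assms(2) by simp
  qed
  also have "\<dots> \<le> (\<Sum>n\<in>J. (sqrt (w n) * d n)\<^sup>2) * (\<Sum>n\<in>J. (1 / sqrt (w n))\<^sup>2)"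
    by (rule Cauchy_Schwarz_ineq_sum)
  also have "(\<Sum>n\<in>J. (sqrt (w n) * d n)\<^sup>2) = (\<Sum>n\<in>J. w n * (d n)\<^sup>2)"
    using assms(1) by (intro sum.cong) (auto simp: power_mult_distrib less_imp_le)
  also have "(\<Sum>n\<in>J. (1 / sqrt (w n))\<^sup>2) = (\<Sum>n\<in>J. 1 / w n)"
    using assms(1) by (intro sum.cong) (auto simp: power_divide less_imp_le)
  finally have le: "1 \<le> (\<Sum>n\<in>J. w n * (d n)\<^sup>2) * (\<Sum>n\<in>J. 1 / w n)" .
  have nn: "0 \<le> (\<Sum>n\<in>J. w n * (d n)\<^sup>2)" using assms(1) by (intro sum_nonneg) (auto simp: less_imp_le)
  have "1 \<le> (\<Sum>n\<in>J. w n * (d n)\<^sup>2) * R"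
    using le mult_left_mono[OF assms(3) nn] by linarith
  moreover from this have "0 < R" using mult_nonneg_nonpos[OF nn, of R] by linarith
  ultimately show ?thesis by (simp add: divide_le_eq)
qed

definition bump_sum :: "real \<Rightarrow> nat \<Rightarrow> real" where
  "bump_sum \<alpha> N = (\<Sum>n<N. bump \<alpha> (real n / real N))"

text \<open>In macroscopic coordinates the resistance \<open>a n * a (N - n)\<close> of a step is \<open>bump\<close> up to scale.\<close>

lemma powr_bump:
  assumes "0 < N" "n \<le> N"
  shows "real N powr (2 * \<alpha>) * bump \<alpha> (real n / real N) = real n powr \<alpha> * (real N - real n) powr \<alpha>"
proof -
  have "1 - real n / real N = (real N - real n) / real N" using assms by (simp add: field_simps)
  then have "bump \<alpha> (real n / real N) = (real n powr \<alpha> / real N powr \<alpha>) * ((real N - real n) powr \<alpha> / real N powr \<alpha>)"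
    using assms by (simp add: bump_def powr_divide)
  moreover have "real N powr (2 * \<alpha>) = real N powr \<alpha> * real N powr \<alpha>" by (simp flip: powr_add)
  ultimately show ?thesis using assms by simp
qed

context zero_range
begin

text \<open>The thresholds on \<open>x\<close> and \<open>y\<close> make the tubes of different pairs disjoint.\<close>

definition tube :: "'s \<Rightarrow> 's \<Rightarrow> nat \<Rightarrow> nat \<Rightarrow> ('s \<Rightarrow> nat) set" where
  "tube x y M L = {\<xi> \<in> configs M. L < \<xi> x \<and> L < \<xi> y \<and> (\<forall>z. z \<noteq> x \<longrightarrow> z \<noteq> y \<longrightarrow> \<xi> z \<le> L)}"

lemma finite_tube [simp]: "finite (tube x y M L)"
  by (simp add: tube_def)

lemma weight_remove2:
  assumes "x \<noteq> y"
  shows "weight \<xi> = site_weight x (\<xi> x) * site_weight y (\<xi> y) * (\<Prod>z\<in>UNIV - {x, y}. site_weight z (\<xi> z))"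
proof -
  have "(\<Prod>z\<in>UNIV - {x}. site_weight z (\<xi> z))
      = site_weight y (\<xi> y) * (\<Prod>z\<in>UNIV - {x} - {y}. site_weight z (\<xi> z))"
    using assms by (intro prod.remove) auto
  moreover have "UNIV - {x} - {y} = UNIV - {x, y}" by auto
  ultimately show ?thesis unfolding weight_remove[of \<xi> x] by (simp add: mult.assoc)
qed

text \<open>The tube contains, for every choice \<open>\<zeta>\<close> of at most \<open>L\<close> particles on each site off \<open>x\<close> and \<open>y\<close>, a path on which
  the other particles move from \<open>y\<close> to \<open>x\<close>: adding a particle at \<open>x\<close> to its \<open>n\<close>-th configuration gives the
  same result as adding one at \<open>y\<close> to the next. The series law applies to each path, and the sum of the weights of the \<open>\<zeta>\<close>
  factorizes.\<close>

lemma energy_tube_ge: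
  assumes xy: "x \<noteq> y" "x \<in> S_star m" "y \<in> S_star m"
    and M: "(CARD('s) + 2) * L < M"
    and F1: "\<And>\<eta>. \<eta> \<in> configs (Suc M) \<Longrightarrow> M - (CARD('s) + 1) * L \<le> \<eta> x
      \<Longrightarrow> (\<And>z. z \<noteq> x \<Longrightarrow> z \<noteq> y \<Longrightarrow> \<eta> z \<le> L) \<Longrightarrow> F \<eta> = 1"
    and F0: "\<And>\<eta>. \<eta> \<in> configs (Suc M) \<Longrightarrow> M - (CARD('s) + 1) * L \<le> \<eta> y
      \<Longrightarrow> (\<And>z. z \<noteq> x \<Longrightarrow> z \<noteq> y \<Longrightarrow> \<eta> z \<le> L) \<Longrightarrow> F \<eta> = 0"
  shows "cap_S r m x y * (\<Prod>z\<in>UNIV - {x, y}. \<Sum>n\<le>L. site_weight z n)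
      / (real (Suc M) powr (2 * \<alpha>) * bump_sum \<alpha> (Suc M))
    \<le> (\<Sum>\<xi>\<in>tube x y M L. weight \<xi> * dirichlet_S r m (\<lambda>z. F (add_particle \<xi> z)))"
proof -
  let ?P = "PiE (UNIV - {x, y}) (\<lambda>_. {..L})"
  \<comment> \<open>this range of \<open>n\<close> leaves more than \<open>L\<close> particles on \<open>y\<close> whatever \<open>\<zeta>\<close> is\<close>
  define a b where "a = Suc L" and "b = M - (CARD('s) + 1) * L"
  define s where "s \<zeta> = (\<Sum>z\<in>UNIV - {x, y}. \<zeta> z)" for \<zeta> :: "'s \<Rightarrow> nat"
  \<comment> \<open>the configuration of \<open>M'\<close> particles with \<open>n\<close> of them on \<open>x\<close>, and \<open>\<zeta>\<close> off \<open>x\<close> and \<open>y\<close>; it is used for the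
    configurations \<open>\<xi>\<close> (\<open>M' = M\<close>) and for the arguments of \<open>F\<close> (\<open>M' = Suc M\<close>)\<close>
  define conf where "conf M' \<zeta> n = \<zeta>(x := n, y := M' - n - s \<zeta>)" for M' \<zeta> n
  define G where "G \<xi> = weight \<xi> * dirichlet_S r m (\<lambda>z. F (add_particle \<xi> z))" for \<xi>
  define R where "R = real (Suc M) powr (2 * \<alpha>) * bump_sum \<alpha> (Suc M)"
  have ab: "a \<le> b" using M by (auto simp: a_def b_def algebra_simps)
  have b: "b + (CARD('s) + 1) * L = M" using M by (auto simp: b_def algebra_simps)
  have s: "s \<zeta> \<le> CARD('s) * L" if "\<zeta> \<in> ?P" for \<zeta>
    unfolding s_def using that by (intro sum_le_card_mult) (auto simp: PiE_iff)
  have conf_configs: "conf M' \<zeta> n \<in> configs M'" if "n + s \<zeta> \<le> M'" for M' \<zeta> n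
  proof -
    have "(\<Sum>z\<in>UNIV. conf M' \<zeta> n z) = conf M' \<zeta> n x + (\<Sum>z\<in>UNIV - {x}. conf M' \<zeta> n z)"
      by (rule sum.remove) auto
    also have "(\<Sum>z\<in>UNIV - {x}. conf M' \<zeta> n z)
        = conf M' \<zeta> n y + (\<Sum>z\<in>UNIV - {x} - {y}. conf M' \<zeta> n z)"
      using xy by (intro sum.remove) auto
    also have "(\<Sum>z\<in>UNIV - {x} - {y}. conf M' \<zeta> n z) = s \<zeta>"
      unfolding s_def by (rule sum.cong) (auto simp: conf_def)
    finally show ?thesis using that xy by (simp add: configs_def conf_def)
  qed
  have conf_le: "conf M' \<zeta> n z \<le> L" if "\<zeta> \<in> ?P" "z \<noteq> x" "z \<noteq> y" for M' \<zeta> n z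
    using that by (auto simp: conf_def PiE_iff)
  have inj: "inj_on (\<lambda>(\<zeta>, n). conf M \<zeta> n) (?P \<times> {a..<b})"
  proof (rule inj_onI, clarify)
    fix \<zeta> n \<zeta>' n'
    assume *: "\<zeta> \<in> ?P" "\<zeta>' \<in> ?P" "conf M \<zeta> n = conf M \<zeta>' n'"
    have "\<zeta> z = \<zeta>' z" if "z \<in> UNIV - {x, y}" for z
      using fun_cong[OF *(3), of z] that by (simp add: conf_def)
    then have "\<zeta> = \<zeta>'" using * by (intro PiE_ext) auto
    moreover have "n = n'" using fun_cong[OF *(3), of x] xy by (simp add: conf_def)
    ultimately show "\<zeta> = \<zeta>' \<and> n = n'" by simp
  qed
  have sub: "(\<lambda>(\<zeta>, n). conf M \<zeta> n) ` (?P \<times> {a..<b}) \<subseteq> tube x y M L"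
  proof clarify
    fix \<zeta> n assume \<zeta>: "\<zeta> \<in> ?P" and n: "n \<in> {a..<b}"
    have "L < conf M \<zeta> n x" "L < conf M \<zeta> n y"
      using n s[OF \<zeta>] b xy by (auto simp: conf_def a_def)
    moreover have "conf M \<zeta> n \<in> configs M"
      using n s[OF \<zeta>] b by (intro conf_configs) auto
    ultimately show "conf M \<zeta> n \<in> tube x y M L"
      using conf_le[OF \<zeta>] by (auto simp: tube_def)
  qed
  have fibre: "cap_S r m x y * (\<Prod>z\<in>UNIV - {x, y}. site_weight z (\<zeta> z)) / R \<le> (\<Sum>n\<in>{a..<b}. G (conf M \<zeta> n))"
    if \<zeta>: "\<zeta> \<in> ?P" for \<zeta>
  proof -
    define p where "p = (\<Prod>z\<in>UNIV - {x, y}. site_weight z (\<zeta> z))"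
    define d where "d n = F (conf (Suc M) \<zeta> (Suc n)) - F (conf (Suc M) \<zeta> n)" for n
    define w where "w n = 1 / zr_a \<alpha> n * (1 / zr_a \<alpha> (M - n - s \<zeta>))" for n
    have n_s: "n + s \<zeta> \<le> M" if "n \<in> {a..<b}" for n using that s[OF \<zeta>] b by auto
    have "sum d {a..<b} = F (conf (Suc M) \<zeta> b) - F (conf (Suc M) \<zeta> a)"
      unfolding d_def using ab by (rule sum_Suc_diff')
    also have "F (conf (Suc M) \<zeta> b) = 1"
    proof (rule F1)
      show "conf (Suc M) \<zeta> b \<in> configs (Suc M)" using s[OF \<zeta>] b by (intro conf_configs) auto
      show "M - (CARD('s) + 1) * L \<le> conf (Suc M) \<zeta> b x" using xy by (simp add: conf_def b_def)
    qed (rule conf_le[OF \<zeta>])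
    also have "F (conf (Suc M) \<zeta> a) = 0"
    proof (rule F0)
      show "conf (Suc M) \<zeta> a \<in> configs (Suc M)" using s[OF \<zeta>] b ab by (intro conf_configs) auto
      show "M - (CARD('s) + 1) * L \<le> conf (Suc M) \<zeta> a y" using s[OF \<zeta>] xy by (simp add: conf_def a_def)
    qed (rule conf_le[OF \<zeta>])
    finally have d1: "sum d {a..<b} = 1" by simp
    have "1 / R \<le> (\<Sum>n\<in>{a..<b}. w n * (d n)\<^sup>2)"
    proof (rule sum_squares_ge_resistance)
      have "(\<Sum>n\<in>{a..<b}. 1 / w n) \<le> (\<Sum>n\<in>{a..<b}. real (Suc M) powr (2 * \<alpha>) * bump \<alpha> (real n / real (Suc M)))"
      proof (rule sum_mono)
        fix n assume n: "n \<in> {a..<b}"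
        have "real (M - n - s \<zeta>) \<le> real (Suc M) - real n" using n_s[OF n] by linarith
        moreover have "1 / w n = zr_a \<alpha> n * zr_a \<alpha> (M - n - s \<zeta>)" by (simp add: w_def)
        moreover have "M - n - s \<zeta> \<noteq> 0" "n \<noteq> 0" using n s[OF \<zeta>] b by (auto simp: a_def)
        ultimately have "1 / w n \<le> real n powr \<alpha> * (real (Suc M) - real n) powr \<alpha>"
          using alpha by (auto simp: zr_a_def intro!: mult_mono powr_mono2)
        also have "\<dots> = real (Suc M) powr (2 * \<alpha>) * bump \<alpha> (real n / real (Suc M))"
          using n_s[OF n] by (intro powr_bump[symmetric]) auto
        finally show "1 / w n \<le> \<dots>" .
      qed
      also have "\<dots> \<le> (\<Sum>n<Suc M. real (Suc M) powr (2 * \<alpha>) * bump \<alpha> (real n / real (Suc M)))"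
        using b by (intro sum_mono2) (auto simp: bump_nonneg)
      also have "\<dots> = R" by (simp add: R_def bump_sum_def sum_distrib_left del: sum.lessThan_Suc)
      finally show "(\<Sum>n\<in>{a..<b}. 1 / w n) \<le> R" .
    qed (use d1 in \<open>auto simp: w_def\<close>)
    then have "cap_S r m x y * p * (1 / R) \<le> cap_S r m x y * p * (\<Sum>n\<in>{a..<b}. w n * (d n)\<^sup>2)"
      using xy by (intro mult_left_mono mult_nonneg_nonneg cap_S_nonneg) (auto simp: p_def intro: prod_nonneg)
    also have "\<dots> = (\<Sum>n\<in>{a..<b}. w n * p * (cap_S r m x y * (d n)\<^sup>2))"
      by (simp add: sum_distrib_left mult_ac)
    also have "\<dots> \<le> (\<Sum>n\<in>{a..<b}. G (conf M \<zeta> n))"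
    proof (rule sum_mono)
      fix n assume n: "n \<in> {a..<b}"
      have "(\<Prod>z\<in>UNIV - {x, y}. site_weight z (conf M \<zeta> n z)) = p"
        unfolding p_def by (rule prod.cong) (auto simp: conf_def)
      then have "weight (conf M \<zeta> n) = w n * p"
        unfolding weight_remove2[OF xy(1)] using xy by (simp add: w_def conf_def site_weight_star)
      moreover have "add_particle (conf M \<zeta> n) x = conf (Suc M) \<zeta> (Suc n)"
        "add_particle (conf M \<zeta> n) y = conf (Suc M) \<zeta> n"
        using n_s[OF n] xy by (auto simp: add_particle_def conf_def fun_eq_iff)
      then have "cap_S r m x y * (d n)\<^sup>2 \<le> dirichlet_S r m (\<lambda>z. F (add_particle (conf M \<zeta> n) z))"
        using cap_S_mult_le[OF xy(1), of "\<lambda>z. F (add_particle (conf M \<zeta> n) z)"] by (simp add: d_def)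
      ultimately show "w n * p * (cap_S r m x y * (d n)\<^sup>2) \<le> G (conf M \<zeta> n)"
        using weight_nonneg[of "conf M \<zeta> n"] by (simp add: G_def mult_left_mono)
    qed
    finally show ?thesis by (simp add: p_def)
  qed
  have "cap_S r m x y * (\<Prod>z\<in>UNIV - {x, y}. \<Sum>n\<le>L. site_weight z n) / R
      = (\<Sum>\<zeta>\<in>?P. cap_S r m x y * (\<Prod>z\<in>UNIV - {x, y}. site_weight z (\<zeta> z)) / R)"
    by (simp add: prod_sum_PiE sum_distrib_left sum_divide_distrib)
  also have "\<dots> \<le> (\<Sum>\<zeta>\<in>?P. \<Sum>n\<in>{a..<b}. G (conf M \<zeta> n))"
    by (intro sum_mono fibre)
  also have "\<dots> = sum G ((\<lambda>(\<zeta>, n). conf M \<zeta> n) ` (?P \<times> {a..<b}))"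
    by (subst sum.reindex[OF inj]) (simp add: sum.cartesian_product o_def split_def)
  also have "\<dots> \<le> sum G (tube x y M L)"
    using sub by (intro sum_mono2) (auto simp: G_def)
  finally show ?thesis by (simp add: G_def R_def)
qed

lemma energy_ge:
  assumes "S1 \<subseteq> S_star m" "S2 \<subseteq> S_star m" "S1 \<inter> S2 = {}"
    and "(CARD('s) + 2) * L < M"
    and "\<And>\<eta> x. \<eta> \<in> configs (Suc M) \<Longrightarrow> x \<in> S1 \<Longrightarrow> M - (CARD('s) + 1) * L \<le> \<eta> x
      \<Longrightarrow> (\<And>z. z \<notin> S_star m \<Longrightarrow> \<eta> z \<le> L) \<Longrightarrow> F \<eta> = 1"
    and "\<And>\<eta> y. \<eta> \<in> configs (Suc M) \<Longrightarrow> y \<in> S2 \<Longrightarrow> M - (CARD('s) + 1) * L \<le> \<eta> y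
      \<Longrightarrow> (\<And>z. z \<notin> S_star m \<Longrightarrow> \<eta> z \<le> L) \<Longrightarrow> F \<eta> = 0"
  shows "(\<Sum>x\<in>S1. \<Sum>y\<in>S2. cap_S r m x y * (\<Prod>z\<in>UNIV - {x, y}. \<Sum>n\<le>L. site_weight z n))
      / (real (Suc M) powr (2 * \<alpha>) * bump_sum \<alpha> (Suc M)) \<le> energy M F"
proof -
  define G where "G \<xi> = weight \<xi> * dirichlet_S r m (\<lambda>z. F (add_particle \<xi> z))" for \<xi>
  let ?R = "real (Suc M) powr (2 * \<alpha>) * bump_sum \<alpha> (Suc M)"
  let ?T = "\<lambda>p. tube (fst p) (snd p) M L"
  have "(\<Sum>x\<in>S1. \<Sum>y\<in>S2. cap_S r m x y * (\<Prod>z\<in>UNIV - {x, y}. \<Sum>n\<le>L. site_weight z n)) / ?R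
      = (\<Sum>x\<in>S1. \<Sum>y\<in>S2. cap_S r m x y * (\<Prod>z\<in>UNIV - {x, y}. \<Sum>n\<le>L. site_weight z n) / ?R)"
    by (simp add: sum_divide_distrib)
  also have "\<dots> \<le> (\<Sum>x\<in>S1. \<Sum>y\<in>S2. sum G (tube x y M L))"
  proof (intro sum_mono)
    fix x y assume xy: "x \<in> S1" "y \<in> S2"
    then have "x \<in> S_star m" "y \<in> S_star m" "x \<noteq> y" using assms(1-3) by auto
    then have "\<And>z. z \<notin> S_star m \<Longrightarrow> z \<noteq> x \<and> z \<noteq> y" by blast
    then show "cap_S r m x y * (\<Prod>z\<in>UNIV - {x, y}. \<Sum>n\<le>L. site_weight z n) / ?R \<le> sum G (tube x y M L)"
      unfolding G_def
      by (intro energy_tube_ge assms(4) assms(5)[OF _ xy(1)] assms(6)[OF _ xy(2)]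
            \<open>x \<in> S_star m\<close> \<open>y \<in> S_star m\<close> \<open>x \<noteq> y\<close>) simp_all
  qed
  also have "\<dots> = (\<Sum>p\<in>S1 \<times> S2. sum G (?T p))"
    by (simp add: sum.cartesian_product split_def)
  also have "\<dots> = sum G (\<Union>p\<in>S1 \<times> S2. ?T p)"
  proof (rule sum.UNION_disjoint[symmetric])
    show "\<forall>p\<in>S1 \<times> S2. \<forall>q\<in>S1 \<times> S2. p \<noteq> q \<longrightarrow> ?T p \<inter> ?T q = {}"
    proof (intro ballI impI)
      fix p q assume pq: "p \<in> S1 \<times> S2" "q \<in> S1 \<times> S2" "p \<noteq> q"
      have "fst p \<notin> {fst q, snd q} \<or> snd p \<notin> {fst q, snd q}"
      proof (cases "fst p = fst q")
        case True
        then have "snd p \<noteq> snd q" using pq(3) by (simp add: prod_eq_iff)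
        moreover have "snd p \<noteq> fst q" using pq assms(3) by auto
        ultimately show ?thesis by simp
      next
        case False
        moreover have "fst p \<noteq> snd q" using pq assms(3) by auto
        ultimately show ?thesis by simp
      qed
      then show "?T p \<inter> ?T q = {}" by (auto simp: tube_def)
    qed
  qed auto
  also have "\<dots> \<le> sum G (configs M)"
    by (intro sum_mono2) (auto simp: tube_def G_def)
  finally show ?thesis by (simp add: energy_def G_def)
qed

end

section \<open>The trial function\<close>

context zero_range
begin

text \<open>An upper bound for the error of \<open>height\<close> near a well, in units of the threshold \<open>E\<close> of the trial function: \<open>3 * E\<close>
  for each of the other sites, and \<open>2 * E\<close> for each term of the triple sum in \<open>height\<close>.\<close>

definition margin :: real where
  "margin = 3 * real CARD('s) + 2 * real CARD('s) ^ 3"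

lemma margin_pos: "0 < margin"
  by (simp add: margin_def add_pos_nonneg)

end

text \<open>The parameters of the trial function: \<open>f x y\<close> will be a near-minimizer for the capacity of the walk between \<open>x \<in> S1\<close>
  and \<open>y \<in> S2\<close>, and \<open>A\<close> is the width of the plateaus of the profile.\<close>

locale trial_function = zero_range \<alpha> r m
  for \<alpha> :: real and r :: "'s::finite \<Rightarrow> 's \<Rightarrow> real" and m :: "'s pmf" +
  fixes S1 S2 :: "'s set" and f :: "'s \<Rightarrow> 's \<Rightarrow> 's \<Rightarrow> real" and A :: real and N :: nat
  assumes stars: "S1 \<union> S2 = S_star m" and disjoint: "S1 \<inter> S2 = {}"
    and f_nonneg: "0 \<le> f x y z" and f_le_1: "f x y z \<le> 1"
    and f_source: "x \<in> S1 \<Longrightarrow> y \<in> S2 \<Longrightarrow> f x y x = 1"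
    and f_sink: "x \<in> S1 \<Longrightarrow> y \<in> S2 \<Longrightarrow> f x y y = 0"
    and A_pos: "0 < A" and A_less: "A < 1 / 2" and N_pos: "0 < N"
begin

text \<open>A site is called large if it carries at least \<open>2 * E\<close> particles. The choice \<open>margin * E = A * N\<close> keeps the height of a
  configuration with a single large site on a plateau.\<close>

definition E :: real where
  "E = A / margin * real N"

text \<open>Equal to \<open>\<eta> z\<close> if \<open>x\<close> and \<open>y\<close> carry many more particles than \<open>z\<close>, and 0 if one of them carries at most \<open>E\<close>. Thus a
  correction meant for condensates on \<open>x\<close> and \<open>y\<close> switches itself off elsewhere, in a Lipschitz manner.\<close>

definition overlap :: "('s \<Rightarrow> nat) \<Rightarrow> 's \<Rightarrow> 's \<Rightarrow> 's \<Rightarrow> real" where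
  "overlap \<eta> x y z = min (real (\<eta> z)) (max 0 (min (real (\<eta> x)) (real (\<eta> y)) - E))"

text \<open>The first sum alone is right when all the particles are on \<open>x \<in> S1\<close> and \<open>y \<in> S2\<close>, but a particle on a third
  site \<open>z\<close> has to count \<open>f x y z\<close> instead of 0 or 1. The correction depends on the pair carrying the condensates, and \<open>overlap\<close>
  selects it.\<close>

definition height :: "('s \<Rightarrow> nat) \<Rightarrow> real" where
  "height \<eta> = (\<Sum>x\<in>S1. real (\<eta> x))
     + (\<Sum>x\<in>S1. \<Sum>y\<in>S2. \<Sum>z\<in>UNIV - {x, y}. (f x y z - of_bool (z \<in> S1)) * overlap \<eta> x y z)"

definition trial :: "('s \<Rightarrow> nat) \<Rightarrow> real" where
  "trial \<eta> = profile \<alpha> A (height \<eta> / real N)"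

lemma E_pos: "0 < E"
  using margin_pos A_pos N_pos by (simp add: E_def)

lemma margin_E: "margin * E = A * real N"
  using margin_pos by (simp add: E_def)

lemma card_triple_sum_le:
  fixes t :: "'s \<Rightarrow> 's \<Rightarrow> 's \<Rightarrow> real"
  assumes "\<And>x y z. x \<in> S1 \<Longrightarrow> y \<in> S2 \<Longrightarrow> \<bar>t x y z\<bar> \<le> c" "0 \<le> c"
  shows "\<bar>\<Sum>x\<in>S1. \<Sum>y\<in>S2. \<Sum>z\<in>UNIV - {x, y}. t x y z\<bar> \<le> real CARD('s) ^ 3 * c"
proof -
  have "\<bar>\<Sum>x\<in>S1. \<Sum>y\<in>S2. \<Sum>z\<in>UNIV - {x, y}. t x y z\<bar> \<le> (\<Sum>x\<in>S1. \<Sum>y\<in>S2. \<Sum>z\<in>UNIV - {x, y}. c)"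
    using assms by (intro order_trans[OF sum_abs] sum_mono) auto
  also have "\<dots> \<le> (\<Sum>x\<in>(UNIV :: 's set). \<Sum>y\<in>(UNIV :: 's set). \<Sum>z\<in>(UNIV :: 's set). c)"
  proof -
    have "(\<Sum>z\<in>UNIV - {x, y}. c) \<le> (\<Sum>z\<in>(UNIV :: 's set). c)" for x y :: 's
      using assms(2) by (intro sum_mono2) auto
    then have "(\<Sum>x\<in>S1. \<Sum>y\<in>S2. \<Sum>z\<in>UNIV - {x, y}. c)
        \<le> (\<Sum>x\<in>S1. \<Sum>y\<in>S2. \<Sum>z\<in>(UNIV :: 's set). c)"
      by (intro sum_mono)
    also have "\<dots> = real (card S1 * card S2) * (real CARD('s) * c)" by simp
    also have "\<dots> \<le> real (CARD('s) * CARD('s)) * (real CARD('s) * c)"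
      using assms(2) by (intro mult_right_mono of_nat_mono mult_le_mono card_mono) auto
    finally show ?thesis by simp
  qed
  also have "\<dots> = real CARD('s) ^ 3 * c" by (simp add: power3_eq_cube mult.assoc)
  finally show ?thesis .
qed

lemma coefficient_le: "\<bar>f x y z - of_bool (z \<in> S1)\<bar> \<le> 1"
  using f_nonneg[of x y z] f_le_1[of x y z] by (cases "z \<in> S1") auto

lemma height_diff_le:
  assumes "\<And>z. \<bar>real (\<eta> z) - real (\<eta>' z)\<bar> \<le> 1"
  shows "\<bar>height \<eta> - height \<eta>'\<bar> \<le> real CARD('s) + real CARD('s) ^ 3"
proof -
  have "\<bar>(\<Sum>x\<in>S1. real (\<eta> x)) - (\<Sum>x\<in>S1. real (\<eta>' x))\<bar> \<le> (\<Sum>x\<in>S1. \<bar>real (\<eta> x) - real (\<eta>' x)\<bar>)"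
    by (simp add: sum_subtractf[symmetric])
  also have "\<dots> \<le> (\<Sum>x\<in>S1. 1)" using assms by (intro sum_mono)
  also have "\<dots> \<le> real CARD('s)" by (simp add: card_mono)
  finally have 1: "\<bar>(\<Sum>x\<in>S1. real (\<eta> x)) - (\<Sum>x\<in>S1. real (\<eta>' x))\<bar> \<le> real CARD('s)" .
  let ?t = "\<lambda>x y z. (f x y z - of_bool (z \<in> S1)) * (overlap \<eta> x y z - overlap \<eta>' x y z)"
  have "\<bar>overlap \<eta> x y z - overlap \<eta>' x y z\<bar> \<le> 1" for x y z
    using assms[of x] assms[of y] assms[of z] unfolding overlap_def by linarith
  then have "\<bar>?t x y z\<bar> \<le> 1 * 1" for x y z
    unfolding abs_mult by (intro mult_mono coefficient_le) auto
  then have "\<bar>\<Sum>x\<in>S1. \<Sum>y\<in>S2. \<Sum>z\<in>UNIV - {x, y}. ?t x y z\<bar> \<le> real CARD('s) ^ 3 * 1"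
    by (intro card_triple_sum_le) auto
  then have 2: "\<bar>(\<Sum>x\<in>S1. \<Sum>y\<in>S2. \<Sum>z\<in>UNIV - {x, y}. (f x y z - of_bool (z \<in> S1)) * overlap \<eta> x y z)
      - (\<Sum>x\<in>S1. \<Sum>y\<in>S2. \<Sum>z\<in>UNIV - {x, y}. (f x y z - of_bool (z \<in> S1)) * overlap \<eta>' x y z)\<bar>
      \<le> real CARD('s) ^ 3"
    by (simp add: right_diff_distrib sum_subtractf)
  show ?thesis using 1 2 unfolding height_def by linarith
qed

lemma sum_others_le:
  fixes \<eta> :: "'s \<Rightarrow> nat"
  assumes "\<And>z. z \<in> B \<Longrightarrow> real (\<eta> z) \<le> c" "0 \<le> c"
  shows "(\<Sum>z\<in>B. real (\<eta> z)) \<le> real CARD('s) * c"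
proof -
  have "(\<Sum>z\<in>B. real (\<eta> z)) \<le> real (card B) * c" using assms(1) by (rule sum_bounded_above)
  also have "\<dots> \<le> real CARD('s) * c" using assms(2) by (simp add: mult_right_mono card_mono)
  finally show ?thesis .
qed

text \<open>With a single condensate the height is within \<open>margin * E = A * N\<close> of 0 or \<open>N\<close>, where the profile is flat.\<close>

lemma trial_corner:
  assumes \<eta>: "\<eta> \<in> configs N" and small: "\<And>z. z \<noteq> x0 \<Longrightarrow> real (\<eta> z) \<le> 3 * E"
  shows "trial \<eta> = of_bool (x0 \<in> S1)"
proof -
  let ?t = "\<lambda>x y z. (f x y z - of_bool (z \<in> S1)) * overlap \<eta> x y z"
  have "\<bar>?t x y z\<bar> \<le> 1 * (2 * E)" if xy: "x \<in> S1" "y \<in> S2" for x y z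
    unfolding abs_mult
  proof (intro mult_mono coefficient_le)
    have "x \<noteq> x0 \<or> y \<noteq> x0" using xy disjoint by auto
    then have "min (real (\<eta> x)) (real (\<eta> y)) \<le> 3 * E"
      using small[of x] small[of y] by linarith
    then show "\<bar>overlap \<eta> x y z\<bar> \<le> 2 * E" using E_pos unfolding overlap_def by linarith
  qed auto
  then have corr: "\<bar>\<Sum>x\<in>S1. \<Sum>y\<in>S2. \<Sum>z\<in>UNIV - {x, y}. ?t x y z\<bar> \<le> real CARD('s) ^ 3 * (2 * E)"
    using E_pos by (intro card_triple_sum_le) auto
  have marg: "margin * E = real CARD('s) * (3 * E) + real CARD('s) ^ 3 * (2 * E)"
    by (simp add: margin_def algebra_simps)
  show ?thesis
  proof (cases "x0 \<in> S1")
    case True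
    have "real N = real (\<eta> x0) + (\<Sum>z\<in>UNIV - {x0}. real (\<eta> z))"
      using configs_coordinate[OF \<eta>, of x0] by (simp flip: of_nat_sum of_nat_add)
    moreover have "(\<Sum>z\<in>UNIV - {x0}. real (\<eta> z)) \<le> real CARD('s) * (3 * E)"
      using small E_pos by (intro sum_others_le) auto
    moreover have "real (\<eta> x0) \<le> (\<Sum>x\<in>S1. real (\<eta> x))"
      using True by (intro member_le_sum) auto
    ultimately have "real N - margin * E \<le> height \<eta>"
      using corr marg unfolding height_def by linarith
    then have "1 - A \<le> height \<eta> / real N" using N_pos by (simp add: margin_E field_simps)
    then show ?thesis using True A_pos A_less alpha by (simp add: trial_def profile_eq_1)
  next
    case False
    then have "(\<Sum>x\<in>S1. real (\<eta> x)) \<le> real CARD('s) * (3 * E)"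
      using E_pos by (intro sum_others_le small) auto
    then have "height \<eta> \<le> margin * E"
      using corr marg unfolding height_def by linarith
    then have "height \<eta> / real N \<le> A" using N_pos by (simp add: margin_E divide_le_eq)
    then show ?thesis using False by (simp add: trial_def profile_eq_0)
  qed
qed

lemma height_no_pair:
  assumes "\<And>x y. x \<in> S1 \<Longrightarrow> y \<in> S2 \<Longrightarrow> min (real (\<eta> x)) (real (\<eta> y)) \<le> E"
  shows "height \<eta> = (\<Sum>x\<in>S1. real (\<eta> x))"
proof -
  have "overlap \<eta> x y z = 0" if "x \<in> S1" "y \<in> S2" for x y z
    using assms[OF that] by (simp add: overlap_def max_absorb1)
  then show ?thesis by (simp add: height_def)
qed

lemma margin_ge: "real CARD('s) \<le> margin"
  by (simp add: margin_def)

text \<open>Two condensates on the same side switch off all corrections, so the height counts the particles on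
  \<open>S1\<close>, which are almost all or almost none.\<close>

lemma trial_pair_same_side:
  assumes \<eta>: "\<eta> \<in> configs N" and xy: "x \<noteq> y" "x \<in> S_star m" "y \<in> S_star m" "x \<in> S1 \<longleftrightarrow> y \<in> S1"
    and small: "\<And>z. z \<noteq> x \<Longrightarrow> z \<noteq> y \<Longrightarrow> real (\<eta> z) \<le> E"
  shows "trial \<eta> = of_bool (x \<in> S1)"
proof -
  have "u \<notin> {x, y} \<or> v \<notin> {x, y}" if "u \<in> S1" "v \<in> S2" for u v
    using xy that disjoint stars by auto
  then have height: "height \<eta> = (\<Sum>x\<in>S1. real (\<eta> x))"
    using small by (intro height_no_pair) (fastforce simp: min_le_iff_disj)
  have CE: "real CARD('s) * E \<le> A * real N"
    using margin_ge E_pos margin_E by (metis mult_right_mono less_imp_le)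
  show ?thesis
  proof (cases "x \<in> S1")
    case True
    have "real N = real (\<eta> x) + real (\<eta> y) + (\<Sum>z\<in>UNIV - {x, y}. real (\<eta> z))"
      using configs_coordinates[OF \<eta> xy(1)] by (simp flip: of_nat_sum of_nat_add)
    moreover have "(\<Sum>z\<in>UNIV - {x, y}. real (\<eta> z)) \<le> real CARD('s) * E"
      using small E_pos by (intro sum_others_le) auto
    moreover have "(\<Sum>z\<in>{x, y}. real (\<eta> z)) \<le> (\<Sum>x\<in>S1. real (\<eta> x))"
      using True xy by (intro sum_mono2) auto
    ultimately have "(1 - A) * real N \<le> height \<eta>"
      using CE height xy(1) by (simp add: left_diff_distrib)
    then have "1 - A \<le> height \<eta> / real N" using N_pos by (simp add: le_divide_eq)
    then show ?thesis using True A_pos A_less alpha by (simp add: trial_def profile_eq_1)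
  next
    case False
    then have "(\<Sum>x\<in>S1. real (\<eta> x)) \<le> real CARD('s) * E"
      using xy E_pos by (intro sum_others_le small) auto
    then have "height \<eta> / real N \<le> A" using CE height N_pos by (simp add: divide_le_eq)
    then show ?thesis using False by (simp add: trial_def profile_eq_0)
  qed
qed

lemma height_pair:
  assumes xy: "x \<in> S1" "y \<in> S2"
    and small: "\<And>z. z \<noteq> x \<Longrightarrow> z \<noteq> y \<Longrightarrow> real (\<eta> z) \<le> E"
    and large: "2 * E \<le> real (\<eta> x)" "2 * E \<le> real (\<eta> y)"
  shows "height \<eta> = (\<Sum>z\<in>UNIV. f x y z * real (\<eta> z))"
proof -
  have ne: "x \<noteq> y" "y \<notin> S1" using xy disjoint by auto
  let ?T = "\<lambda>u v. \<Sum>z\<in>UNIV - {u, v}. (f u v z - of_bool (z \<in> S1)) * overlap \<eta> u v z"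
  have T0: "?T u v = 0" if "u \<in> S1" "v \<in> S2" "(u, v) \<noteq> (x, y)" for u v
  proof -
    have "u \<notin> {x, y} \<or> v \<notin> {x, y}" using that xy disjoint by auto
    then have "min (real (\<eta> u)) (real (\<eta> v)) \<le> E" using small by (auto simp: min_le_iff_disj)
    then have "overlap \<eta> u v z = 0" for z by (simp add: overlap_def max_absorb1)
    then show ?thesis by simp
  qed
  have "(\<Sum>u\<in>S1. \<Sum>v\<in>S2. ?T u v) = (\<Sum>p\<in>S1 \<times> S2. ?T (fst p) (snd p))"
    by (simp add: sum.cartesian_product split_def)
  also have "\<dots> = (\<Sum>p\<in>{(x, y)}. ?T (fst p) (snd p))"
    using xy by (intro sum.mono_neutral_right ballI T0) auto
  also have "\<dots> = ?T x y" by simp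
  also have "\<dots> = (\<Sum>z\<in>UNIV - {x, y}. f x y z * real (\<eta> z) - of_bool (z \<in> S1) * real (\<eta> z))"
  proof (rule sum.cong)
    fix z assume z: "z \<in> UNIV - {x, y}"
    then have "overlap \<eta> x y z = real (\<eta> z)"
      using small[of z] large E_pos unfolding overlap_def by auto
    then show "(f x y z - of_bool (z \<in> S1)) * overlap \<eta> x y z = f x y z * real (\<eta> z) - of_bool (z \<in> S1) * real (\<eta> z)"
      by (simp add: left_diff_distrib)
  qed simp
  finally have corr: "(\<Sum>u\<in>S1. \<Sum>v\<in>S2. ?T u v)
      = (\<Sum>z\<in>UNIV - {x, y}. f x y z * real (\<eta> z)) - (\<Sum>z\<in>UNIV - {x, y}. of_bool (z \<in> S1) * real (\<eta> z))"
    by (simp add: sum_subtractf)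
  have split: "(\<Sum>z\<in>UNIV. g z) = g x + g y + (\<Sum>z\<in>UNIV - {x, y}. g z)" for g :: "'s \<Rightarrow> real"
  proof -
    have "UNIV = insert x (insert y (UNIV - {x, y}))" by auto
    then have "(\<Sum>z\<in>UNIV. g z) = sum g (insert x (insert y (UNIV - {x, y})))" by simp
    then show ?thesis using ne by simp
  qed
  have "(\<Sum>u\<in>S1. real (\<eta> u)) = (\<Sum>z\<in>UNIV. of_bool (z \<in> S1) * real (\<eta> z))"
    by (simp add: sum.If_cases of_bool_def if_distrib[of "\<lambda>t. t * _"] cong: if_cong)
  then show ?thesis
    unfolding height_def corr using split[of "\<lambda>z. of_bool (z \<in> S1) * real (\<eta> z)"]
      split[of "\<lambda>z. f x y z * real (\<eta> z)"] xy ne f_source[OF xy] f_sink[OF xy] by simp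
qed

definition lipschitz :: real where
  "lipschitz = (real CARD('s) + real CARD('s) ^ 3) / (bump_mass \<alpha> A * real N)"

lemma mass_pos: "0 < bump_mass \<alpha> A"
  using alpha A_pos A_less by (intro bump_mass_pos) auto

lemma trial_diff_le: "\<bar>trial (add_particle \<xi> w) - trial (add_particle \<xi> w')\<bar> \<le> lipschitz"
proof -
  let ?s = "height (add_particle \<xi> w') / real N" and ?t = "height (add_particle \<xi> w) / real N"
  have "\<bar>profile \<alpha> A ?t - profile \<alpha> A ?s\<bar> \<le> 1 / bump_mass \<alpha> A * \<bar>?t - ?s\<bar>"
    using alpha A_pos A_less
    by (intro profile_diff_le[where lo = "min ?s ?t" and hi = "max ?s ?t"] bump_le_1) auto
  also have "\<bar>?t - ?s\<bar> = \<bar>height (add_particle \<xi> w) - height (add_particle \<xi> w')\<bar> / real N"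
    by (simp add: diff_divide_distrib[symmetric])
  also have "\<dots> \<le> (real CARD('s) + real CARD('s) ^ 3) / real N"
    by (intro divide_right_mono height_diff_le) (auto simp: add_particle_def)
  finally show ?thesis using mass_pos by (simp add: trial_def lipschitz_def divide_right_mono)
qed

end

section \<open>The energy of the trial function\<close>

context trial_function
begin

definition local_energy :: "('s \<Rightarrow> nat) \<Rightarrow> real" where
  "local_energy \<xi> = weight \<xi> * dirichlet_S r m (\<lambda>z. trial (add_particle \<xi> z))"

lemma local_energy_nonneg: "0 \<le> local_energy \<xi>"
  by (simp add: local_energy_def)

lemma local_energy_le: "local_energy \<xi> \<le> lipschitz\<^sup>2 * rate_sum * weight \<xi>"
proof -
  have "dirichlet_S r m (\<lambda>z. trial (add_particle \<xi> z)) \<le> lipschitz\<^sup>2 * rate_sum"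
    by (rule dirichlet_S_le) (rule trial_diff_le)
  from mult_left_mono[OF this weight_nonneg[of \<xi>]] show ?thesis
    by (simp add: local_energy_def mult.commute)
qed

lemma sum_local_energy_le: "sum local_energy B \<le> lipschitz\<^sup>2 * rate_sum * sum weight B"
  unfolding sum_distrib_left by (intro sum_mono local_energy_le)

lemma local_energy_constant:
  assumes "\<And>w. trial (add_particle \<xi> w) = c"
  shows "local_energy \<xi> = 0"
  by (simp add: local_energy_def dirichlet_S_def assms)

definition off_star :: "('s \<Rightarrow> nat) set" where
  "off_star = {\<xi> \<in> configs (N - 1). \<exists>z. z \<notin> S_star m \<and> 2 * E \<le> real (\<xi> z)}"

definition triples :: "nat \<Rightarrow> ('s \<Rightarrow> nat) set" where
  "triples L = {\<xi> \<in> configs (N - 1). \<exists>x y z. x \<noteq> y \<and> x \<noteq> z \<and> y \<noteq> z \<and>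
     2 * E \<le> real (\<xi> x) \<and> 2 * E \<le> real (\<xi> y) \<and> L < \<xi> z}"

definition pairs :: "nat \<Rightarrow> 's \<Rightarrow> 's \<Rightarrow> ('s \<Rightarrow> nat) set" where
  "pairs L x y = {\<xi> \<in> configs (N - 1). 2 * E \<le> real (\<xi> x) \<and> 2 * E \<le> real (\<xi> y) \<and>
     (\<forall>z. z \<noteq> x \<longrightarrow> z \<noteq> y \<longrightarrow> \<xi> z \<le> L)}"

lemma finite_regions [simp]: "finite off_star" "finite (triples L)" "finite (pairs L x y)"
  by (simp_all add: off_star_def triples_def pairs_def)

lemma add_particle_N: "\<xi> \<in> configs (N - 1) \<Longrightarrow> add_particle \<xi> w \<in> configs N"
  using add_particle_configs[of \<xi> "N - 1" w] N_pos by simp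

lemma add_particle_le: "real (add_particle \<xi> w z) \<le> real (\<xi> z) + 1"
  by (simp add: add_particle_def)

text \<open>Outside the three regions either at most one site is large, or exactly two sites are, both in \<open>S_star m\<close> and
  on the same side. In both cases the trial function does not see the additional particle.\<close>

lemma local_energy_eq_0:
  assumes \<xi>: "\<xi> \<in> configs (N - 1)" and L: "real L + 1 \<le> E"
    and out: "\<xi> \<notin> off_star" "\<xi> \<notin> triples L" "\<And>x y. x \<in> S1 \<Longrightarrow> y \<in> S2 \<Longrightarrow> \<xi> \<notin> pairs L x y"
  shows "local_energy \<xi> = 0"
proof (cases "\<exists>x y. x \<noteq> y \<and> 2 * E \<le> real (\<xi> x) \<and> 2 * E \<le> real (\<xi> y)")
  case True
  then obtain x y where xy: "x \<noteq> y" "2 * E \<le> real (\<xi> x)" "2 * E \<le> real (\<xi> y)" by blast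
  have stars_xy: "x \<in> S_star m" "y \<in> S_star m" using out(1) \<xi> xy by (auto simp: off_star_def)
  have small: "\<xi> z \<le> L" if "z \<noteq> x" "z \<noteq> y" for z
  proof (rule ccontr)
    assume "\<not> \<xi> z \<le> L"
    then have "\<xi> \<in> triples L"
      unfolding triples_def using \<xi> xy that
      by (intro CollectI conjI exI[of _ x] exI[of _ y] exI[of _ z]) auto
    then show False using out(2) by simp
  qed
  have "\<xi> \<in> pairs L x y" "\<xi> \<in> pairs L y x" using \<xi> xy small by (auto simp: pairs_def)
  then have same: "x \<in> S1 \<longleftrightarrow> y \<in> S1" using out(3) stars stars_xy by blast
  have "trial (add_particle \<xi> w) = of_bool (x \<in> S1)" for w
  proof (rule trial_pair_same_side[OF add_particle_N[OF \<xi>] xy(1) stars_xy same])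
    fix z assume "z \<noteq> x" "z \<noteq> y"
    then have "real (\<xi> z) \<le> real L" using small by simp
    then show "real (add_particle \<xi> w z) \<le> E" using add_particle_le[of \<xi> w z] L by linarith
  qed
  then show ?thesis by (rule local_energy_constant)
next
  case False
  then obtain x0 where x0: "\<And>z. z \<noteq> x0 \<Longrightarrow> real (\<xi> z) < 2 * E"
    by (metis not_le)
  have "trial (add_particle \<xi> w) = of_bool (x0 \<in> S1)" for w
  proof (rule trial_corner[OF add_particle_N[OF \<xi>]])
    fix z assume "z \<noteq> x0"
    then show "real (add_particle \<xi> w z) \<le> 3 * E"
      using add_particle_le[of \<xi> w z] x0[of z] L by linarith
  qed
  then show ?thesis by (rule local_energy_constant)
qed

lemma sum_off_star_le:
  assumes "0 < \<rho>" "\<rho> < 1" "\<And>x. x \<notin> S_star m \<Longrightarrow> m_star m x \<le> \<rho>"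
  shows "sum weight off_star \<le> real CARD('s) * (\<rho> powr (2 * E) * \<Gamma> ^ CARD('s))"
proof -
  let ?B = "\<lambda>z. {\<xi> \<in> configs (N - 1). 2 * E \<le> real (\<xi> z)}"
  have "sum weight off_star \<le> (\<Sum>z\<in>- S_star m. sum weight (?B z))"
    by (rule sum_le_sum_cover) (auto simp: off_star_def)
  also have "\<dots> \<le> (\<Sum>z\<in>- S_star m. \<rho> powr (2 * E) * \<Gamma> ^ CARD('s))"
    using assms by (intro sum_mono sum_weight_off_star_le[where N = "N - 1"]) auto
  also have "\<dots> \<le> (\<Sum>z\<in>(UNIV :: 's set). \<rho> powr (2 * E) * \<Gamma> ^ CARD('s))"
    using Gamma_ge_1 by (intro sum_mono2) auto
  finally show ?thesis by simp
qed

lemma sum_triples_le: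
  "sum weight (triples L) \<le> real CARD('s) ^ 3 *
     ((2 * E) powr - \<alpha> * (real N * (2 * E) powr - \<alpha> * (Gamma_tail L * \<Gamma> ^ CARD('s))))"
proof -
  let ?I = "{p :: 's \<times> 's \<times> 's. fst p \<noteq> fst (snd p) \<and> fst p \<noteq> snd (snd p) \<and> fst (snd p) \<noteq> snd (snd p)}"
  let ?B = "\<lambda>p. {\<xi> \<in> configs (N - 1). 2 * E \<le> real (\<xi> (fst p)) \<and> 2 * E \<le> real (\<xi> (fst (snd p)))
     \<and> L < \<xi> (snd (snd p))}"
  let ?c = "(2 * E) powr - \<alpha> * (real N * (2 * E) powr - \<alpha> * (Gamma_tail L * \<Gamma> ^ CARD('s)))"
  have N: "real (N - 1) + 1 = real N" using N_pos by simp
  have "triples L \<subseteq> (\<Union>p\<in>?I. ?B p)"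
  proof
    fix \<xi> assume "\<xi> \<in> triples L"
    then obtain x y z where "x \<noteq> y" "x \<noteq> z" "y \<noteq> z" "\<xi> \<in> configs (N - 1)"
      "2 * E \<le> real (\<xi> x)" "2 * E \<le> real (\<xi> y)" "L < \<xi> z" unfolding triples_def by blast
    then have "(x, y, z) \<in> ?I" "\<xi> \<in> ?B (x, y, z)" by auto
    then show "\<xi> \<in> (\<Union>p\<in>?I. ?B p)" by blast
  qed
  then have "sum weight (triples L) \<le> (\<Sum>p\<in>?I. sum weight (?B p))"
    by (intro sum_le_sum_cover) auto
  also have "\<dots> \<le> (\<Sum>p\<in>?I. ?c)"
  proof (rule sum_mono)
    fix p assume p: "p \<in> ?I"
    have "sum weight (?B p) \<le> (2 * E) powr - \<alpha> * ((real (N - 1) + 1) * (2 * E) powr - \<alpha> * (Gamma_tail L * \<Gamma> ^ CARD('s)))"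
      using p E_pos
      by (intro sum_weight_three_sites_le[where x = "fst p" and y = "fst (snd p)" and w = "snd (snd p)"]) auto
    then show "sum weight (?B p) \<le> ?c" unfolding N .
  qed
  also have "\<dots> \<le> (\<Sum>p\<in>(UNIV :: ('s \<times> 's \<times> 's) set). ?c)"
    using Gamma_tail_nonneg Gamma_ge_1 by (intro sum_mono2) auto
  also have "\<dots> = real CARD('s) ^ 3 * ?c" by (simp add: card_prod power3_eq_cube)
  finally show ?thesis .
qed

text \<open>Bounds the ratios \<open>(n + K) / n\<close> for \<open>n \<ge> 2 * E\<close>, where \<open>K = CARD('s) * L + 1\<close> bounds the number of particles off
  the two large sites, the additional one included. It tends to 1 as \<open>N \<rightarrow> \<infinity>\<close>, because \<open>E\<close> is proportional to \<open>N\<close>.\<close>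

definition distortion :: "nat \<Rightarrow> real" where
  "distortion L = 1 + (real CARD('s) * real L + 1) / (2 * E)"

text \<open>Here the trial function at \<open>\<xi> + w\<close> is the profile at \<open>t w\<close>, where \<open>t w\<close> depends on \<open>w\<close> only through \<open>f x y w / N\<close> and lies
  close to \<open>\<xi> x / N\<close>. So the local energy is at most the Dirichlet form of \<open>f x y\<close> times the squared slope of the
  profile. The slope contributes \<open>bump\<close> twice and the weight divides by it once.\<close>

lemma local_energy_pair_le:
  assumes xy: "x \<in> S1" "y \<in> S2" and L: "real L + 1 \<le> E" and \<xi>: "\<xi> \<in> pairs L x y"
  shows "local_energy \<xi> \<le> distortion L powr (4 * \<alpha>) * dirichlet_S r m (f x y)
      / ((bump_mass \<alpha> A)\<^sup>2 * (real N)\<^sup>2 * real N powr (2 * \<alpha>))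
      * (bump \<alpha> (real (\<xi> x) / real N) * (\<Prod>z\<in>UNIV - {x, y}. site_weight z (\<xi> z)))"
proof -
  define n k K where "n = real (\<xi> x)" and "k = real (\<xi> y)" and "K = real CARD('s) * real L + 1"
  define s where "s = (\<Sum>z\<in>UNIV - {x, y}. real (\<xi> z))"
  define t where "t w = height (add_particle \<xi> w) / real N" for w
  define B where "B = ((n + K) * (k + K)) powr \<alpha> / real N powr (2 * \<alpha>)"
  define p where "p = (\<Prod>z\<in>UNIV - {x, y}. site_weight z (\<xi> z))"
  let ?N = "real N"
  have ne: "x \<noteq> y" using xy disjoint by auto
  have conf: "\<xi> \<in> configs (N - 1)" and nk: "2 * E \<le> n" "2 * E \<le> k"
    and small: "\<And>z. z \<noteq> x \<Longrightarrow> z \<noteq> y \<Longrightarrow> \<xi> z \<le> L"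
    using \<xi> by (auto simp: pairs_def n_def k_def)
  have K: "0 \<le> K" by (simp add: K_def)
  have pos: "0 < n" "0 < k" using nk E_pos by linarith+
  have "\<xi> x + \<xi> y + (\<Sum>z\<in>UNIV - {x, y}. \<xi> z) + 1 = N"
    using configs_coordinates[OF conf ne] N_pos by simp
  then have N_eq: "?N = n + k + s + 1"
    unfolding n_def k_def s_def by (simp flip: of_nat_sum of_nat_add)
  have s: "0 \<le> s" "s \<le> real CARD('s) * real L"
  proof -
    show "0 \<le> s" by (simp add: s_def sum_nonneg)
    show "s \<le> real CARD('s) * real L"
      unfolding s_def by (rule sum_others_le) (simp_all add: small)
  qed
  have t_eq: "t w = (n + (\<Sum>z\<in>UNIV - {x, y}. f x y z * real (\<xi> z)) + f x y w) / ?N" for w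
  proof -
    have "height (add_particle \<xi> w) = (\<Sum>z\<in>UNIV. f x y z * real (add_particle \<xi> w z))"
    proof (rule height_pair[OF xy])
      fix z assume "z \<noteq> x" "z \<noteq> y"
      then show "real (add_particle \<xi> w z) \<le> E"
        using add_particle_le[of \<xi> w z] small[of z] L by (simp flip: of_nat_le_iff)
    qed (use nk in \<open>auto simp: add_particle_def n_def k_def\<close>)
    also have "\<dots> = (\<Sum>z\<in>UNIV. f x y z * real (\<xi> z) + (if z = w then f x y w else 0))"
      by (rule sum.cong) (auto simp: add_particle_def distrib_left)
    also have "\<dots> = (\<Sum>z\<in>UNIV. f x y z * real (\<xi> z)) + f x y w"
      by (simp add: sum.distrib)
    also have "(\<Sum>z\<in>UNIV. f x y z * real (\<xi> z))
        = (\<Sum>z\<in>insert x (insert y (UNIV - {x, y})). f x y z * real (\<xi> z))"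
      by (rule sum.cong) auto
    also have "\<dots> = n + (\<Sum>z\<in>UNIV - {x, y}. f x y z * real (\<xi> z))"
      using ne f_source[OF xy] f_sink[OF xy] by (simp add: n_def)
    finally show ?thesis by (simp add: t_def)
  qed
  have fs: "0 \<le> (\<Sum>z\<in>UNIV - {x, y}. f x y z * real (\<xi> z))" "(\<Sum>z\<in>UNIV - {x, y}. f x y z * real (\<xi> z)) \<le> s"
    unfolding s_def using f_nonneg f_le_1
    by (auto intro!: sum_nonneg sum_mono mult_nonneg_nonneg mult_left_le_one_le)
  have t_in: "t w \<in> {n / ?N..(n + K) / ?N}" for w
    using fs s f_nonneg[of x y w] f_le_1[of x y w] N_pos
    by (auto simp: t_eq K_def intro!: divide_right_mono)
  have bump_le: "bump \<alpha> u \<le> B" if u: "u \<in> {n / ?N..(n + K) / ?N}" "u \<in> {A..1 - A}" for u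
  proof -
    have "u powr \<alpha> \<le> ((n + K) / ?N) powr \<alpha>" using u A_pos alpha by (intro powr_mono2) auto
    moreover have "(1 - u) powr \<alpha> \<le> ((k + K) / ?N) powr \<alpha>"
    proof (rule powr_mono2)
      have "1 - u \<le> 1 - n / ?N" using u by simp
      also have "\<dots> = (?N - n) / ?N" using N_pos by (simp add: field_simps)
      also have "\<dots> \<le> (k + K) / ?N" using s N_eq by (intro divide_right_mono) (auto simp: K_def)
      finally show "1 - u \<le> (k + K) / ?N" .
    qed (use u A_pos alpha in auto)
    ultimately have "bump \<alpha> u \<le> ((n + K) / ?N) powr \<alpha> * ((k + K) / ?N) powr \<alpha>"
      unfolding bump_def by (intro mult_mono) auto
    also have "\<dots> = B"
      using pos K N_pos by (simp add: B_def powr_divide powr_mult flip: powr_add)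
    finally show ?thesis .
  qed
  have B: "0 \<le> B" by (simp add: B_def)
  have D_le: "dirichlet_S r m (\<lambda>z. trial (add_particle \<xi> z)) \<le> (B / (bump_mass \<alpha> A * ?N))\<^sup>2 * dirichlet_S r m (f x y)"
  proof (rule dirichlet_S_mono)
    fix u v
    have "\<bar>profile \<alpha> A (t v) - profile \<alpha> A (t u)\<bar> \<le> B / bump_mass \<alpha> A * \<bar>t v - t u\<bar>"
      using alpha A_pos A_less B t_in bump_le
      by (intro profile_diff_le[where lo = "n / ?N" and hi = "(n + K) / ?N"]) auto
    also have "t v - t u = (f x y v - f x y u) / ?N"
      by (simp add: t_eq diff_divide_distrib[symmetric])
    finally show "\<bar>trial (add_particle \<xi> v) - trial (add_particle \<xi> u)\<bar>
        \<le> B / (bump_mass \<alpha> A * ?N) * \<bar>f x y v - f x y u\<bar>"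
      by (simp add: trial_def t_def)
  qed
  have weight_eq: "weight \<xi> = 1 / (n * k) powr \<alpha> * p"
  proof -
    have "x \<in> S_star m" "y \<in> S_star m" using xy stars by auto
    then show ?thesis
      unfolding weight_remove2[OF ne] using pos
      by (simp add: site_weight_star zr_a_def n_def k_def p_def powr_mult)
  qed
  have "local_energy \<xi> \<le> weight \<xi> * ((B / (bump_mass \<alpha> A * ?N))\<^sup>2 * dirichlet_S r m (f x y))"
    unfolding local_energy_def by (intro mult_left_mono D_le weight_nonneg)
  also have "\<dots> = 1 / (n * k) powr \<alpha> * p * ((B / (bump_mass \<alpha> A * ?N))\<^sup>2 * dirichlet_S r m (f x y))"
    unfolding weight_eq ..
  also have "\<dots> = (B\<^sup>2 / (n * k) powr \<alpha>) * (p * dirichlet_S r m (f x y) / ((bump_mass \<alpha> A)\<^sup>2 * ?N\<^sup>2))"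
    by (simp add: power_divide power_mult_distrib)
  also have "\<dots> \<le> (distortion L powr (4 * \<alpha>) / ?N powr (2 * \<alpha>) * bump \<alpha> (n / ?N))
      * (p * dirichlet_S r m (f x y) / ((bump_mass \<alpha> A)\<^sup>2 * ?N\<^sup>2))"
  proof (rule mult_right_mono)
    have d: "u + K \<le> distortion L * u" if "2 * E \<le> u" for u
    proof -
      have "K = K / (2 * E) * (2 * E)" using E_pos by simp
      also have "\<dots> \<le> K / (2 * E) * u" using that K E_pos by (intro mult_left_mono) auto
      finally show ?thesis by (simp add: distortion_def K_def[symmetric] distrib_right)
    qed
    have d0: "0 < distortion L" using K E_pos by (simp add: distortion_def K_def[symmetric] add_pos_nonneg)
    have nk_bump: "(n * k) powr \<alpha> / ?N powr (2 * \<alpha>) \<le> bump \<alpha> (n / ?N)"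
    proof -
      have "n \<le> ?N" using N_eq s pos by linarith
      then have eq: "?N powr (2 * \<alpha>) * bump \<alpha> (n / ?N) = n powr \<alpha> * (?N - n) powr \<alpha>"
        unfolding n_def using N_pos by (intro powr_bump) auto
      have "(n * k) powr \<alpha> \<le> n powr \<alpha> * (?N - n) powr \<alpha>"
        using pos N_eq s alpha by (simp add: powr_mult powr_mono2 mult_left_mono)
      then show ?thesis using N_pos unfolding eq[symmetric] by (simp add: divide_le_eq mult.commute)
    qed
    have "(n + K) * (k + K) \<le> (distortion L * n) * (distortion L * k)"
      using d nk pos K d0 by (intro mult_mono) auto
    also have "\<dots> = distortion L powr 2 * (n * k)"
      using d0 by (simp add: powr_numeral power2_eq_square)
    finally have "((n + K) * (k + K)) powr \<alpha> \<le> (distortion L powr 2 * (n * k)) powr \<alpha>"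
      using alpha pos K by (intro powr_mono2) auto
    also have "\<dots> = distortion L powr (2 * \<alpha>) * (n * k) powr \<alpha>"
      using pos by (simp add: powr_mult powr_powr)
    finally have "B \<le> distortion L powr (2 * \<alpha>) * (n * k) powr \<alpha> / ?N powr (2 * \<alpha>)"
      by (simp add: B_def divide_right_mono)
    then have "B\<^sup>2 \<le> (distortion L powr (2 * \<alpha>) * (n * k) powr \<alpha> / ?N powr (2 * \<alpha>))\<^sup>2"
      using B by (intro power_mono)
    also have "\<dots> = distortion L powr (4 * \<alpha>) * ((n * k) powr \<alpha>)\<^sup>2 / (?N powr (2 * \<alpha>))\<^sup>2"
      by (simp add: power_divide power_mult_distrib power2_eq_square[of "distortion L powr _"] flip: powr_add)
    finally have "B\<^sup>2 / (n * k) powr \<alpha> \<le> distortion L powr (4 * \<alpha>) * ((n * k) powr \<alpha>)\<^sup>2 / (?N powr (2 * \<alpha>))\<^sup>2 / (n * k) powr \<alpha>"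
      by (rule divide_right_mono) simp
    also have "\<dots> = distortion L powr (4 * \<alpha>) / ?N powr (2 * \<alpha>) * ((n * k) powr \<alpha> / ?N powr (2 * \<alpha>))"
      using pos by (simp add: power2_eq_square)
    also have "\<dots> \<le> distortion L powr (4 * \<alpha>) / ?N powr (2 * \<alpha>) * bump \<alpha> (n / ?N)"
      by (intro mult_left_mono nk_bump) simp
    finally show "B\<^sup>2 / (n * k) powr \<alpha> \<le> distortion L powr (4 * \<alpha>) / ?N powr (2 * \<alpha>) * bump \<alpha> (n / ?N)" .
  qed (auto simp: p_def intro!: mult_nonneg_nonneg divide_nonneg_nonneg prod_nonneg)
  finally show ?thesis by (simp add: n_def p_def mult_ac)
qed

text \<open>The coordinate at \<open>y\<close> is eliminated; the one at \<open>x\<close> produces the Riemann sum of \<open>bump\<close>.\<close>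

lemma sum_pairs_le:
  assumes xy: "x \<in> S1" "y \<in> S2" and L: "real L + 1 \<le> E"
  shows "sum local_energy (pairs L x y) \<le> distortion L powr (4 * \<alpha>) * dirichlet_S r m (f x y)
      / ((bump_mass \<alpha> A)\<^sup>2 * (real N)\<^sup>2 * real N powr (2 * \<alpha>))
      * (bump_sum \<alpha> N * (\<Prod>z\<in>UNIV - {x, y}. site_sum z))"
proof -
  have ne: "x \<noteq> y" using xy disjoint by auto
  let ?C = "distortion L powr (4 * \<alpha>) * dirichlet_S r m (f x y)
      / ((bump_mass \<alpha> A)\<^sup>2 * (real N)\<^sup>2 * real N powr (2 * \<alpha>))"
  define v where "v z n = (if z = x then bump \<alpha> (real n / real N) else site_weight z n)" for z n
  define B where "B z = (if z = x then {..<N} else {..L})" for z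
  have split: "(\<Prod>z\<in>UNIV - {y}. h z) = h x * (\<Prod>z\<in>UNIV - {x, y}. h z)" for h :: "'s \<Rightarrow> real"
  proof -
    have "UNIV - {y} - {x} = UNIV - {x, y}" by auto
    then show ?thesis using ne prod.remove[of "UNIV - {y}" x h] by simp
  qed
  have C: "0 \<le> ?C" by simp
  have "sum local_energy (pairs L x y) \<le> ?C * (\<Prod>z\<in>UNIV - {y}. \<Sum>n\<in>B z. v z n)"
  proof (rule sum_configs_le[where N = "N - 1"])
    fix \<xi> assume \<xi>: "\<xi> \<in> pairs L x y"
    have "(\<Prod>z\<in>UNIV - {y}. v z (\<xi> z)) = bump \<alpha> (real (\<xi> x) / real N) * (\<Prod>z\<in>UNIV - {x, y}. site_weight z (\<xi> z))"
      unfolding split by (auto simp: v_def intro!: prod.cong)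
    then show "local_energy \<xi> \<le> ?C * (\<Prod>z\<in>UNIV - {y}. v z (\<xi> z))"
      using local_energy_pair_le[OF xy L \<xi>] by simp
    fix z assume "z \<noteq> y"
    have "\<xi> x \<le> N - 1" using \<xi> by (auto simp: pairs_def intro: configs_le)
    then show "\<xi> z \<in> B z" using \<xi> \<open>z \<noteq> y\<close> N_pos by (auto simp: B_def pairs_def)
  qed (use C in \<open>auto simp: pairs_def B_def v_def bump_nonneg\<close>)
  also have "(\<Prod>z\<in>UNIV - {y}. \<Sum>n\<in>B z. v z n) = bump_sum \<alpha> N * (\<Prod>z\<in>UNIV - {x, y}. \<Sum>n\<le>L. site_weight z n)"
    unfolding split by (auto simp: v_def B_def bump_sum_def intro!: prod.cong)
  also have "?C * \<dots> \<le> ?C * (bump_sum \<alpha> N * (\<Prod>z\<in>UNIV - {x, y}. site_sum z))"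
    using C by (intro mult_left_mono prod_mono)
      (auto simp: bump_sum_def bump_nonneg intro!: sum_nonneg sum_site_weight_le)
  finally show ?thesis .
qed

lemma energy_trial_le:
  assumes L: "real L + 1 \<le> E"
    and \<rho>: "0 < \<rho>" "\<rho> < 1" "\<And>x. x \<notin> S_star m \<Longrightarrow> m_star m x \<le> \<rho>"
  shows "energy (N - 1) trial \<le>
    lipschitz\<^sup>2 * rate_sum * (real CARD('s) * (\<rho> powr (2 * E) * \<Gamma> ^ CARD('s)))
    + lipschitz\<^sup>2 * rate_sum * (real CARD('s) ^ 3 *
       ((2 * E) powr - \<alpha> * (real N * (2 * E) powr - \<alpha> * (Gamma_tail L * \<Gamma> ^ CARD('s)))))
    + (\<Sum>x\<in>S1. \<Sum>y\<in>S2. distortion L powr (4 * \<alpha>) * dirichlet_S r m (f x y)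
        / ((bump_mass \<alpha> A)\<^sup>2 * (real N)\<^sup>2 * real N powr (2 * \<alpha>))
        * (bump_sum \<alpha> N * (\<Prod>z\<in>UNIV - {x, y}. site_sum z)))"
proof -
  let ?P = "\<Union>p\<in>S1 \<times> S2. pairs L (fst p) (snd p)"
  let ?R = "configs (N - 1) - off_star - triples L - ?P"
  have "energy (N - 1) trial = sum local_energy (configs (N - 1))"
    by (simp add: energy_def local_energy_def)
  also have "\<dots> \<le> sum local_energy off_star + sum local_energy (triples L \<union> (?P \<union> ?R))"
    by (intro sum_le_sum_Un) (auto simp: local_energy_nonneg)
  also have "sum local_energy (triples L \<union> (?P \<union> ?R))
      \<le> sum local_energy (triples L) + sum local_energy (?P \<union> ?R)"
    by (intro sum_le_sum_Un) (auto simp: local_energy_nonneg)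
  also have "sum local_energy (?P \<union> ?R) \<le> sum local_energy ?P + sum local_energy ?R"
    by (intro sum_le_sum_Un) (auto simp: local_energy_nonneg)
  also have "sum local_energy ?R = 0"
    using L by (intro sum.neutral ballI local_energy_eq_0) auto
  also have "sum local_energy ?P \<le> (\<Sum>p\<in>S1 \<times> S2. sum local_energy (pairs L (fst p) (snd p)))"
    by (rule sum_le_sum_cover) (auto simp: local_energy_nonneg)
  also have "\<dots> = (\<Sum>x\<in>S1. \<Sum>y\<in>S2. sum local_energy (pairs L x y))"
    by (simp add: sum.cartesian_product split_def)
  also have "\<dots> \<le> (\<Sum>x\<in>S1. \<Sum>y\<in>S2. distortion L powr (4 * \<alpha>) * dirichlet_S r m (f x y)
        / ((bump_mass \<alpha> A)\<^sup>2 * (real N)\<^sup>2 * real N powr (2 * \<alpha>))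
        * (bump_sum \<alpha> N * (\<Prod>z\<in>UNIV - {x, y}. site_sum z)))"
    using L by (intro sum_mono sum_pairs_le)
  also have "sum local_energy off_star
      \<le> lipschitz\<^sup>2 * rate_sum * (real CARD('s) * (\<rho> powr (2 * E) * \<Gamma> ^ CARD('s)))"
    using rate_sum_nonneg
    by (intro order_trans[OF sum_local_energy_le] mult_left_mono sum_off_star_le[OF \<rho>]) auto
  also have "sum local_energy (triples L) \<le> lipschitz\<^sup>2 * rate_sum * (real CARD('s) ^ 3 *
       ((2 * E) powr - \<alpha> * (real N * (2 * E) powr - \<alpha> * (Gamma_tail L * \<Gamma> ^ CARD('s)))))"
    using rate_sum_nonneg
    by (intro order_trans[OF sum_local_energy_le] mult_left_mono sum_triples_le) auto
  finally show ?thesis by simp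
qed


text \<open>Multiplied by \<open>N powr (1 + 2 * \<alpha>)\<close>, the three contributions separate into an exponentially small
  one, one that is small with \<open>Gamma_tail L\<close> uniformly in \<open>N\<close>, and the main one.\<close>

lemma scaled_energy_trial_le:
  assumes L: "real L + 1 \<le> E"
    and \<rho>: "0 < \<rho>" "\<rho> < 1" "\<And>x. x \<notin> S_star m \<Longrightarrow> m_star m x \<le> \<rho>"
  defines "c \<equiv> ((real CARD('s) + real CARD('s) ^ 3) / bump_mass \<alpha> A)\<^sup>2 * rate_sum * \<Gamma> ^ CARD('s)"
  shows "real N powr (1 + 2 * \<alpha>) * energy (N - 1) trial \<le>
    c * real CARD('s) * (real N powr (2 * \<alpha> - 1) * \<rho> powr (2 * (A / margin) * real N))
    + c * real CARD('s) ^ 3 * (2 * (A / margin)) powr - (2 * \<alpha>) * Gamma_tail L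
    + (\<Sum>x\<in>S1. \<Sum>y\<in>S2. (1 + (real CARD('s) * real L + 1) / (2 * (A / margin)) / real N) powr (4 * \<alpha>)
        * dirichlet_S r m (f x y) / (bump_mass \<alpha> A)\<^sup>2 * (bump_sum \<alpha> N / real N)
        * (\<Prod>z\<in>UNIV - {x, y}. site_sum z))"
proof -
  let ?X = "real N powr (1 + 2 * \<alpha>)" and ?d = "A / margin"
  have d: "0 < ?d" using A_pos margin_pos by simp
  have lip: "?X * lipschitz\<^sup>2 = ((real CARD('s) + real CARD('s) ^ 3) / bump_mass \<alpha> A)\<^sup>2 * real N powr (2 * \<alpha> - 1)"
  proof -
    have "?X = real N powr (2 * \<alpha> - 1) * (real N)\<^sup>2"
      using N_pos by (simp flip: powr_numeral powr_add)
    then show ?thesis using N_pos by (simp add: lipschitz_def power_divide power_mult_distrib)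
  qed
  have E2: "real N powr (2 * \<alpha> - 1) * ((2 * E) powr - \<alpha> * (real N * (2 * E) powr - \<alpha>)) = (2 * ?d) powr - (2 * \<alpha>)"
  proof -
    have "2 * E = (2 * ?d) * real N" by (simp add: E_def)
    then have "(2 * E) powr - \<alpha> = (2 * ?d) powr - \<alpha> * real N powr - \<alpha>"
      using d N_pos by (simp only: powr_mult)
    then have "real N powr (2 * \<alpha> - 1) * ((2 * E) powr - \<alpha> * (real N * (2 * E) powr - \<alpha>))
        = ((2 * ?d) powr - \<alpha> * (2 * ?d) powr - \<alpha>)
          * (real N powr (2 * \<alpha> - 1) * real N powr 1 * real N powr - \<alpha> * real N powr - \<alpha>)"
      using N_pos by simp
    also have "real N powr (2 * \<alpha> - 1) * real N powr 1 * real N powr - \<alpha> * real N powr - \<alpha> = 1"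
      using N_pos by (simp only: powr_add[symmetric]) simp
    also have "(2 * ?d) powr - \<alpha> * (2 * ?d) powr - \<alpha> = (2 * ?d) powr - (2 * \<alpha>)"
      by (simp only: powr_add[symmetric]) simp
    finally show ?thesis by simp
  qed
  have 1: "?X * (lipschitz\<^sup>2 * rate_sum * (real CARD('s) * (\<rho> powr (2 * E) * \<Gamma> ^ CARD('s))))
      = c * real CARD('s) * (real N powr (2 * \<alpha> - 1) * \<rho> powr (2 * ?d * real N))"
  proof -
    have "?X * (lipschitz\<^sup>2 * rate_sum * (real CARD('s) * (\<rho> powr (2 * E) * \<Gamma> ^ CARD('s))))
        = (?X * lipschitz\<^sup>2) * rate_sum * (real CARD('s) * (\<rho> powr (2 * E) * \<Gamma> ^ CARD('s)))"
      by (simp only: mult.assoc)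
    then show ?thesis unfolding lip c_def E_def by (simp add: mult_ac)
  qed
  have 2: "?X * (lipschitz\<^sup>2 * rate_sum * (real CARD('s) ^ 3 *
       ((2 * E) powr - \<alpha> * (real N * (2 * E) powr - \<alpha> * (Gamma_tail L * \<Gamma> ^ CARD('s))))))
      = c * real CARD('s) ^ 3 * (2 * ?d) powr - (2 * \<alpha>) * Gamma_tail L"
  proof -
    have "?X * (lipschitz\<^sup>2 * rate_sum * (real CARD('s) ^ 3 *
       ((2 * E) powr - \<alpha> * (real N * (2 * E) powr - \<alpha> * (Gamma_tail L * \<Gamma> ^ CARD('s))))))
      = (?X * lipschitz\<^sup>2) * rate_sum * (real CARD('s) ^ 3 *
       ((2 * E) powr - \<alpha> * (real N * (2 * E) powr - \<alpha> * (Gamma_tail L * \<Gamma> ^ CARD('s)))))"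
      by (simp only: mult.assoc)
    also have "\<dots> = c * real CARD('s) ^ 3 *
        (real N powr (2 * \<alpha> - 1) * ((2 * E) powr - \<alpha> * (real N * (2 * E) powr - \<alpha>))) * Gamma_tail L"
      unfolding lip c_def by (simp only: mult_ac)
    finally show ?thesis unfolding E2 .
  qed
  have 3: "?X * (distortion L powr (4 * \<alpha>) * dirichlet_S r m (f x y)
        / ((bump_mass \<alpha> A)\<^sup>2 * (real N)\<^sup>2 * real N powr (2 * \<alpha>))
        * (bump_sum \<alpha> N * (\<Prod>z\<in>UNIV - {x, y}. site_sum z)))
     = (1 + (real CARD('s) * real L + 1) / (2 * ?d) / real N) powr (4 * \<alpha>)
        * dirichlet_S r m (f x y) / (bump_mass \<alpha> A)\<^sup>2 * (bump_sum \<alpha> N / real N)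
        * (\<Prod>z\<in>UNIV - {x, y}. site_sum z)" for x y
  proof -
    have dist: "distortion L = 1 + (real CARD('s) * real L + 1) / (2 * ?d) / real N"
      by (simp add: distortion_def E_def)
    have X: "?X = real N * real N powr (2 * \<alpha>)" using N_pos by (simp add: powr_add)
    have key: "real N * t * (p * D / (q * (real N)\<^sup>2 * t) * (b * P)) = p * D / q * (b / real N) * P"
      if "t \<noteq> 0" for t p D q b P :: real
      using that N_pos by (simp add: power2_eq_square)
    show ?thesis unfolding dist X using N_pos by (intro key) simp
  qed
  have "?X * energy (N - 1) trial \<le> ?X * (lipschitz\<^sup>2 * rate_sum * (real CARD('s) * (\<rho> powr (2 * E) * \<Gamma> ^ CARD('s)))
    + lipschitz\<^sup>2 * rate_sum * (real CARD('s) ^ 3 *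
       ((2 * E) powr - \<alpha> * (real N * (2 * E) powr - \<alpha> * (Gamma_tail L * \<Gamma> ^ CARD('s)))))
    + (\<Sum>x\<in>S1. \<Sum>y\<in>S2. distortion L powr (4 * \<alpha>) * dirichlet_S r m (f x y)
        / ((bump_mass \<alpha> A)\<^sup>2 * (real N)\<^sup>2 * real N powr (2 * \<alpha>))
        * (bump_sum \<alpha> N * (\<Prod>z\<in>UNIV - {x, y}. site_sum z))))"
    by (intro mult_left_mono energy_trial_le[OF L \<rho>]) auto
  then show ?thesis
    unfolding distrib_left 1 2 sum_distrib_left 3 .
qed

end

section \<open>The limit\<close>

context zero_range
begin

lemma scaled_dirichlet_N:
  assumes "0 < N"
  shows "real N powr (1 + \<alpha>) * dirichlet_N \<alpha> r m N F
    = real N powr (1 + 2 * \<alpha>) * energy (N - 1) F / (M_star m * Z_N \<alpha> m N)"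
proof -
  obtain M where N: "N = Suc M" using assms by (cases N) auto
  have "1 + 2 * \<alpha> = (1 + \<alpha>) + \<alpha>" by simp
  then have "real N powr (1 + 2 * \<alpha>) = real N powr (1 + \<alpha>) * real N powr \<alpha>"
    by (simp only: powr_add)
  then show ?thesis
    unfolding N dirichlet_N_eq_energy by (simp add: mult.commute)
qed

lemma cap_N_le:
  assumes "0 < N" "\<And>\<eta>. \<eta> \<in> B1 \<Longrightarrow> F \<eta> = 1" "\<And>\<eta>. \<eta> \<in> B0 \<Longrightarrow> F \<eta> = 0"
  shows "cap_N \<alpha> r m N B1 B0 \<le> dirichlet_N \<alpha> r m N F"
proof -
  have "0 \<le> dirichlet_N \<alpha> r m N F" for F
    using dirichlet_N_nonneg[of "N - 1" F] assms(1) by simp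
  then show ?thesis
    unfolding cap_N_def using assms(2,3) by (intro cInf_lower) (auto intro!: bdd_belowI[of _ 0])
qed

lemma Z_N_nonneg: "0 \<le> Z_N \<alpha> m N"
  unfolding Z_N_eq by (simp add: sum_nonneg)

lemma bump_sum_LIMSEQ: "(\<lambda>N. bump_sum \<alpha> N / real N) \<longlonglongrightarrow> I_alpha \<alpha>"
  unfolding bump_sum_def I_alpha_eq
  using alpha by (intro riemann_sum_LIMSEQ continuous_on_bump) auto

lemma site_sum_prod_pos: "0 < (\<Prod>z\<in>B. site_sum z)"
  using site_sum_ge_1 by (intro prod_pos) (auto intro: less_le_trans[OF zero_less_one])

definition Z_limit :: real where
  "Z_limit = (\<Sum>x\<in>S_star m. \<Prod>z\<in>UNIV - {x}. site_sum z)"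

lemma Z_limit_pos:
  assumes "S_star m \<noteq> {}" shows "0 < Z_limit"
  unfolding Z_limit_def using assms by (intro sum_pos site_sum_prod_pos) auto

text \<open>Sites of \<open>S_star m\<close> have \<open>site_sum z = \<Gamma>\<close>. So with \<open>P\<close> the product of all site sums, \<open>Z_limit\<close> is
  \<open>kappa_star m * P / \<Gamma>\<close>, the products without \<open>x\<close> and \<open>y\<close> are \<open>P / \<Gamma>\<^sup>2\<close>, and \<open>P\<close> cancels.\<close>

lemma limit_constant_eq:
  assumes "S1 \<subseteq> S_star m" "S2 \<subseteq> S_star m" "S1 \<inter> S2 = {}" "S_star m \<noteq> {}"
  shows "(\<Sum>x\<in>S1. \<Sum>y\<in>S2. cap_S r m x y * (\<Prod>z\<in>UNIV - {x, y}. site_sum z)) / (M_star m * Z_limit * I_alpha \<alpha>)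
    = 1 / (M_star m * real (kappa_star m) * \<Gamma> * I_alpha \<alpha>) * (\<Sum>x\<in>S1. \<Sum>y\<in>S2. cap_S r m x y)"
proof -
  define P where "P = (\<Prod>z\<in>UNIV. site_sum z)"
  have P: "0 < P" unfolding P_def by (rule site_sum_prod_pos)
  have G: "0 < \<Gamma>" using Gamma_ge_1 by linarith
  have k: "0 < real (kappa_star m)" using assms(4) by (simp add: kappa_star_def card_gt_0_iff)
  have one: "(\<Prod>z\<in>UNIV - {x}. site_sum z) = P / \<Gamma>" if "x \<in> S_star m" for x
    using prod.remove[of UNIV x site_sum] that G by (simp add: P_def site_sum_star)
  have "(\<Prod>z\<in>UNIV - {x, y}. site_sum z) = P / \<Gamma>\<^sup>2" if "x \<in> S1" "y \<in> S2" for x y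
  proof -
    have xy: "x \<in> S_star m" "y \<in> S_star m" "x \<noteq> y" using that assms by auto
    have "UNIV - {x} - {y} = UNIV - {x, y}" by auto
    then have "(\<Prod>z\<in>UNIV - {x}. site_sum z) = site_sum y * (\<Prod>z\<in>UNIV - {x, y}. site_sum z)"
      using prod.remove[of "UNIV - {x}" y site_sum] xy by simp
    then show ?thesis using one[OF xy(1)] G by (simp add: site_sum_star[OF xy(2)] power2_eq_square field_simps)
  qed
  then have "(\<Sum>x\<in>S1. \<Sum>y\<in>S2. cap_S r m x y * (\<Prod>z\<in>UNIV - {x, y}. site_sum z))
      = (\<Sum>x\<in>S1. \<Sum>y\<in>S2. cap_S r m x y) * (P / \<Gamma>\<^sup>2)"
    by (simp add: sum_distrib_right sum_divide_distrib)
  moreover have "Z_limit = real (kappa_star m) * (P / \<Gamma>)"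
    by (simp add: Z_limit_def one kappa_star_def)
  ultimately show ?thesis using P G k by (simp add: power2_eq_square)
qed

text \<open>For large \<open>N\<close> the ends of the paths of the lower bound lie in the wells: they have at most
  \<open>(CARD('s) + 1) * L + 1\<close> particles off the condensate, and at most \<open>L\<close> on each site off \<open>S_star m\<close>.\<close>

lemma scaled_cap_N_ge:
  assumes S: "S1 \<subseteq> S_star m" "S2 \<subseteq> S_star m" "S1 \<inter> S2 = {}"
    and l_inf: "filterlim l at_top sequentially" and l_small: "(\<lambda>N. l N / real N) \<longlonglongrightarrow> 0"
    and b_inf: "\<And>z. z \<notin> S_star m \<Longrightarrow> filterlim (\<lambda>N. b N z) at_top sequentially"
  shows "\<forall>\<^sub>F N in sequentially.
    (\<Sum>x\<in>S1. \<Sum>y\<in>S2. cap_S r m x y * (\<Prod>z\<in>UNIV - {x, y}. \<Sum>n\<le>L. site_weight z n))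
      / (M_star m * Z_N \<alpha> m N * (bump_sum \<alpha> N / real N))
    \<le> real N powr (1 + \<alpha>) * cap_N \<alpha> r m N (wells m l b N S1) (wells m l b N S2)"
proof -
  have "\<forall>\<^sub>F N in sequentially. real ((CARD('s) + 1) * L) + 1 \<le> l N"
    using l_inf by (simp add: filterlim_at_top)
  moreover have "\<forall>\<^sub>F N in sequentially. l N / real N < 1 / 2"
    using l_small by (rule order_tendstoD) simp
  moreover have "\<forall>\<^sub>F N in sequentially. \<forall>z\<in>- S_star m. real L \<le> b N z"
    using b_inf by (intro eventually_ball_finite) (auto simp: filterlim_at_top)
  moreover have "\<forall>\<^sub>F N in sequentially. (CARD('s) + 2) * L + 1 < N"
    by (rule eventually_gt_at_top)
  ultimately show ?thesis
  proof eventually_elim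
    case (elim N)
    let ?B1 = "wells m l b N S1" and ?B0 = "wells m l b N S2"
    let ?Q = "\<Sum>x\<in>S1. \<Sum>y\<in>S2. cap_S r m x y * (\<Prod>z\<in>UNIV - {x, y}. \<Sum>n\<le>L. site_weight z n)"
    define M where "M = N - 1"
    have N: "N = Suc M" and M: "(CARD('s) + 2) * L < M" using elim(4) by (auto simp: M_def)
    have P: "0 < real N powr (1 + \<alpha>)" using N by simp
    have half: "2 * l N < real N" using elim(2) N by (simp add: field_simps)
    have in_well: "\<eta> \<in> well m l b N x"
      if "\<eta> \<in> configs (Suc M)" "M - (CARD('s) + 1) * L \<le> \<eta> x" "\<And>z. z \<notin> S_star m \<Longrightarrow> \<eta> z \<le> L" for \<eta> x
    proof -
      have "real N \<le> real (\<eta> x) + real ((CARD('s) + 1) * L) + 1"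
        using that(2) unfolding N by linarith
      then have "real N - l N \<le> real (\<eta> x)" using elim(1) by linarith
      moreover have "real (\<eta> z) \<le> b N z" if "z \<notin> S_star m" for z
        using \<open>\<And>z. z \<notin> S_star m \<Longrightarrow> \<eta> z \<le> L\<close>[OF that] elim(3) that
        by (meson ComplI of_nat_mono order_trans)
      ultimately show ?thesis using that(1) N by (simp add: well_def)
    qed
    have disj: "\<eta> \<notin> ?B0" if \<eta>1: "\<eta> \<in> ?B1" for \<eta>
    proof
      assume "\<eta> \<in> ?B0"
      with \<eta>1 obtain x y where xy: "x \<in> S1" "y \<in> S2" "\<eta> \<in> well m l b N x" "\<eta> \<in> well m l b N y"
        by (auto simp: wells_def)
      then have "x \<noteq> y" using S by auto
      then have "\<eta> x + \<eta> y \<le> N"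
        using configs_coordinates[of \<eta> N x y] xy by (auto simp: well_def)
      then have "real (\<eta> x) + real (\<eta> y) \<le> real N" by (simp flip: of_nat_add)
      then show False using xy half by (simp add: well_def)
    qed
    have "?Q / (M_star m * Z_N \<alpha> m N * (bump_sum \<alpha> N / real N)) \<le> real N powr (1 + \<alpha>) * dirichlet_N \<alpha> r m N F"
      if F: "\<forall>\<eta>\<in>?B1. F \<eta> = 1" "\<forall>\<eta>\<in>?B0. F \<eta> = 0" for F
    proof -
      have "?Q / (real N powr (2 * \<alpha>) * bump_sum \<alpha> N) \<le> energy M F"
        unfolding N
      proof (rule energy_ge[OF S M])
        fix \<eta> x assume "\<eta> \<in> configs (Suc M)" "M - (CARD('s) + 1) * L \<le> \<eta> x"
          and "\<And>z. z \<notin> S_star m \<Longrightarrow> \<eta> z \<le> L"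
        then have w: "\<eta> \<in> well m l b N x" by (rule in_well)
        show "x \<in> S1 \<Longrightarrow> F \<eta> = 1" using F(1) w by (auto simp: wells_def)
        show "x \<in> S2 \<Longrightarrow> F \<eta> = 0" using F(2) w by (auto simp: wells_def)
      qed
      then have "real N powr (1 + 2 * \<alpha>) * (?Q / (real N powr (2 * \<alpha>) * bump_sum \<alpha> N)) / (M_star m * Z_N \<alpha> m N)
          \<le> real N powr (1 + 2 * \<alpha>) * energy M F / (M_star m * Z_N \<alpha> m N)"
        using M_star_pos Z_N_nonneg by (intro divide_right_mono mult_left_mono) auto
      moreover have "real N powr (1 + 2 * \<alpha>) * (?Q / (real N powr (2 * \<alpha>) * bump_sum \<alpha> N)) / (M_star m * Z_N \<alpha> m N)
          = ?Q / (M_star m * Z_N \<alpha> m N * (bump_sum \<alpha> N / real N))"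
        using N by (simp add: powr_add mult_ac)
      ultimately show ?thesis using scaled_dirichlet_N[of N F] N by simp
    qed
    then have *: "?Q / (M_star m * Z_N \<alpha> m N * (bump_sum \<alpha> N / real N)) / real N powr (1 + \<alpha>) \<le> dirichlet_N \<alpha> r m N F"
      if "\<forall>\<eta>\<in>?B1. F \<eta> = 1" "\<forall>\<eta>\<in>?B0. F \<eta> = 0" for F
      using that by (simp only: pos_divide_le_eq[OF P] mult.commute[of "dirichlet_N \<alpha> r m N F"])
    have "?Q / (M_star m * Z_N \<alpha> m N * (bump_sum \<alpha> N / real N)) / real N powr (1 + \<alpha>) \<le> cap_N \<alpha> r m N ?B1 ?B0"
      unfolding cap_N_def
    proof (rule cInf_greatest)
      show "{dirichlet_N \<alpha> r m N F |F. (\<forall>\<eta>\<in>?B1. F \<eta> = 1) \<and> (\<forall>\<eta>\<in>?B0. F \<eta> = 0)} \<noteq> {}"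
        using disj by (auto intro!: exI[of _ "\<lambda>\<eta>. of_bool (\<eta> \<in> ?B1)"])
    qed (use * in auto)
    then show ?case
      by (simp only: pos_divide_le_eq[OF P] mult.commute[of "cap_N \<alpha> r m N ?B1 ?B0"])
  qed
qed

text \<open>For large \<open>N\<close> the trial function is admissible, because \<open>l N\<close> is below its threshold \<open>E\<close>, which is
  proportional to \<open>N\<close>.\<close>

lemma scaled_cap_N_le:
  assumes S: "S1 \<union> S2 = S_star m" "S1 \<inter> S2 = {}"
    and f: "\<And>x y z. 0 \<le> f x y z" "\<And>x y z. f x y z \<le> 1"
      "\<And>x y. x \<in> S1 \<Longrightarrow> y \<in> S2 \<Longrightarrow> f x y x = 1" "\<And>x y. x \<in> S1 \<Longrightarrow> y \<in> S2 \<Longrightarrow> f x y y = 0"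
    and A: "0 < A" "A < 1 / 2"
    and \<rho>: "0 < \<rho>" "\<rho> < 1" "\<And>x. x \<notin> S_star m \<Longrightarrow> m_star m x \<le> \<rho>"
    and l_small: "(\<lambda>N. l N / real N) \<longlonglongrightarrow> 0"
  defines "c \<equiv> ((real CARD('s) + real CARD('s) ^ 3) / bump_mass \<alpha> A)\<^sup>2 * rate_sum * \<Gamma> ^ CARD('s)"
  shows "\<forall>\<^sub>F N in sequentially.
    real N powr (1 + \<alpha>) * cap_N \<alpha> r m N (wells m l b N S1) (wells m l b N S2) \<le>
    (c * real CARD('s) * (real N powr (2 * \<alpha> - 1) * \<rho> powr (2 * (A / margin) * real N))
    + c * real CARD('s) ^ 3 * (2 * (A / margin)) powr - (2 * \<alpha>) * Gamma_tail L
    + (\<Sum>x\<in>S1. \<Sum>y\<in>S2. (1 + (real CARD('s) * real L + 1) / (2 * (A / margin)) / real N) powr (4 * \<alpha>)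
        * dirichlet_S r m (f x y) / (bump_mass \<alpha> A)\<^sup>2 * (bump_sum \<alpha> N / real N)
        * (\<Prod>z\<in>UNIV - {x, y}. site_sum z))) / (M_star m * Z_N \<alpha> m N)"
proof -
  let ?d = "A / margin"
  have d: "0 < ?d" using A margin_pos by simp
  have "\<forall>\<^sub>F N in sequentially. l N / real N < ?d"
    using l_small d by (rule order_tendstoD)
  moreover have "\<forall>\<^sub>F N in sequentially. (real L + 1) / ?d \<le> real N"
    using filterlim_real_sequentially by (simp add: filterlim_at_top)
  moreover have "\<forall>\<^sub>F N in sequentially. 0 < N" by (rule eventually_gt_at_top)
  ultimately show ?thesis
  proof eventually_elim
    case (elim N)
    interpret trial_function \<alpha> r m S1 S2 f A N
      using S f A elim(3) by unfold_locales auto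
    have "real L + 1 \<le> real N * ?d" using elim(2) by (simp only: pos_divide_le_eq[OF d])
    then have LE: "real L + 1 \<le> E" by (simp add: E_def mult.commute)
    have lE: "l N < E" using elim(1,3) by (simp add: E_def pos_divide_less_eq)
    have trial_well: "trial \<eta> = of_bool (x \<in> S1)" if \<eta>: "\<eta> \<in> well m l b N x" for \<eta> x
    proof (rule trial_corner)
      show "\<eta> \<in> configs N" using \<eta> by (simp add: well_def)
      fix z assume "z \<noteq> x"
      then have "\<eta> x + \<eta> z \<le> N"
        using configs_coordinates[of \<eta> N x z] \<eta> by (auto simp: well_def)
      then have "real (\<eta> x) + real (\<eta> z) \<le> real N" by (simp flip: of_nat_add)
      moreover have "real N - l N \<le> real (\<eta> x)" using \<eta> by (simp add: well_def)
      ultimately show "real (\<eta> z) \<le> 3 * E" using lE E_pos by linarith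
    qed
    have "cap_N \<alpha> r m N (wells m l b N S1) (wells m l b N S2) \<le> dirichlet_N \<alpha> r m N trial"
    proof (rule cap_N_le[OF elim(3)])
      show "\<eta> \<in> wells m l b N S1 \<Longrightarrow> trial \<eta> = 1" for \<eta>
        using trial_well by (auto simp: wells_def)
      show "\<eta> \<in> wells m l b N S2 \<Longrightarrow> trial \<eta> = 0" for \<eta>
        using trial_well S(2) by (fastforce simp: wells_def)
    qed
    then have "real N powr (1 + \<alpha>) * cap_N \<alpha> r m N (wells m l b N S1) (wells m l b N S2)
        \<le> real N powr (1 + 2 * \<alpha>) * energy (N - 1) trial / (M_star m * Z_N \<alpha> m N)"
      unfolding scaled_dirichlet_N[OF elim(3), symmetric] by (intro mult_left_mono) auto
    also have "\<dots> \<le> (c * real CARD('s) * (real N powr (2 * \<alpha> - 1) * \<rho> powr (2 * (A / margin) * real N))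
    + c * real CARD('s) ^ 3 * (2 * (A / margin)) powr - (2 * \<alpha>) * Gamma_tail L
    + (\<Sum>x\<in>S1. \<Sum>y\<in>S2. (1 + (real CARD('s) * real L + 1) / (2 * (A / margin)) / real N) powr (4 * \<alpha>)
        * dirichlet_S r m (f x y) / (bump_mass \<alpha> A)\<^sup>2 * (bump_sum \<alpha> N / real N)
        * (\<Prod>z\<in>UNIV - {x, y}. site_sum z))) / (M_star m * Z_N \<alpha> m N)"
      unfolding c_def using scaled_energy_trial_le[OF LE \<rho>] M_star_pos Z_N_nonneg
      by (intro divide_right_mono) auto
    finally show ?case .
  qed
qed

text \<open>The same small number \<open>A\<close> serves as width of the plateaus and as allowed excess of the Dirichlet forms of the
  \<open>f x y\<close> over the capacities, so that only one further limit remains.\<close>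

lemma scaled_cap_N_eventually_less:
  assumes S: "S1 \<union> S2 = S_star m" "S1 \<inter> S2 = {}" "S_star m \<noteq> {}"
    and l_small: "(\<lambda>N. l N / real N) \<longlonglongrightarrow> 0"
    and A: "0 < A" "A < 1 / 2"
    and a: "(\<Sum>x\<in>S1. \<Sum>y\<in>S2. (cap_S r m x y + A) * (\<Prod>z\<in>UNIV - {x, y}. site_sum z))
      * I_alpha \<alpha> / (bump_mass \<alpha> A)\<^sup>2 / (M_star m * Z_limit) < a"
  shows "\<forall>\<^sub>F N in sequentially.
    real N powr (1 + \<alpha>) * cap_N \<alpha> r m N (wells m l b N S1) (wells m l b N S2) < a"
proof -
  obtain \<rho> where \<rho>: "0 < \<rho>" "\<rho> < 1" "\<And>x. x \<notin> S_star m \<Longrightarrow> m_star m x \<le> \<rho>"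
    using m_star_off_star by blast
  have "\<exists>f. (\<forall>z. 0 \<le> f z \<and> f z \<le> 1) \<and> (x \<in> S1 \<and> y \<in> S2 \<longrightarrow>
      f x = 1 \<and> f y = 0 \<and> dirichlet_S r m f < cap_S r m x y + A)" for x y
  proof (cases "x \<in> S1 \<and> y \<in> S2")
    case True
    then have "x \<noteq> y" using S by auto
    then show ?thesis by (rule cap_S_near_minimizer[OF _ A(1)]) blast
  qed (auto intro: exI[of _ "\<lambda>_. 0"])
  then obtain f where f: "\<And>x y z. 0 \<le> f x y z" "\<And>x y z. f x y z \<le> 1"
      "\<And>x y. x \<in> S1 \<Longrightarrow> y \<in> S2 \<Longrightarrow> f x y x = 1" "\<And>x y. x \<in> S1 \<Longrightarrow> y \<in> S2 \<Longrightarrow> f x y y = 0"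
      and fD: "\<And>x y. x \<in> S1 \<Longrightarrow> y \<in> S2 \<Longrightarrow> dirichlet_S r m (f x y) < cap_S r m x y + A"
    by metis
  let ?d = "A / margin" and ?k = "real CARD('s)"
  have d: "0 < ?d" using A margin_pos by simp
  have Z: "Z_N \<alpha> m \<longlonglongrightarrow> Z_limit" unfolding Z_limit_def by (rule Z_N_LIMSEQ)
  have MZ: "0 < M_star m * Z_limit" using M_star_pos Z_limit_pos[OF S(3)] by simp
  define c where "c = ((?k + ?k ^ 3) / bump_mass \<alpha> A)\<^sup>2 * rate_sum * \<Gamma> ^ CARD('s)"
  define Q where "Q = (\<Sum>x\<in>S1. \<Sum>y\<in>S2. 1 powr (4 * \<alpha>) * dirichlet_S r m (f x y) / (bump_mass \<alpha> A)\<^sup>2 * I_alpha \<alpha>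
        * (\<Prod>z\<in>UNIV - {x, y}. site_sum z))"
  show ?thesis
  proof (rule eventually_less_iterated_limit[where F = sequentially
      and hi = "\<lambda>L N. (c * ?k * (real N powr (2 * \<alpha> - 1) * \<rho> powr (2 * ?d * real N))
        + c * ?k ^ 3 * (2 * ?d) powr - (2 * \<alpha>) * Gamma_tail L
        + (\<Sum>x\<in>S1. \<Sum>y\<in>S2. (1 + (?k * real L + 1) / (2 * ?d) / real N) powr (4 * \<alpha>)
        * dirichlet_S r m (f x y) / (bump_mass \<alpha> A)\<^sup>2 * (bump_sum \<alpha> N / real N)
        * (\<Prod>z\<in>UNIV - {x, y}. site_sum z))) / (M_star m * Z_N \<alpha> m N)"
      and hi' = "\<lambda>L. (c * ?k * 0 + c * ?k ^ 3 * (2 * ?d) powr - (2 * \<alpha>) * Gamma_tail L + Q) / (M_star m * Z_limit)"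
      and l = "(c * ?k * 0 + c * ?k ^ 3 * (2 * ?d) powr - (2 * \<alpha>) * 0 + Q) / (M_star m * Z_limit)"])
    fix L
    show "\<forall>\<^sub>F N in sequentially.
      real N powr (1 + \<alpha>) * cap_N \<alpha> r m N (wells m l b N S1) (wells m l b N S2)
      \<le> (c * ?k * (real N powr (2 * \<alpha> - 1) * \<rho> powr (2 * ?d * real N))
        + c * ?k ^ 3 * (2 * ?d) powr - (2 * \<alpha>) * Gamma_tail L
        + (\<Sum>x\<in>S1. \<Sum>y\<in>S2. (1 + (?k * real L + 1) / (2 * ?d) / real N) powr (4 * \<alpha>)
        * dirichlet_S r m (f x y) / (bump_mass \<alpha> A)\<^sup>2 * (bump_sum \<alpha> N / real N)
        * (\<Prod>z\<in>UNIV - {x, y}. site_sum z))) / (M_star m * Z_N \<alpha> m N)"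
      unfolding c_def by (rule scaled_cap_N_le[OF S(1,2) f A \<rho> l_small])
    have "(\<lambda>N. 1 + (?k * real L + 1) / (2 * ?d) / real N) \<longlonglongrightarrow> 1 + 0"
      by (intro tendsto_intros tendsto_divide_0[OF tendsto_const] filterlim_real_sequentially[THEN filterlim_at_top_imp_at_infinity])
    then have one: "(\<lambda>N. 1 + (?k * real L + 1) / (2 * ?d) / real N) \<longlonglongrightarrow> 1" by simp
    show "(\<lambda>N. (c * ?k * (real N powr (2 * \<alpha> - 1) * \<rho> powr (2 * ?d * real N))
        + c * ?k ^ 3 * (2 * ?d) powr - (2 * \<alpha>) * Gamma_tail L
        + (\<Sum>x\<in>S1. \<Sum>y\<in>S2. (1 + (?k * real L + 1) / (2 * ?d) / real N) powr (4 * \<alpha>)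
        * dirichlet_S r m (f x y) / (bump_mass \<alpha> A)\<^sup>2 * (bump_sum \<alpha> N / real N)
        * (\<Prod>z\<in>UNIV - {x, y}. site_sum z))) / (M_star m * Z_N \<alpha> m N))
      \<longlonglongrightarrow> (c * ?k * 0 + c * ?k ^ 3 * (2 * ?d) powr - (2 * \<alpha>) * Gamma_tail L + Q) / (M_star m * Z_limit)"
      unfolding Q_def
      by (intro tendsto_divide tendsto_add tendsto_mult tendsto_const tendsto_sum tendsto_powr one
          bump_sum_LIMSEQ Z powr_mult_exponential_LIMSEQ) (use \<rho> d MZ bump_mass_pos[of \<alpha> A] A alpha in auto)
  next
    show "(\<lambda>L. (c * ?k * 0 + c * ?k ^ 3 * (2 * ?d) powr - (2 * \<alpha>) * Gamma_tail L + Q) / (M_star m * Z_limit))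
      \<longlonglongrightarrow> (c * ?k * 0 + c * ?k ^ 3 * (2 * ?d) powr - (2 * \<alpha>) * 0 + Q) / (M_star m * Z_limit)"
      using MZ by (intro tendsto_intros Gamma_tail_LIMSEQ) auto
  next
    let ?s = "\<Sum>x\<in>S1. \<Sum>y\<in>S2. (cap_S r m x y + A) * (\<Prod>z\<in>UNIV - {x, y}. site_sum z)"
    have "Q = (\<Sum>x\<in>S1. \<Sum>y\<in>S2. dirichlet_S r m (f x y) * (\<Prod>z\<in>UNIV - {x, y}. site_sum z))
        * (I_alpha \<alpha> / (bump_mass \<alpha> A)\<^sup>2)"
      by (simp add: Q_def sum_distrib_left sum_divide_distrib mult_ac)
    also have "\<dots> \<le> ?s * (I_alpha \<alpha> / (bump_mass \<alpha> A)\<^sup>2)"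
      using fD I_alpha_pos[of \<alpha>] alpha site_sum_prod_pos
      by (intro mult_right_mono sum_mono) (auto simp: less_imp_le)
    finally have "Q / (M_star m * Z_limit) \<le> ?s * I_alpha \<alpha> / (bump_mass \<alpha> A)\<^sup>2 / (M_star m * Z_limit)"
      using MZ by (intro divide_right_mono) auto
    then show "(c * ?k * 0 + c * ?k ^ 3 * (2 * ?d) powr - (2 * \<alpha>) * 0 + Q) / (M_star m * Z_limit) < a"
      using a by simp
  qed simp
qed

lemma scaled_cap_N_LIMSEQ:
  assumes S: "S1 \<union> S2 = S_star m" "S1 \<inter> S2 = {}" "S_star m \<noteq> {}"
    and l_inf: "filterlim l at_top sequentially" and l_small: "(\<lambda>N. l N / real N) \<longlonglongrightarrow> 0"
    and b_inf: "\<And>z. z \<notin> S_star m \<Longrightarrow> filterlim (\<lambda>N. b N z) at_top sequentially"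
  shows "(\<lambda>N. real N powr (1 + \<alpha>) * cap_N \<alpha> r m N (wells m l b N S1) (wells m l b N S2))
    \<longlonglongrightarrow> (\<Sum>x\<in>S1. \<Sum>y\<in>S2. cap_S r m x y * (\<Prod>z\<in>UNIV - {x, y}. site_sum z))
      / (M_star m * Z_limit * I_alpha \<alpha>)" (is "?X \<longlonglongrightarrow> ?lim")
proof (rule order_tendstoI)
  have Z: "Z_N \<alpha> m \<longlonglongrightarrow> Z_limit" unfolding Z_limit_def by (rule Z_N_LIMSEQ)
  have pos: "0 < M_star m" "0 < Z_limit" "0 < I_alpha \<alpha>"
    using M_star_pos Z_limit_pos[OF S(3)] I_alpha_pos alpha by auto
  have S': "S1 \<subseteq> S_star m" "S2 \<subseteq> S_star m" using S by auto
  fix a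
  show "\<forall>\<^sub>F N in sequentially. a < ?X N" if "a < ?lim"
  proof (rule eventually_greater_iterated_limit[where F = sequentially,
      OF _ scaled_cap_N_ge[OF S' S(2) l_inf l_small b_inf] _ _ that])
    fix L
    show "(\<lambda>N. (\<Sum>x\<in>S1. \<Sum>y\<in>S2. cap_S r m x y * (\<Prod>z\<in>UNIV - {x, y}. \<Sum>n\<le>L. site_weight z n))
      / (M_star m * Z_N \<alpha> m N * (bump_sum \<alpha> N / real N)))
      \<longlonglongrightarrow> (\<Sum>x\<in>S1. \<Sum>y\<in>S2. cap_S r m x y * (\<Prod>z\<in>UNIV - {x, y}. \<Sum>n\<le>L. site_weight z n))
      / (M_star m * Z_limit * I_alpha \<alpha>)"
      using pos by (intro tendsto_intros Z bump_sum_LIMSEQ) auto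
  next
    show "(\<lambda>L. (\<Sum>x\<in>S1. \<Sum>y\<in>S2. cap_S r m x y * (\<Prod>z\<in>UNIV - {x, y}. \<Sum>n\<le>L. site_weight z n))
      / (M_star m * Z_limit * I_alpha \<alpha>)) \<longlonglongrightarrow> ?lim"
      using pos by (intro tendsto_intros site_sum_LIMSEQ) auto
  qed auto
  show "\<forall>\<^sub>F N in sequentially. ?X N < a" if "?lim < a"
  proof -
    let ?u = "\<lambda>A. (\<Sum>x\<in>S1. \<Sum>y\<in>S2. (cap_S r m x y + A) * (\<Prod>z\<in>UNIV - {x, y}. site_sum z))
      * I_alpha \<alpha> / (bump_mass \<alpha> A)\<^sup>2 / (M_star m * Z_limit)"
    have "(?u \<longlongrightarrow> (\<Sum>x\<in>S1. \<Sum>y\<in>S2. (cap_S r m x y + 0) * (\<Prod>z\<in>UNIV - {x, y}. site_sum z))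
      * I_alpha \<alpha> / (I_alpha \<alpha>)\<^sup>2 / (M_star m * Z_limit)) (at_right 0)"
      using pos alpha by (intro tendsto_intros bump_mass_tendsto) auto
    also have "(\<Sum>x\<in>S1. \<Sum>y\<in>S2. (cap_S r m x y + 0) * (\<Prod>z\<in>UNIV - {x, y}. site_sum z))
      * I_alpha \<alpha> / (I_alpha \<alpha>)\<^sup>2 / (M_star m * Z_limit) = ?lim"
      using pos by (simp add: power2_eq_square mult_ac)
    finally have "\<forall>\<^sub>F A in at_right 0. ?u A < a" using that by (rule order_tendstoD)
    moreover have "\<forall>\<^sub>F A in at_right (0 :: real). A \<in> {0<..<1 / 2}"
      by (rule eventually_at_right_real) simp
    ultimately have "\<forall>\<^sub>F A in at_right (0 :: real). ?u A < a \<and> A \<in> {0<..<1 / 2}"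
      by (rule eventually_conj)
    then obtain A where "?u A < a" "0 < A" "A < 1 / 2"
      using eventually_happens'[OF trivial_limit_at_right_real] by auto
    then show ?thesis by (intro scaled_cap_N_eventually_less[OF S l_small]) auto
  qed
qed

end

theorem theorem2p2:
  fixes \<alpha> :: real
    and r :: "'s::finite \<Rightarrow> 's \<Rightarrow> real"
    and m :: "'s pmf"
    and l :: "nat \<Rightarrow> real"
    and b :: "nat \<Rightarrow> 's \<Rightarrow> real"
    and S1 S2 :: "'s set"
  assumes "CARD('s) \<ge> 2"
    and "\<alpha> > 1"
    and "jump_rates r"
    and "irreducible_rates r"
    and "reversible_rates r m"
    and "kappa_star m \<ge> 2"
    and "filterlim l at_top sequentially"
    and "(\<lambda>N. l N / real N) \<longlonglongrightarrow> 0"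
    and "\<And>z. z \<in> UNIV - S_star m \<Longrightarrow> filterlim (\<lambda>N. b N z) at_top sequentially"
    and "S1 \<noteq> {}"
    and "S1 \<subset> S_star m"
    and "S2 = S_star m - S1"
  shows "(\<lambda>N. real N powr (1 + \<alpha>) * cap_N \<alpha> r m N (wells m l b N S1) (wells m l b N S2))
           \<longlonglongrightarrow> 1 / (M_star m * real (kappa_star m) * Gamma_alpha \<alpha> * I_alpha \<alpha>)
                * (\<Sum>x\<in>S1. \<Sum>y\<in>S2. cap_S r m x y)"
proof -
  interpret zero_range \<alpha> r m using assms(2,3) by unfold_locales
  have S: "S1 \<union> S2 = S_star m" "S1 \<inter> S2 = {}" "S_star m \<noteq> {}" "S1 \<subseteq> S_star m" "S2 \<subseteq> S_star m"
    using assms(11,12) by auto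
  show ?thesis
    unfolding limit_constant_eq[OF S(4,5,2,3), symmetric]
    using assms(7-9) by (intro scaled_cap_N_LIMSEQ S(1-3)) auto
qed

end
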